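(* Let $W$ be the Weyl group of type $B_n$ (equivalently $C_n$), $n\ge 2$, with Coxeter number $h=2n$. Then there exists an admissible hsop $\Theta$ such that the subvariety $V^\Theta\subset V$ consists of $(h+1)^n$ distinct points and there is a $W\times C$-equivariant bijection between $V^\Theta$ and $\mathsf{Park}^{NC}_W$.
   Context: $W$ is the hyperoctahedral group of $n\times n$ signed permutation matrices acting on $V=\mathbb{R}^n$; we also write $V$ for the complexification $\mathbb{C}^n$. $T\subset W$ is the set of reflections. Fix simple reflections and let $c$ be a Coxeter element (product of the simple reflections in some order); $h$ is its order, $C=\langle c\rangle$, $\omega=e^{2\pi i/h}$. Noncrossing parking functions: $\mathcal{L}$ is the set of all intersections (flats) of reflecting hyperplanes of $W$ (including $V$). For $X\in\mathcal{L}$, $W_X$ is the pointwise stabilizer of $X$. Let $\ell_T(w)$ be the least $k$ such that $w$ is a product of $k$ reflections, and write $u\le_T v$ iff $\ell_T(v)=\ell_T(u)+\ell_T(u^{-1}v)$. $NC(W)=\{w\in W:w\le_T c\}$, identified via the injection $w\mapsto V^w$ with a set of flats (noncrossing flats). $\mathsf{Park}^{NC}_W$ is the set of classes $[w,X]$ with $w\in W$, $X\in NC(W)$, where $[w,X]=[w',X']$ iff $X=X'$ and $wW_X=w'W_X$. $W\times C$ acts by $(v,c^d).[w,X]=[vwc^{-d},c^d(X)]$. Hsops: $\mathbb{C}[V]=\mathbb{C}[x_1,\dots,x_n]$ with $x_1,\dots,x_n$ a basis of $V^*$. An admissible hsop is a homogeneous system of parameters $\Theta=(\theta_1,\dots,\theta_n)$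 in $\mathbb{C}[V]$ with all $\theta_i$ of degree $h+1$ such that the linear isomorphism $V^*\to\mathbb{C}\theta_1+\cdots+\mathbb{C}\theta_n$, $x_i\mapsto\theta_i$, is $W$-equivariant. $V^\Theta\subset V=\mathbb{C}^n$ is the zero locus of the ideal $(\theta_1-x_1,\dots,\theta_n-x_n)$; $W$ acts on it by restriction of its linear action on $V$, and $c^d\in C$ acts by scaling by $\omega^d$. *)

theory Defs
  imports
    "HOL-Analysis.Analysis"
    "HOL-Algebra.Multiplicative_Group"
    "HOL-Library.Poly_Mapping"
begin

section \<open>The hyperoctahedral group\<close>

definition signed_permutation_matrix :: "real^'n^'n \<Rightarrow> bool" where
  "signed_permutation_matrix w \<longleftrightarrow>
     (\<exists>p s. bij p \<and> (\<forall>j. s j \<in> {1, -1}) \<and>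
        w = (\<chi> i j. if i = p j then s j else 0))"

definition hyperoctahedral :: "(real^'n^'n) monoid" ("\<W>") where
  "\<W> = \<lparr>carrier = {w. signed_permutation_matrix w}, mult = (**), one = mat 1\<rparr>"

definition refl_matrix :: "real^'n \<Rightarrow> real^'n^'n" where
  "refl_matrix a = matrix (\<lambda>x. x - (2 * (x \<bullet> a) / (a \<bullet> a)) *\<^sub>R a)"

definition reflections :: "(real^'n^'n) set" where
  "reflections = {t \<in> carrier \<W>. \<exists>a. a \<noteq> 0 \<and> t = refl_matrix a}"

text \<open>The roots of type B. Those of type C differ only in the length of the first
  family, and therefore give the same simple reflections.\<close>

definition roots_B :: "(real^'n) set" where
  "roots_B = {axis i s | i s. s \<in> {1, -1}} \<union>
     {axis i s + axis j t | i j s t. i \<noteq> j \<and> s \<in> {1, -1} \<and> t \<in> {1, -1}}"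

definition simple_system :: "(real^'n) set \<Rightarrow> bool" where
  "simple_system D \<longleftrightarrow> D \<subseteq> roots_B \<and> independent D \<and>
     (\<forall>b\<in>roots_B. \<exists>k. (\<forall>a\<in>D. 0 \<le> k a) \<and>
        (b = (\<Sum>a\<in>D. k a *\<^sub>R a) \<or> b = - (\<Sum>a\<in>D. k a *\<^sub>R a)))"

definition coxeter_element :: "real^'n^'n \<Rightarrow> bool" where
  "coxeter_element c \<longleftrightarrow>
     (\<exists>as. distinct as \<and> simple_system (set as) \<and>
        c = foldr (\<lambda>a w. refl_matrix a \<otimes>\<^bsub>\<W>\<^esub> w) as \<one>\<^bsub>\<W>\<^esub>)"


section \<open>Noncrossing parking functions\<close>

definition refl_length :: "real^'n^'n \<Rightarrow> nat" where
  "refl_length w = (LEAST k. \<exists>ts. length ts = k \<and> set ts \<subseteq> reflections \<and>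
     w = foldr (\<lambda>t u. t \<otimes>\<^bsub>\<W>\<^esub> u) ts \<one>\<^bsub>\<W>\<^esub>)"

definition abs_le :: "real^'n^'n \<Rightarrow> real^'n^'n \<Rightarrow> bool" (infix "\<le>\<^sub>T" 50) where
  "u \<le>\<^sub>T v \<longleftrightarrow> refl_length v = refl_length u + refl_length (inv\<^bsub>\<W>\<^esub> u \<otimes>\<^bsub>\<W>\<^esub> v)"

definition NC :: "real^'n^'n \<Rightarrow> (real^'n^'n) set" where
  "NC c = {w \<in> carrier \<W>. w \<le>\<^sub>T c}"

definition fixed_space :: "real^'n^'n \<Rightarrow> (real^'n) set" where
  "fixed_space w = {x. w *v x = x}"

definition NC_flats :: "real^'n^'n \<Rightarrow> (real^'n) set set" where
  "NC_flats c = fixed_space ` NC c"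

definition stabilizer :: "(real^'n) set \<Rightarrow> (real^'n^'n) set" where
  "stabilizer X = {w \<in> carrier \<W>. \<forall>x\<in>X. w *v x = x}"

definition park_rel ::
  "real^'n^'n \<Rightarrow> (((real^'n^'n) \<times> (real^'n) set) \<times> ((real^'n^'n) \<times> (real^'n) set)) set" where
  "park_rel c = {((w, X), (w', X')).
     w \<in> carrier \<W> \<and> X \<in> NC_flats c \<and> w' \<in> carrier \<W> \<and> X' \<in> NC_flats c \<and>
     X = X' \<and> w <#\<^bsub>\<W>\<^esub> stabilizer X = w' <#\<^bsub>\<W>\<^esub> stabilizer X'}"

definition park_class ::
  "real^'n^'n \<Rightarrow> real^'n^'n \<Rightarrow> (real^'n) set \<Rightarrow> ((real^'n^'n) \<times> (real^'n) set) set" where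
  "park_class c w X = park_rel c `` {(w, X)}"

definition Park :: "real^'n^'n \<Rightarrow> ((real^'n^'n) \<times> (real^'n) set) set set" where
  "Park c = (carrier \<W> \<times> NC_flats c) // park_rel c"


section \<open>Polynomials on the reflection representation\<close>

text \<open>An element of \<open>\<complex>[V]\<close> maps each exponent vector to its coefficient; the
  variable \<open>x\<^sub>i\<close> is the \<open>i\<close>-th coordinate function on \<open>V = \<complex>\<^sup>n\<close>.\<close>

type_synonym 'n cpoly = "('n \<Rightarrow>\<^sub>0 nat) \<Rightarrow>\<^sub>0 complex"

definition Const :: "complex \<Rightarrow> 'n cpoly" where
  "Const a = Poly_Mapping.single 0 a"

definition Var :: "'n \<Rightarrow> 'n cpoly" where
  "Var i = Poly_Mapping.single (Poly_Mapping.single i 1) 1"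

definition peval :: "('n::finite) cpoly \<Rightarrow> complex^'n \<Rightarrow> complex" where
  "peval p v = (\<Sum>m\<in>Poly_Mapping.keys p. Poly_Mapping.lookup p m *
     (\<Prod>i\<in>UNIV. (v $ i) ^ Poly_Mapping.lookup m i))"

definition psubst :: "('n::finite \<Rightarrow> 'n cpoly) \<Rightarrow> 'n cpoly \<Rightarrow> 'n cpoly" where
  "psubst F p = (\<Sum>m\<in>Poly_Mapping.keys p. Const (Poly_Mapping.lookup p m) *
     (\<Prod>i\<in>UNIV. F i ^ Poly_Mapping.lookup m i))"

definition homogeneous :: "nat \<Rightarrow> ('n::finite) cpoly \<Rightarrow> bool" where
  "homogeneous d p \<longleftrightarrow>
     (\<forall>m\<in>Poly_Mapping.keys p. (\<Sum>i\<in>UNIV. Poly_Mapping.lookup m i) = d)"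

definition linear_forms :: "('n::finite) cpoly set" where
  "linear_forms = {p. homogeneous 1 p}"

text \<open>The contragredient action \<open>(w \<cdot> p)(v) = p (w\<inverse> v)\<close>.\<close>

definition pact :: "real^'n^'n \<Rightarrow> 'n cpoly \<Rightarrow> 'n cpoly" where
  "pact w = psubst (\<lambda>i. \<Sum>j\<in>UNIV. Const (of_real ((inv\<^bsub>\<W>\<^esub> w) $ i $ j)) * Var j)"

text \<open>As many homogeneous elements of positive degree as the Krull dimension of \<open>\<complex>[V]\<close>,
  such that \<open>\<complex>[V]\<close> is a finitely generated module over the subalgebra
  \<open>\<complex>[\<theta>\<^sub>1, \<dots>, \<theta>\<^sub>n]\<close>, which is the range of substitution.\<close>

definition hsop :: "('n::finite \<Rightarrow> 'n cpoly) \<Rightarrow> bool" where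
  "hsop \<Theta> \<longleftrightarrow> (\<forall>i. \<exists>d>0. homogeneous d (\<Theta> i)) \<and>
     (\<exists>B. finite B \<and>
        (\<forall>p. \<exists>q. (\<forall>b\<in>B. q b \<in> range (psubst \<Theta>)) \<and> p = (\<Sum>b\<in>B. q b * b)))"

text \<open>The linear map on \<open>V\<^sup>*\<close> that sends \<open>x\<^sub>i\<close> to \<open>\<theta>\<^sub>i\<close>.\<close>

definition hsop_map :: "('n::finite \<Rightarrow> 'n cpoly) \<Rightarrow> 'n cpoly \<Rightarrow> 'n cpoly" where
  "hsop_map \<Theta> f =
     (\<Sum>i\<in>UNIV. Const (Poly_Mapping.lookup f (Poly_Mapping.single i 1)) * \<Theta> i)"

definition admissible_hsop :: "nat \<Rightarrow> ('n::finite \<Rightarrow> 'n cpoly) \<Rightarrow> bool" where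
  "admissible_hsop h \<Theta> \<longleftrightarrow> hsop \<Theta> \<and> (\<forall>i. homogeneous (h + 1) (\<Theta> i)) \<and>
     inj_on (hsop_map \<Theta>) linear_forms \<and>
     (\<forall>w\<in>carrier \<W>. \<forall>f\<in>linear_forms. hsop_map \<Theta> (pact w f) = pact w (hsop_map \<Theta> f))"

definition parking_ideal :: "('n::finite \<Rightarrow> 'n cpoly) \<Rightarrow> 'n cpoly set" where
  "parking_ideal \<Theta> = {\<Sum>i\<in>UNIV. q i * (\<Theta> i - Var i) | q. True}"

definition parking_locus :: "('n::finite \<Rightarrow> 'n cpoly) \<Rightarrow> (complex^'n) set" where
  "parking_locus \<Theta> = {v. \<forall>p\<in>parking_ideal \<Theta>. peval p v = 0}"


section \<open>Equivariance\<close>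

text \<open>The action of \<open>(u, c\<^sup>d)\<close> on \<open>\<complex>\<^sup>n\<close>, with \<open>c\<^sup>d\<close> scaling by
  \<open>exp (2 \<pi> \<i> d / h)\<close>, where \<open>h\<close> is the order of \<open>c\<close>.\<close>

definition locus_act :: "real^'n^'n \<Rightarrow> real^'n^'n \<Rightarrow> int \<Rightarrow> complex^'n \<Rightarrow> complex^'n" where
  "locus_act c u d v = (exp (2 * of_real pi * \<i> / of_nat (group.ord \<W> c)) powi d) *s
     (map_matrix complex_of_real u *v v)"

text \<open>The \<open>W \<times> C\<close>-action on classes is expressed through arbitrary representatives.\<close>

definition park_equivariant ::
  "real^'n^'n \<Rightarrow> (complex^'n) set \<Rightarrow>
   (complex^'n \<Rightarrow> ((real^'n^'n) \<times> (real^'n) set) set) \<Rightarrow> bool" where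
  "park_equivariant c S f \<longleftrightarrow>
     (\<forall>v\<in>S. \<forall>u\<in>carrier \<W>. \<forall>d::int. \<forall>w\<in>carrier \<W>. \<forall>X\<in>NC_flats c.
        f v = park_class c w X \<longrightarrow>
        f (locus_act c u d v) =
          park_class c (u \<otimes>\<^bsub>\<W>\<^esub> w \<otimes>\<^bsub>\<W>\<^esub> (c [^]\<^bsub>\<W>\<^esub> (- d)))
            ((\<lambda>x. (c [^]\<^bsub>\<W>\<^esub> d) *v x) ` X))"

end

theory Submission
  imports Defs "HOL-Library.Real_Mod"
begin

text \<open>The hsop is \<open>\<theta>\<^sub>i = x\<^sub>i ^ (h + 1)\<close>, whose locus consists of the vectors with entries in
  \<open>{0} \<union> \<mu>\<^sub>h\<close>. A Coxeter element is a single signed cycle, so the vectors \<open>\<plusminus> axis i 1\<close> can be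
  enumerated cyclically as \<open>e 0, e 1, \<dots>\<close> with \<open>c (e m) = e (m + 1)\<close> and \<open>e (m + n) = - e m\<close>.
  A noncrossing element \<open>w\<close> lifts to a permutation of the integers whose cycles do
  not cross and whose finite cycles each fit into \<open>n\<close> consecutive positions. Give \<open>e m\<close> the value \<open>\<omega>\<^sup>s\<close> if its finite cycle starts at \<open>s\<close>, and the
  value 0 if its cycle is infinite. These are the coordinates of a vector of the locus with
  stabilizer \<open>W\<^sub>X\<close>, \<open>X = V\<^sup>w\<close>, and this construction commutes with \<open>c\<close>. Every \<open>W\<close>-orbit of the locus
  contains exactly one such vector: an orbit is given by the numbers \<open>k s\<close> of coordinates
  equal to \<open>\<plusminus> \<omega>\<^sup>s\<close>, and these, read as the sizes of the blocks that start at \<open>s\<close>, determine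
  a unique noncrossing configuration, as for a sequence of stack operations. The bijection
  sends \<open>u v\<close> to \<open>[u, X]\<close> for such a vector \<open>v\<close>.\<close>

section \<open>Noncrossing lifts and their labels\<close>

text \<open>The absolute order becomes accessible through linear algebra: reflection length is the
  codimension of the fixed space and \<open>c\<close> fixes only 0, so \<open>w\<close> is
  noncrossing exactly when every vector splits as \<open>x + y\<close> with \<open>w x = x\<close>
  and \<open>w y = c y\<close>. For the vector \<open>e m\<close> the part \<open>y\<close> solves
  \<open>(c - 1) y = e (g m) - e m\<close>, where \<open>g\<close> is the lift of \<open>w\<close>;
  up to sign it is a sum of consecutive \<open>e j\<close>. This turns noncrossing into stability of
  integer intervals under \<open>g\<close>, the conditions \<open>up\<close> and \<open>down\<close>
  below. On the integers a block has a first element, which is absent on the cycle of length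
  \<open>2 n\<close>. The window \<open>m - n < g m \<le> m + n\<close> is half-open because
  \<open>w (e m) = - e m\<close> has to be an upward step. Labels and signs fit together since
  \<open>\<omega>\<close> to the power \<open>n\<close> is -1. Squares of coordinates detect the
  orbits, and they depend on a label only modulo \<open>n\<close>. Pure powers are equivariant
  because \<open>h + 1\<close> is odd. As simple systems are arbitrary, the cycle structure of
  \<open>c\<close> is derived from the sign condition on roots: exactly one simple root has the form
  plus or minus \<open>axis i 1\<close>, and the others form a tree on the coordinates.\<close>

definition last_such :: "(int \<Rightarrow> bool) \<Rightarrow> int option" where
  "last_such P = (if \<exists>s. P s then Some (GREATEST s. P s) else None)"

lemma int_bounded_greatest:
  fixes P :: "int \<Rightarrow> bool"
  assumes "P s0" and "\<And>s. P s \<Longrightarrow> s \<le> b"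
  shows "\<exists>s. P s \<and> s0 \<le> s \<and> (\<forall>t. P t \<longrightarrow> t \<le> s)"
proof -
  let ?A = "{s. P s \<and> s0 \<le> s}"
  have fin: "finite ?A"
    by (rule finite_subset[of _ "{s0..b}"]) (use assms(2) in auto)
  have ne: "s0 \<in> ?A" using assms(1) by simp
  have "Max ?A \<in> ?A" using fin ne Max_in by blast
  moreover have "t \<le> Max ?A" if "P t" for t
  proof (cases "s0 \<le> t")
    case True
    with that fin show ?thesis by simp
  next
    case False
    then show ?thesis using Max_ge[OF fin ne] by simp
  qed
  ultimately show ?thesis by blast
qed

lemma int_bounded_least:
  fixes P :: "int \<Rightarrow> bool"
  assumes "P s0" and "\<And>s. P s \<Longrightarrow> b \<le> s"
  shows "\<exists>s. P s \<and> s \<le> s0 \<and> (\<forall>t. P t \<longrightarrow> s \<le> t)"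
proof -
  have "P (- (- s0))" using assms(1) by simp
  moreover have "s \<le> - b" if "P (- s)" for s using assms(2)[OF that] by simp
  ultimately obtain s where "P (- s)" "- s0 \<le> s" "\<forall>t. P (- t) \<longrightarrow> t \<le> s"
    using int_bounded_greatest[of "\<lambda>s. P (- s)" "- s0" "- b"] by blast
  moreover from this(3) have "- s \<le> t" if "P t" for t
    using that by (metis minus_le_iff minus_minus)
  ultimately show ?thesis by (intro exI[of _ "- s"]) auto
qed

lemma last_such_eq_Some_iff:
  assumes "\<And>s. P s \<Longrightarrow> s \<le> b"
  shows "last_such P = Some s \<longleftrightarrow> P s \<and> (\<forall>t. P t \<longrightarrow> t \<le> s)"
proof
  assume *: "last_such P = Some s"
  then obtain s0 where "P s0" by (auto simp: last_such_def split: if_splits)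
  then obtain u where u: "P u" "\<forall>t. P t \<longrightarrow> t \<le> u"
    using int_bounded_greatest[of P s0 b] assms by blast
  then have "(GREATEST s. P s) = u" by (intro Greatest_equality) auto
  with * u show "P s \<and> (\<forall>t. P t \<longrightarrow> t \<le> s)"
    by (auto simp: last_such_def split: if_splits)
next
  assume *: "P s \<and> (\<forall>t. P t \<longrightarrow> t \<le> s)"
  then have "(GREATEST s. P s) = s" by (intro Greatest_equality) auto
  with * show "last_such P = Some s" by (auto simp: last_such_def)
qed

lemma last_such_eq_None_iff: "last_such P = None \<longleftrightarrow> (\<forall>s. \<not> P s)"
  by (auto simp: last_such_def)

text \<open>Serves to replace \<open>spans\<close> by a condition on counts or heights that is
  weaker for an individual \<open>s\<close> but has the same largest solution.\<close>

lemma last_such_cong_bounded: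
  assumes "\<And>s. P s \<Longrightarrow> s \<le> b" and "\<And>s. Q s \<Longrightarrow> s \<le> b"
    and "\<And>s. P s \<Longrightarrow> Q s" and "\<And>s. Q s \<Longrightarrow> \<exists>t\<ge>s. P t"
  shows "last_such P = last_such Q"
proof (cases "last_such P")
  case None
  then have "last_such Q = None"
    using assms(4) by (auto simp: last_such_eq_None_iff)
  with None show ?thesis by simp
next
  case (Some s)
  then have "P s" "\<forall>t. P t \<longrightarrow> t \<le> s"
    using last_such_eq_Some_iff[of P b] assms(1) by blast+
  then have "Q s \<and> (\<forall>t. Q t \<longrightarrow> t \<le> s)"
    using assms(3,4) by (meson order_trans)
  then have "last_such Q = Some s"
    using last_such_eq_Some_iff[of Q b] assms(2) by blast
  with Some show ?thesis by simp
qed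

text \<open>The block of \<open>s\<close> is traversed upwards by \<open>g\<close> and closed by the step from its last
  element \<open>l\<close> back to \<open>g l = s\<close>. The label of \<open>m\<close> is the innermost \<open>s\<close> with
  \<open>s \<le> m \<le> l\<close>, so blocks can be handled without iterating \<open>g\<close>. The elements of the zero block
  have no label.\<close>

definition spans :: "(int \<Rightarrow> int) \<Rightarrow> int \<Rightarrow> int \<Rightarrow> bool" where
  "spans g m s \<longleftrightarrow> s \<le> m \<and> (\<exists>l\<ge>m. g l = s)"

definition label :: "(int \<Rightarrow> int) \<Rightarrow> int \<Rightarrow> int option" where
  "label g m = last_such (spans g m)"

lemma label_eq_Some_iff:
  "label g m = Some s \<longleftrightarrow> spans g m s \<and> (\<forall>t. spans g m t \<longrightarrow> t \<le> s)"
  unfolding label_def by (rule last_such_eq_Some_iff[where b = m]) (simp add: spans_def)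

lemma label_eq_None_iff: "label g m = None \<longleftrightarrow> (\<forall>s. \<not> spans g m s)"
  unfolding label_def by (rule last_such_eq_None_iff)

lemma spans_imp_label:
  assumes "spans g m s"
  shows "\<exists>t\<ge>s. label g m = Some t \<and> t \<le> m"
  using int_bounded_greatest[of "spans g m" s m] assms
  unfolding label_eq_Some_iff by (auto simp: spans_def)

definition multiplicity :: "(int \<Rightarrow> int) \<Rightarrow> int \<Rightarrow> nat" where
  "multiplicity g s = card {m. label g m = Some s}"

text \<open>A downward step, fixed points included, closes a block, so its closed interval contains
  the whole block and all blocks nested in it. An upward step joins two successive elements of a
  block, and only what lies strictly between them is confined. The identity is
  \<open>g m = m\<close>, the Coxeter element \<open>g m = m + 1\<close>.\<close>

locale nc_lift =
  fixes n :: int and g :: "int \<Rightarrow> int"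
  assumes n_pos: "0 < n" and inj: "inj g" and shift: "g (m + n) = g m + n"
    and lower: "m - n < g m" and upper: "g m \<le> m + n"
    and up: "\<lbrakk>m < g m; m < j; j < g m\<rbrakk> \<Longrightarrow> m < g j \<and> g j < g m"
    and down: "\<lbrakk>g m \<le> m; g m \<le> j; j \<le> m\<rbrakk> \<Longrightarrow> g m \<le> g j \<and> g j \<le> m"
begin

text \<open>An injective map of a finite interval into itself permutes it.\<close>

lemma down_surj:
  assumes "g m \<le> m" "g m \<le> j" "j \<le> m"
  shows "\<exists>i. g m \<le> i \<and> i \<le> m \<and> g i = j"
proof -
  let ?I = "{g m..m}"
  have "g ` ?I \<subseteq> ?I" using down assms(1) by auto
  then have "g ` ?I = ?I"
    by (meson endo_inj_surj finite_atLeastAtMost_int inj inj_on_subset subset_UNIV)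
  with assms show ?thesis by (metis atLeastAtMost_iff imageE)
qed

text \<open>\<open>g\<close> permutes the interval from \<open>s\<close> to the closing position
  \<open>l\<close>, so \<open>m\<close> lies in it exactly when \<open>g m\<close> does.\<close>

lemma spans_image_iff: "spans g (g m) s \<longleftrightarrow> spans g m s"
proof
  assume "spans g (g m) s"
  then obtain l where l: "g l = s" "s \<le> g m" "g m \<le> l" by (auto simp: spans_def)
  then obtain i where "s \<le> i" "i \<le> l" "g i = g m" using down_surj[of l "g m"] by auto
  moreover from this have "i = m" using inj by (simp add: inj_eq)
  ultimately show "spans g m s" using l by (auto simp: spans_def)
next
  assume "spans g m s"
  then obtain l where l: "g l = s" "s \<le> m" "m \<le> l" by (auto simp: spans_def)
  then show "spans g (g m) s" using down[of l m] by (auto simp: spans_def)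
qed

lemma label_image [simp]: "label g (g m) = label g m"
  unfolding label_def by (rule arg_cong[where f = last_such]) (simp add: fun_eq_iff spans_image_iff)

lemma shift_minus: "g (m - n) = g m - n"
  using shift[of "m - n"] by simp

lemma spans_shift: "spans g (m + n) (s + n) \<longleftrightarrow> spans g m s"
proof -
  have "(\<exists>l\<ge>m + n. g l = s + n) \<longleftrightarrow> (\<exists>l\<ge>m. g l = s)"
  proof
    assume "\<exists>l\<ge>m + n. g l = s + n"
    then obtain l where "l \<ge> m + n" "g l = s + n" by blast
    then have "l - n \<ge> m" "g (l - n) = s" by (simp_all add: shift_minus)
    then show "\<exists>l\<ge>m. g l = s" by blast
  next
    assume "\<exists>l\<ge>m. g l = s"
    then obtain l where "l \<ge> m" "g l = s" by blast
    then have "l + n \<ge> m + n" "g (l + n) = s + n" by (simp_all add: shift)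
    then show "\<exists>l\<ge>m + n. g l = s + n" by blast
  qed
  then show ?thesis by (simp add: spans_def)
qed

lemma label_shift: "label g (m + n) = map_option (\<lambda>s. s + n) (label g m)"
proof (cases "label g m")
  case None
  then have "\<not> spans g (m + n) s" for s
    using spans_shift[of m "s - n"] by (simp add: label_eq_None_iff)
  then have "label g (m + n) = None" by (simp add: label_eq_None_iff)
  with None show ?thesis by simp
next
  case (Some s)
  then have "label g (m + n) = Some (s + n)"
    unfolding label_eq_Some_iff
  proof (intro conjI allI impI)
    assume *: "spans g m s \<and> (\<forall>t. spans g m t \<longrightarrow> t \<le> s)"
    then show "spans g (m + n) (s + n)" by (simp add: spans_shift)
    show "t \<le> s + n" if "spans g (m + n) t" for t
    proof -
      have "t - n \<le> s" using that * spans_shift[of m "t - n"] by simp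
      then show ?thesis by simp
    qed
  qed
  with Some show ?thesis by simp
qed

lemma label_bounds: "label g m = Some s \<Longrightarrow> s \<le> m \<and> m < s + n"
proof -
  assume "label g m = Some s"
  then obtain l where "s \<le> m" "m \<le> l" "g l = s" by (auto simp: label_eq_Some_iff spans_def)
  then show ?thesis using lower[of l] by auto
qed

lemma finite_label: "finite {m. label g m = Some s}"
proof (rule finite_subset)
  show "{m. label g m = Some s} \<subseteq> {s..s + n}"
  proof
    fix m assume "m \<in> {m. label g m = Some s}"
    then show "m \<in> {s..s + n}" using label_bounds[of m s] by simp
  qed
qed simp

lemma sum_multiplicity:
  assumes "finite A"
  shows "(\<Sum>s\<in>A. multiplicity g s) = card {m. \<exists>s\<in>A. label g m = Some s}"
proof -
  have "card (\<Union>s\<in>A. {m. label g m = Some s}) = (\<Sum>s\<in>A. card {m. label g m = Some s})"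
    by (rule card_UN_disjoint) (use assms finite_label in auto)
  moreover have "(\<Union>s\<in>A. {m. label g m = Some s}) = {m. \<exists>s\<in>A. label g m = Some s}"
    by auto
  ultimately show ?thesis unfolding multiplicity_def by simp
qed

text \<open>Every element of an interval spanned by \<open>s\<close> has its label in that interval, while
  without a label of \<open>m\<close> beyond \<open>s\<close> all blocks opened in \<open>{s..m}\<close> are closed before \<open>m\<close>.
  Thus the multiplicities determine the labels.\<close>

lemma label_eq_last_multiplicity:
  "label g m = last_such (\<lambda>s. s \<le> m \<and> m - s + 1 \<le> int (\<Sum>i=s..m. multiplicity g i))"
  unfolding label_def
proof (rule last_such_cong_bounded[where b = m])
  fix s
  assume s: "spans g m s"
  then obtain l where l: "s \<le> m" "m \<le> l" "g l = s" by (auto simp: spans_def)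
  have "{s..m} \<subseteq> {j. \<exists>i\<in>{s..m}. label g j = Some i}"
  proof
    fix j assume "j \<in> {s..m}"
    then have j: "s \<le> j" "j \<le> m" by auto
    then have "spans g j s" using l unfolding spans_def by (intro conjI exI[of _ l]) auto
    from spans_imp_label[OF this] obtain t where "t \<ge> s" "label g j = Some t" "t \<le> j" by auto
    with j show "j \<in> {j. \<exists>i\<in>{s..m}. label g j = Some i}" by auto
  qed
  moreover have "finite {j. \<exists>i\<in>{s..m}. label g j = Some i}"
    using finite_label by simp
  ultimately have "card {s..m} \<le> card {j. \<exists>i\<in>{s..m}. label g j = Some i}"
    by (rule card_mono[rotated])
  then have "card {s..m} \<le> (\<Sum>i=s..m. multiplicity g i)"
    by (simp only: sum_multiplicity finite_atLeastAtMost_int)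
  then have "m - s + 1 \<le> int (\<Sum>i=s..m. multiplicity g i)"
    by (simp only: card_atLeastAtMost_int nat_le_iff)
  with l show "s \<le> m \<and> m - s + 1 \<le> int (\<Sum>i=s..m. multiplicity g i)" by blast
next
  fix s
  assume s: "s \<le> m \<and> m - s + 1 \<le> int (\<Sum>i=s..m. multiplicity g i)"
  show "\<exists>t\<ge>s. spans g m t"
  proof (rule ccontr)
    assume none: "\<not> (\<exists>t\<ge>s. spans g m t)"
    have "{j. \<exists>i\<in>{s..m}. label g j = Some i} \<subseteq> {s..<m}"
    proof
      fix j assume "j \<in> {j. \<exists>i\<in>{s..m}. label g j = Some i}"
      then obtain i where i: "s \<le> i" "i \<le> m" "spans g j i" by (auto simp: label_eq_Some_iff)
      then obtain l where l: "i \<le> j" "j \<le> l" "g l = i" by (auto simp: spans_def)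
      have "l < m"
      proof (rule ccontr)
        assume "\<not> l < m"
        then have "spans g m i" using i l unfolding spans_def by (intro conjI exI[of _ l]) auto
        with none i show False by blast
      qed
      with i l show "j \<in> {s..<m}" by auto
    qed
    then have "card {j. \<exists>i\<in>{s..m}. label g j = Some i} \<le> card {s..<m}"
      by (intro card_mono) auto
    then have "(\<Sum>i=s..m. multiplicity g i) \<le> card {s..<m}"
      by (simp only: sum_multiplicity finite_atLeastAtMost_int)
    then have "int (\<Sum>i=s..m. multiplicity g i) \<le> m - s"
      using s le_nat_iff[of "m - s"] by (simp only: card_atLeastLessThan_int) linarith
    with s show False by linarith
  qed
qed (auto simp: spans_def)

text \<open>Labels commute with the shift by \<open>n\<close>, and a block lies within
  \<open>n\<close> consecutive positions, so reduction modulo \<open>n\<close> is injective on it.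
  This connects \<open>multiplicity\<close> with the coordinates of a vector, which see positions
  only modulo \<open>n\<close>.\<close>

lemma card_label_window:
  "card {m\<in>{0..<n}. \<exists>t. label g m = Some t \<and> n dvd t - s} = multiplicity g s"
proof -
  have shift_mult: "label g (m + q * n) = map_option (\<lambda>s. s + q * n) (label g m)" for m q
  proof (induction q rule: int_induct[where k = 0])
    case base
    then show ?case by (simp add: map_option_idI)
  next
    case (step1 i)
    have "label g (m + (i + 1) * n) = map_option (\<lambda>s. s + n) (label g (m + i * n))"
      using label_shift[of "m + i * n"] by (simp add: algebra_simps)
    then show ?case using step1 by (cases "label g m") (simp_all add: algebra_simps)
  next
    case (step2 i)
    have "map_option (\<lambda>s. s + n) (label g (m + (i - 1) * n)) = label g (m + i * n)"
      using label_shift[of "m + (i - 1) * n"] by (simp add: algebra_simps)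
    then show ?case using step2
      by (cases "label g m"; cases "label g (m + (i - 1) * n)") (auto simp add: algebra_simps)
  qed
  have "bij_betw (\<lambda>m. m mod n) {m. label g m = Some s}
      {m\<in>{0..<n}. \<exists>t. label g m = Some t \<and> n dvd t - s}"
    unfolding bij_betw_def
  proof (intro conjI inj_onI equalityI subsetI)
    fix x y assume xy: "x \<in> {m. label g m = Some s}" "y \<in> {m. label g m = Some s}"
      and eq: "x mod n = y mod n"
    then have "s \<le> x" "x < s + n" "s \<le> y" "y < s + n" using label_bounds by auto
    moreover have "n dvd x - y" using eq by (simp add: mod_eq_dvd_iff)
    ultimately show "x = y"
      using zdvd_not_zless[of "x - y" n] zdvd_not_zless[of "y - x" n]
      by (smt (verit) dvd_diff_commute)
  next
    fix y assume "y \<in> (\<lambda>m. m mod n) ` {m. label g m = Some s}"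
    then obtain m where m: "label g m = Some s" "y = m mod n" by auto
    have "label g y = Some (s + (- (m div n)) * n)"
      using shift_mult[of m "- (m div n)"] m by (simp add: minus_div_mult_eq_mod)
    then show "y \<in> {m\<in>{0..<n}. \<exists>t. label g m = Some t \<and> n dvd t - s}"
      using m n_pos by simp
  next
    fix m assume "m \<in> {m\<in>{0..<n}. \<exists>t. label g m = Some t \<and> n dvd t - s}"
    then obtain t where t: "0 \<le> m" "m < n" "label g m = Some t" "n dvd t - s" by auto
    then obtain q where "t - s = n * q" by (elim dvdE)
    then have "label g (m + (- q) * n) = Some s"
      using shift_mult[of m "- q"] t by (simp add: algebra_simps)
    moreover have "(m + (- q) * n) mod n = m"
      using t by (metis mod_mult_self1 mod_pos_pos_trivial)
    ultimately show "m \<in> (\<lambda>m. m mod n) ` {m. label g m = Some s}"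
      by (metis (mono_tags, lifting) image_eqI mem_Collect_eq)
  qed
  from bij_betw_same_card[OF this] show ?thesis by (simp only: multiplicity_def)
qed

text \<open>Induction on the distance to the closing position \<open>l\<close>: an upward step from
  \<open>m\<close> comes closer to \<open>l\<close>, and a downward step can only land on
  \<open>s\<close>, because its target also spans \<open>m\<close> and \<open>s\<close> is the
  largest number that does.\<close>

lemma invariant_eq_at_label:
  assumes inv: "\<And>m. x (g m) = (x m :: 'a)" and lab: "label g m = Some s"
  shows "x m = x s"
proof -
  obtain l where l: "g l = s" "s \<le> m" "m \<le> l"
    using lab by (auto simp: label_eq_Some_iff spans_def)
  have "x m = x s" if "nat (l - m) = d" "s \<le> m" "m \<le> l" "label g m = Some s" for d
    using that
  proof (induction d arbitrary: m rule: less_induct)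
    case (less d)
    have gm: "s \<le> g m" "g m \<le> l" using down[of l m] l less.prems by auto
    show ?case
    proof (cases "m < g m")
      case True
      then have "x (g m) = x s"
        using less.IH[of "nat (l - g m)" "g m"] less.prems gm by auto
      then show ?thesis using inv by simp
    next
      case False
      then have "spans g m (g m)" by (auto simp: spans_def)
      then have "g m \<le> s" using less.prems by (auto simp: label_eq_Some_iff)
      with gm have "g m = s" by simp
      then show ?thesis using inv by metis
    qed
  qed
  with l lab show ?thesis by blast
qed

text \<open>The orbit of an unlabelled element \<open>m\<close> is increasing. It cannot jump over \<open>m + n\<close>,
  since then the orbit of \<open>m + n\<close> would be trapped below it.\<close>

lemma antiperiodic_invariant_eq_0:
  fixes x :: "int \<Rightarrow> real"
  assumes inv: "\<And>m. x (g m) = x m" and anti: "\<And>m. x (m + n) = - x m"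
    and unl: "label g m = None"
  shows "x m = 0"
proof -
  have incr: "i < g i" if "label g i = None" for i
  proof (rule ccontr)
    assume "\<not> i < g i"
    then have "spans g i (g i)" by (auto simp: spans_def)
    with that show False by (auto simp: label_eq_None_iff)
  qed
  have orb: "label g ((g ^^ i) j) = None \<and> x ((g ^^ i) j) = x j \<and> j + int i \<le> (g ^^ i) j"
    if "label g j = None" for i j
  proof (induction i)
    case 0
    then show ?case using that by simp
  next
    case (Suc i)
    then show ?case using incr[of "(g ^^ i) j"] inv by auto
  qed
  let ?a = "\<lambda>i. (g ^^ i) m"
  define i where "i = (LEAST i. m + n \<le> ?a i)"
  have ex: "m + n \<le> ?a (nat n)" using orb[OF unl, of "nat n"] n_pos by auto
  have i1: "m + n \<le> ?a i" unfolding i_def by (rule LeastI) (rule ex)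
  have "i \<noteq> 0"
  proof
    assume "i = 0"
    with i1 n_pos show False by simp
  qed
  then obtain i' where i': "i = Suc i'" by (metis not0_implies_Suc)
  have i2: "?a i' < m + n" using not_less_Least[of i' "\<lambda>i. m + n \<le> ?a i"] i' i_def by auto
  have "?a i = m + n"
  proof (rule ccontr)
    assume "?a i \<noteq> m + n"
    then have lt: "?a i' < m + n" "m + n < g (?a i')" using i1 i2 i' by auto
    have unl': "label g (m + n) = None" using unl label_shift by simp
    have trap: "?a i' < (g ^^ j) (m + n) \<and> (g ^^ j) (m + n) < g (?a i')" for j
    proof (induction j)
      case 0
      then show ?case using lt by simp
    next
      case (Suc j)
      then show ?case using up[of "?a i'" "(g ^^ j) (m + n)"] lt by simp
    qed
    \<comment> \<open>The orbit of \<open>m + n\<close> climbs by at least one per step, so after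
      this many steps it has reached the upper end of the trap.\<close>
    show False
      using trap[of "nat (g (?a i') - (m + n))"]
        orb[OF unl', of "nat (g (?a i') - (m + n))"] lt by auto
  qed
  then have "x (m + n) = x m" using orb[OF unl, of i] by simp
  with anti[of m] show "x m = 0" by simp
qed

text \<open>With \<open>x m\<close> the inner product of a vector with \<open>e m\<close>, the left
  side will describe the fixed space of \<open>w\<close>. The right side mentions only labels, so
  the labels determine the fixed space.\<close>

lemma antiperiodic_invariant_iff:
  fixes x :: "int \<Rightarrow> real"
  assumes anti: "\<And>m. x (m + n) = - x m"
  shows "(\<forall>m. x (g m) = x m) \<longleftrightarrow>
    (\<forall>m. case label g m of None \<Rightarrow> x m = 0 | Some s \<Rightarrow> x m = x s)"
proof
  assume *: "\<forall>m. x (g m) = x m"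
  show "\<forall>m. case label g m of None \<Rightarrow> x m = 0 | Some s \<Rightarrow> x m = x s"
  proof
    fix m
    show "case label g m of None \<Rightarrow> x m = 0 | Some s \<Rightarrow> x m = x s"
    proof (cases "label g m")
      case None
      then show ?thesis using antiperiodic_invariant_eq_0[of x m] * anti by simp
    next
      case (Some s)
      then show ?thesis using invariant_eq_at_label[of x m s] * by simp
    qed
  qed
next
  assume *: "\<forall>m. case label g m of None \<Rightarrow> x m = 0 | Some s \<Rightarrow> x m = x s"
  show "\<forall>m. x (g m) = x m"
  proof
    fix m
    show "x (g m) = x m"
      using *[rule_format, of m] *[rule_format, of "g m"] by (auto split: option.splits)
  qed
qed

end

section \<open>Realizing prescribed block sizes by a stack process\<close>

locale circular_walk =
  fixes n :: int and k :: "int \<Rightarrow> nat"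
  assumes n_pos: "0 < n" and k_shift: "k (m + n) = k m"
    and k_sum: "(\<Sum>i\<in>{0..<n}. k i) \<le> nat n"
begin

text \<open>The height of a stack just before position \<open>m\<close>, normalized to 0 at position
  0. Heights may become negative, so that a position can take a plate which nobody put down; these
  positions form the zero block.\<close>

definition H :: "int \<Rightarrow> int" where
  "H m = (if 0 \<le> m then \<Sum>i\<in>{0..<m}. int (k i) - 1 else - (\<Sum>i\<in>{m..<0}. int (k i) - 1))"

lemma H_step: "H (m + 1) = H m + int (k m) - 1"
proof (cases "0 \<le> m")
  case True
  then have "{0..<m + 1} = insert m {0..<m}" by auto
  with True show ?thesis by (simp add: H_def)
next
  case False
  then have "{m..<0} = insert m {m + 1..<0}" by auto
  with False show ?thesis by (auto simp: H_def)
qed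

lemma H_descent: "H m \<le> H (m + 1) + 1"
  by (simp add: H_step)

lemma H_period: obtains r where "0 \<le> r" "\<And>m. H (m + n) = H m - r"
proof -
  define r where "r = H 0 - H n"
  have "H (m + n) = H m - r" for m
  proof (induction m rule: int_induct[where k = 0])
    case base
    then show ?case by (simp add: r_def)
  next
    case (step1 i)
    then show ?case using H_step[of i] H_step[of "i + n"] k_shift[of i] by (simp add: algebra_simps)
  next
    case (step2 i)
    then show ?case using H_step[of "i - 1"] H_step[of "i - 1 + n"] k_shift[of "i - 1"]
      by (simp add: algebra_simps)
  qed
  moreover have "0 \<le> r"
  proof -
    have "H n = int (\<Sum>i\<in>{0..<n}. k i) - n" "H 0 = 0"
      using n_pos by (simp_all add: H_def sum_subtractf)
    moreover have "int (\<Sum>i\<in>{0..<n}. k i) \<le> n" using k_sum n_pos by linarith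
    ultimately show ?thesis by (simp add: r_def)
  qed
  ultimately show ?thesis using that by blast
qed

lemma H_shift_le: "H (m + n) \<le> H m"
  using H_period by (metis diff_ge_0_iff_ge diff_diff_eq2 add_diff_cancel_left')

text \<open>Position \<open>i\<close> puts \<open>k i\<close> plates on a stack and then takes one plate off, the one at
  level \<open>H (i + 1)\<close>. It closes the block of \<open>s\<close> if it takes the lowest plate put
  down by \<open>s\<close>.\<close>

definition closes :: "int \<Rightarrow> int \<Rightarrow> bool" where
  "closes m s \<longleftrightarrow> s \<le> m \<and> H s = H (m + 1) \<and> (\<forall>j. s < j \<and> j \<le> m \<longrightarrow> H (m + 1) < H j)"

text \<open>The taken plate of position \<open>i\<close> has level \<open>H (i + 1)\<close>, so
  \<open>m'\<close> is the first later position that takes a plate from beneath the one taken by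
  \<open>m\<close>.\<close>

definition passes :: "int \<Rightarrow> int \<Rightarrow> bool" where
  "passes m m' \<longleftrightarrow> m < m' \<and> H (m' + 1) < H (m + 1) \<and>
     (\<forall>j. m < j \<and> j < m' \<longrightarrow> H (m + 1) \<le> H (j + 1))"

text \<open>The plates put down by \<open>s\<close> are taken from the top, the first by
  \<open>s\<close> itself, so \<open>passes\<close> runs upwards through the block of
  \<open>s\<close> and the taker of the lowest plate returns to \<open>s\<close>. Takers of plates
  that nobody put down never close a block and are chained upwards forever.\<close>

definition stack_next :: "int \<Rightarrow> int \<Rightarrow> bool" where
  "stack_next m t \<longleftrightarrow> closes m t \<or> (\<nexists>s. closes m s) \<and> passes m t"

definition stack_map :: "int \<Rightarrow> int" where
  "stack_map m = (THE t. stack_next m t)"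

lemma closes_unique:
  assumes "closes m s" "closes m t"
  shows "s = t"
proof (rule ccontr)
  assume "s \<noteq> t"
  then consider "s < t" | "t < s" by linarith
  then show False using assms unfolding closes_def by cases force+
qed

lemma passes_unique:
  assumes "passes m s" "passes m t"
  shows "s = t"
proof (rule ccontr)
  assume "s \<noteq> t"
  then consider "s < t" | "t < s" by linarith
  then show False using assms unfolding passes_def by cases force+
qed

lemma stack_next_unique: "stack_next m s \<Longrightarrow> stack_next m t \<Longrightarrow> s = t"
  unfolding stack_next_def using closes_unique[of m s t] passes_unique[of m s t] by blast

lemma passes_above:
  assumes "passes i m" "i < j" "j \<le> m"
  shows "H (i + 1) \<le> H j"
proof (cases "j = i + 1")
  case False
  then have "i < j - 1" "j - 1 < m" using assms by auto
  then have "H (i + 1) \<le> H (j - 1 + 1)" using assms(1) unfolding passes_def by blast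
  then show ?thesis by simp
qed simp

text \<open>\<open>H\<close> drops by at most one per position, so the first height below a level is
  the one just beneath it.\<close>

lemma passes_level: "passes i m \<Longrightarrow> H (m + 1) = H (i + 1) - 1"
  using passes_above[of i m m] H_descent[of m] unfolding passes_def by auto

lemma closes_last_minimum:
  assumes "j \<le> m" "\<And>i. \<lbrakk>j \<le> i; i \<le> m\<rbrakk> \<Longrightarrow> H (m + 1) \<le> H i" "H j = H (m + 1)"
  shows "\<exists>s. closes m s"
proof -
  have "j \<le> j \<and> j \<le> m \<and> H j = H (m + 1)" using assms by simp
  from int_bounded_greatest[of "\<lambda>s. j \<le> s \<and> s \<le> m \<and> H s = H (m + 1)", OF this, of m]
  obtain s where s: "j \<le> s \<and> s \<le> m \<and> H s = H (m + 1)"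
      "\<And>t. j \<le> t \<and> t \<le> m \<and> H t = H (m + 1) \<Longrightarrow> t \<le> s"
    by blast
  have "H (m + 1) < H i" if "s < i" "i \<le> m" for i
  proof -
    have "H (m + 1) \<le> H i" using assms(2)[of i] s(1) that by simp
    moreover have "H i \<noteq> H (m + 1)" using s(2)[of i] s(1) that by auto
    ultimately show ?thesis by simp
  qed
  with s(1) show ?thesis unfolding closes_def by auto
qed

text \<open>If the height does not fall below \<open>H (m + 1)\<close> within a period, then the
  drop \<open>r\<close> is 0, the walk is periodic and \<open>H (m + 1)\<close> is its minimum. The
  last position up to \<open>m\<close> at that height is then closed by \<open>m\<close>.\<close>

lemma closes_or_passes:
  "(\<exists>s. closes m s) \<or> (\<exists>t. passes m t \<and> t \<le> m + n)"
proof (cases "\<exists>j. m < j \<and> j \<le> m + n \<and> H (j + 1) < H (m + 1)")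
  case True
  then obtain j where j: "m < j" "j \<le> m + n" "H (j + 1) < H (m + 1)" by blast
  then have "m < j \<and> H (j + 1) < H (m + 1)" by simp
  from int_bounded_least[of "\<lambda>i. m < i \<and> H (i + 1) < H (m + 1)", OF this, of m]
  obtain t where t0: "m < t \<and> H (t + 1) < H (m + 1)"
      and t: "\<And>i. m < i \<and> H (i + 1) < H (m + 1) \<Longrightarrow> t \<le> i"
    by auto
  have "H (m + 1) \<le> H (i + 1)" if "m < i" "i < t" for i
    using t[of i] that by linarith
  then have "passes m t" using t0 unfolding passes_def by blast
  moreover have "t \<le> m + n" using t[of j] j by simp
  ultimately show ?thesis by blast
next
  case False
  then have above: "H (m + 1) \<le> H (j + 1)" if "m < j" "j \<le> m + n" for j
    using that by (metis not_less)
  obtain r where r: "0 \<le> r" "\<And>m. H (m + n) = H m - r" using H_period by blast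
  have "H (m + 1) \<le> H (m + n + 1)" using above[of "m + n"] n_pos by simp
  then have "r = 0" using r(1) r(2)[of "m + 1"] by (simp add: algebra_simps)
  then have per: "H (j + n) = H j" for j using r(2) by simp
  have "H (m + 1) \<le> H i" if "m + 1 - n \<le> i" "i \<le> m" for i
  proof (cases "i = m + 1 - n")
    case True
    then show ?thesis using per[of i] by simp
  next
    case False
    then show ?thesis using above[of "i + n - 1"] per[of i] that by simp
  qed
  then have "\<exists>s. closes m s"
    using per[of "m + 1 - n"] n_pos by (intro closes_last_minimum[of "m + 1 - n"]) auto
  then show ?thesis by blast
qed

lemma stack_next_stack_map: "stack_next m (stack_map m)"
proof -
  have "\<exists>t. stack_next m t" using closes_or_passes[of m] by (auto simp: stack_next_def)
  then show ?thesis unfolding stack_map_def using stack_next_unique by (metis theI)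
qed

lemma stack_map_eqI: "stack_next m t \<Longrightarrow> stack_map m = t"
  using stack_next_stack_map stack_next_unique by blast

text \<open>No height between \<open>i\<close> and \<open>m\<close> is below
  \<open>H (i + 1)\<close>. A closing step back past \<open>i\<close> would need one. A passing step
  starts strictly above this level, since at this level a block closes, so it ends before the drop
  at \<open>m\<close>.\<close>

lemma stack_next_up:
  assumes "passes i m" "i < j" "j < m" "stack_next j t"
  shows "i < t \<and> t < m"
proof (cases "closes j t")
  case True
  have ij: "H (i + 1) \<le> H (j + 1)" using assms unfolding passes_def by blast
  have "i < t"
  proof (rule ccontr)
    assume "\<not> i < t"
    then have "H (j + 1) < H (i + 1)" using True assms unfolding closes_def by auto
    with ij show False by simp
  qed
  then show ?thesis using True assms by (simp add: closes_def)
next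
  case False
  then have p: "passes j t" and nc: "\<nexists>s. closes j s" using assms by (auto simp: stack_next_def)
  have "H (i + 1) \<noteq> H (j + 1)"
  proof
    assume eq: "H (i + 1) = H (j + 1)"
    have "\<exists>s. closes j s"
      using eq assms passes_above[OF assms(1)] by (intro closes_last_minimum[of "i + 1"]) auto
    with nc show False by blast
  qed
  then have lt: "H (i + 1) < H (j + 1)" using passes_above[OF assms(1), of "j + 1"] assms by simp
  have "\<not> m < t"
    using p lt passes_level[OF assms(1)] assms unfolding passes_def by fastforce
  moreover have "t \<noteq> m" using passes_level[OF p] passes_level[OF assms(1)] lt by auto
  ultimately show ?thesis using p assms by (simp add: passes_def)
qed

text \<open>Inside the interval of a closed block every level exceeds the common level at its two
  ends, so no step from inside can cross an end.\<close>

lemma stack_next_down: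
  assumes "closes m s" "s \<le> j" "j \<le> m" "stack_next j t"
  shows "s \<le> t \<and> t \<le> m"
proof (cases "j = m")
  case True
  then have "t = s" using assms stack_next_unique[of m s t] by (simp add: stack_next_def)
  then show ?thesis using assms by auto
next
  case False
  then have lt: "H s < H (j + 1)" "H (m + 1) < H (j + 1)"
    using assms unfolding closes_def by auto
  show ?thesis
  proof (cases "closes j t")
    case True
    then have "\<not> t < s" using lt assms unfolding closes_def by fastforce
    then show ?thesis using True assms by (simp add: closes_def)
  next
    case F: False
    then have p: "passes j t" using assms by (auto simp: stack_next_def)
    have "\<not> m < t"
    proof
      assume "m < t"
      then have "H (j + 1) \<le> H (m + 1)" using p False assms unfolding passes_def by auto
      with lt show False by simp
    qed
    then show ?thesis using p assms by (simp add: passes_def)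
  qed
qed

text \<open>A closing step to \<open>t\<close> requires \<open>k t > 0\<close> and a passing step to
  \<open>t\<close> requires \<open>k t = 0\<close>, so the two kinds never share a target. Two
  closing steps to \<open>t\<close> would take the same plate. Of two passing steps to
  \<open>t\<close>, the later one starts strictly inside the earlier one, where
  \<open>stack_next_up\<close> keeps its target below \<open>t\<close>.\<close>

lemma stack_next_inj:
  assumes "stack_next a t" "stack_next b t"
  shows "a = b"
proof -
  have False if "a < b" "stack_next a t" "stack_next b t" for a b
  proof (cases "closes a t")
    case a: True
    then have b: "closes b t" using that by (auto simp: stack_next_def passes_def closes_def)
    then have "\<forall>j. t < j \<and> j \<le> b \<longrightarrow> H (b + 1) < H j" "t \<le> a"
      using a by (simp_all add: closes_def)
    then have "H (b + 1) < H (a + 1)" using that(1) by simp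
    then show False using a b unfolding closes_def by simp
  next
    case False
    then have a: "passes a t" using that by (simp add: stack_next_def)
    show False
    proof (cases "closes b t")
      case b: True
      have lev: "H (t + 1) < H t" using passes_level[OF a] passes_above[OF a, of t] a
        by (simp add: passes_def)
      show False
      proof (cases "t = b")
        case True
        then show False using b lev by (simp add: closes_def)
      next
        case False
        then have "H (b + 1) < H (t + 1)" "H t = H (b + 1)" using b unfolding closes_def by auto
        then show False using lev by simp
      qed
    next
      case False
      then have "b < t" using that by (auto simp: stack_next_def passes_def)
      then show False using stack_next_up[OF a that(1) _ that(3)] by simp
    qed
  qed
  then show ?thesis using assms by (meson linorder_neqE)
qed

lemma stack_next_shift: "stack_next m t \<Longrightarrow> stack_next (m + n) (t + n)"
proof -
  assume *: "stack_next m t"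
  obtain r where r: "\<And>m. H (m + n) = H m - r" using H_period by blast
  have r1: "H (j + n + 1) = H (j + 1) - r" for j using r[of "j + 1"] by (simp add: algebra_simps)
  have cl: "closes (m + n) (s + n) \<longleftrightarrow> closes m s" for s
  proof -
    have "(\<forall>j. s + n < j \<and> j \<le> m + n \<longrightarrow> H (m + n + 1) < H j) \<longleftrightarrow>
        (\<forall>j. s < j \<and> j \<le> m \<longrightarrow> H (m + 1) < H j)" (is "?L = ?R")
    proof
      assume L: ?L
      show ?R using L[rule_format, of "_ + n"] r r1 by simp
    next
      assume R: ?R
      show ?L
      proof (intro allI impI)
        fix j assume "s + n < j \<and> j \<le> m + n"
        then show "H (m + n + 1) < H j" using R[rule_format, of "j - n"] r[of "j - n"] r1 by simp
      qed
    qed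
    then show ?thesis unfolding closes_def by (simp add: r r1)
  qed
  have pa: "passes (m + n) (s + n)" if "passes m s" for s
    unfolding passes_def
  proof (intro conjI allI impI)
    show "m + n < s + n" "H (s + n + 1) < H (m + n + 1)"
      using that by (simp_all add: passes_def r1)
    fix j assume "m + n < j \<and> j < s + n"
    then have "m < j - n \<and> j - n < s" by auto
    then have "H (m + 1) \<le> H (j - n + 1)" using that unfolding passes_def by blast
    then show "H (m + n + 1) \<le> H (j + 1)" using r1[of "j - n"] r1[of m] by simp
  qed
  have "closes m (s - n)" if "closes (m + n) s" for s using cl[of "s - n"] that by simp
  then show ?thesis using * cl pa unfolding stack_next_def by blast
qed

lemma nc_lift_stack_map: "nc_lift n stack_map"
proof
  show "0 < n" by (rule n_pos)
  show "inj stack_map"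
    using stack_next_stack_map stack_next_inj by (metis injI)
  fix m
  note sn = stack_next_stack_map[of m]
  show "stack_map (m + n) = stack_map m + n"
    by (rule stack_map_eqI) (rule stack_next_shift[OF sn])
  show "m - n < stack_map m"
  proof (cases "closes m (stack_map m)")
    case True
    show ?thesis
    proof (rule ccontr)
      assume "\<not> ?thesis"
      \<comment> \<open>An interval this long would contain the start of the block shifted by
        \<open>n\<close>, which lies no higher than the start itself.\<close>
      then have "H (m + 1) < H (stack_map m + n)" using True n_pos unfolding closes_def by auto
      then show False using True H_shift_le[of "stack_map m"] by (simp add: closes_def)
    qed
  next
    case False
    then show ?thesis using sn n_pos by (auto simp: stack_next_def passes_def)
  qed
  show "stack_map m \<le> m + n"
    using sn closes_or_passes[of m] n_pos passes_unique[of m]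
    unfolding stack_next_def closes_def[of m "stack_map m"] by auto
  fix j
  show "m < stack_map j \<and> stack_map j < stack_map m"
    if "m < stack_map m" "m < j" "j < stack_map m"
  proof -
    have "passes m (stack_map m)" using that sn by (auto simp: stack_next_def closes_def)
    then show ?thesis using stack_next_up that stack_next_stack_map by blast
  qed
  show "stack_map m \<le> stack_map j \<and> stack_map j \<le> m"
    if "stack_map m \<le> m" "stack_map m \<le> j" "j \<le> m"
  proof -
    have "closes m (stack_map m)" using that sn by (auto simp: stack_next_def passes_def)
    then show ?thesis using stack_next_down that stack_next_stack_map by blast
  qed
qed

text \<open>The walk descends by at most one at a time, and its heights at \<open>s + q n\<close> do
  not exceed \<open>H s\<close>, so it comes down to \<open>L\<close> without skipping it.\<close>

lemma first_passage:
  assumes "s \<le> m" "L \<le> H (m + 1)" "H s \<le> L"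
  obtains l where "m \<le> l" "H (l + 1) = L" "\<And>j. \<lbrakk>m \<le> j; j < l\<rbrakk> \<Longrightarrow> L < H (j + 1)"
proof -
  have "\<exists>i\<ge>m. H (i + 1) \<le> L"
  proof -
    have "H (s + int q * n) \<le> H s" for q
    proof (induction q)
      case (Suc q)
      have "H (s + int (Suc q) * n) = H (s + int q * n + n)" by (simp add: algebra_simps)
      with Suc H_shift_le[of "s + int q * n"] show ?case by simp
    qed simp
    then have le: "H (s + int (nat (m + 1 - s)) * n) \<le> L" using assms(3) by (rule order_trans)
    have "m + 1 - s \<le> (m + 1 - s) * n" using assms n_pos by simp
    then have "m + 1 \<le> s + (m + 1 - s) * n" by linarith
    moreover have "int (nat (m + 1 - s)) = m + 1 - s" using assms by simp
    ultimately have "m + 1 \<le> s + int (nat (m + 1 - s)) * n" by (simp only:)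
    then have "m \<le> s + int (nat (m + 1 - s)) * n - 1" by linarith
    moreover have "H (s + int (nat (m + 1 - s)) * n - 1 + 1) \<le> L"
      using le by (simp only: diff_add_cancel)
    ultimately show ?thesis by blast
  qed
  then obtain i where "m \<le> i \<and> H (i + 1) \<le> L" by blast
  from int_bounded_least[of "\<lambda>i. m \<le> i \<and> H (i + 1) \<le> L", OF this, of m]
  obtain l where l: "m \<le> l \<and> H (l + 1) \<le> L"
      "\<And>t. m \<le> t \<and> H (t + 1) \<le> L \<Longrightarrow> l \<le> t"
    by auto
  have lt: "L < H (j + 1)" if "m \<le> j" "j < l" for j using l(2)[of j] that by linarith
  have "H (l + 1) = L"
  proof (cases "l = m")
    case True
    then show ?thesis using assms l by simp
  next
    case False
    then have "L < H (l - 1 + 1)" using lt[of "l - 1"] l by simp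
    then show ?thesis using H_descent[of l] l by simp
  qed
  with l lt show ?thesis using that by blast
qed

text \<open>Position \<open>m\<close> takes the plate at level \<open>H (m + 1)\<close>, and this
  plate was put down by the last \<open>s\<close> before which the stack was at most that
  high.\<close>

lemma label_stack_map:
  "label stack_map m = last_such (\<lambda>s. s \<le> m \<and> H s \<le> H (m + 1))"
  unfolding label_def
proof (rule last_such_cong_bounded[where b = m])
  fix s assume "spans stack_map m s"
  then obtain l where l: "s \<le> m" "m \<le> l" "stack_map l = s" by (auto simp: spans_def)
  then have c: "closes l s"
    using stack_next_stack_map[of l] by (auto simp: stack_next_def passes_def)
  show "s \<le> m \<and> H s \<le> H (m + 1)"
  proof (cases "m = l")
    case False
    then show ?thesis using c l unfolding closes_def by (simp add: less_imp_le)
  qed (use c l in \<open>simp add: closes_def\<close>)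
next
  fix s assume "s \<le> m \<and> H s \<le> H (m + 1)"
  from int_bounded_greatest[of "\<lambda>s. s \<le> m \<and> H s \<le> H (m + 1)", OF this, of m]
  obtain t where t: "s \<le> t" "t \<le> m \<and> H t \<le> H (m + 1)"
      "\<And>j. j \<le> m \<and> H j \<le> H (m + 1) \<Longrightarrow> j \<le> t"
    by auto
  have above: "H (m + 1) < H j" if "t < j" "j \<le> m" for j using t(3)[of j] that by linarith
  \<comment> \<open>\<open>l\<close> takes the lowest plate of \<open>t\<close> and thereby closes
    the block of \<open>t\<close>.\<close>
  obtain l where l: "m \<le> l" "H (l + 1) = H t" "\<And>j. \<lbrakk>m \<le> j; j < l\<rbrakk> \<Longrightarrow> H t < H (j + 1)"
    using first_passage[of t m "H t"] t by auto
  have "H (l + 1) < H j" if "t < j" "j \<le> l" for j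
  proof (cases "j \<le> m")
    case True
    then show ?thesis using above[of j] that t l by simp
  next
    case False
    then show ?thesis using l(3)[of "j - 1"] that l by simp
  qed
  then have "closes l t" using t l unfolding closes_def by auto
  then have "stack_map l = t" by (intro stack_map_eqI) (simp add: stack_next_def)
  then have "spans stack_map m t" using t l unfolding spans_def by (intro conjI exI[of _ l]) auto
  with t show "\<exists>t\<ge>s. spans stack_map m t" by blast
qed (auto simp: spans_def)

lemma label_stack_map_iff:
  "label stack_map m = Some s \<longleftrightarrow>
    s \<le> m \<and> H s \<le> H (m + 1) \<and> (\<forall>j. s < j \<and> j \<le> m \<longrightarrow> H (m + 1) < H j)"
proof -
  have "label stack_map m = Some s \<longleftrightarrow>
    (s \<le> m \<and> H s \<le> H (m + 1)) \<and> (\<forall>j. j \<le> m \<and> H j \<le> H (m + 1) \<longrightarrow> j \<le> s)"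
    unfolding label_stack_map by (rule last_such_eq_Some_iff[where b = m]) simp
  also have "\<dots> \<longleftrightarrow>
      s \<le> m \<and> H s \<le> H (m + 1) \<and> (\<forall>j. s < j \<and> j \<le> m \<longrightarrow> H (m + 1) < H j)"
    by (auto simp: not_le[symmetric])
  finally show ?thesis .
qed

text \<open>The plates of \<open>s\<close> occupy the \<open>k s\<close> levels from
  \<open>H s\<close> upwards, and each of them is taken by exactly one position.\<close>

lemma multiplicity_stack_map: "multiplicity stack_map s = k s"
proof -
  have "bij_betw (\<lambda>m. H (m + 1)) {m. label stack_map m = Some s} {H s..<H s + int (k s)}"
    unfolding bij_betw_def
  proof (intro conjI inj_onI equalityI subsetI)
    fix x y
    assume xy: "x \<in> {m. label stack_map m = Some s}" "y \<in> {m. label stack_map m = Some s}"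
      and eq: "H (x + 1) = H (y + 1)"
    have False if "x < y" "label stack_map x = Some s" "label stack_map y = Some s"
      "H (x + 1) = H (y + 1)" for x y
    proof -
      have "s < x + 1 \<and> x + 1 \<le> y \<longrightarrow> H (y + 1) < H (x + 1)" "s \<le> x"
        using that unfolding label_stack_map_iff by blast+
      with that show False by simp
    qed
    then show "x = y" using xy eq by (metis linorder_neqE mem_Collect_eq)
  next
    fix L assume "L \<in> (\<lambda>m. H (m + 1)) ` {m. label stack_map m = Some s}"
    then obtain m where m: "label stack_map m = Some s" "L = H (m + 1)" by auto
    then have "L \<le> H (s + 1)"
      unfolding label_stack_map_iff by (cases "m = s") (auto simp: less_imp_le)
    then show "L \<in> {H s..<H s + int (k s)}"
      using m H_step[of s] by (simp add: label_stack_map_iff)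
  next
    fix L assume L: "L \<in> {H s..<H s + int (k s)}"
    then obtain l where l: "s \<le> l" "H (l + 1) = L" "\<And>j. \<lbrakk>s \<le> j; j < l\<rbrakk> \<Longrightarrow> L < H (j + 1)"
      using first_passage[of s s L] H_step[of s] by auto
    have "H (l + 1) < H j" if "s < j" "j \<le> l" for j using l(3)[of "j - 1"] that l by simp
    then have "label stack_map l = Some s" using l L unfolding label_stack_map_iff by auto
    with l show "L \<in> (\<lambda>m. H (m + 1)) ` {m. label stack_map m = Some s}" by auto
  qed
  from bij_betw_same_card[OF this] show ?thesis by (simp add: multiplicity_def)
qed

end

section \<open>The hyperoctahedral group and its reflection length\<close>

lemma axis_inner_axis: "axis i (1::real) \<bullet> axis j 1 = (if i = j then 1 else 0)"
  by (simp add: inner_axis_axis)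

lemma mat_eq_axisI:
  fixes A B :: "real^'n^'m"
  assumes "\<And>j. A *v axis j 1 = B *v axis j 1"
  shows "A = B"
  using assms by (simp add: matrix_vector_mult_basis column_def vec_eq_iff)

lemma signed_permutation_matrix_iff:
  fixes w :: "real^'n^'n"
  shows "signed_permutation_matrix w \<longleftrightarrow>
    (\<exists>p s. bij p \<and> (\<forall>j. s j \<in> {1, -1}) \<and> (\<forall>j. w *v axis j 1 = s j *\<^sub>R axis (p j) 1))"
proof -
  have "w = (\<chi> i j. if i = p j then s j else 0) \<longleftrightarrow>
      (\<forall>j. w *v axis j 1 = s j *\<^sub>R axis (p j) 1)" for p s
  proof -
    have "(w *v axis j 1) $ i = w $ i $ j" for i j
      by (simp add: matrix_vector_mult_basis column_def)
    then show ?thesis by (simp add: vec_eq_iff) (auto simp: axis_def)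
  qed
  then show ?thesis unfolding signed_permutation_matrix_def by simp
qed

lemma carrier_W [simp]: "w \<in> carrier \<W> \<longleftrightarrow> signed_permutation_matrix w"
  by (simp add: hyperoctahedral_def)

lemma mult_W [simp]: "u \<otimes>\<^bsub>\<W>\<^esub> w = u ** w"
  by (simp add: hyperoctahedral_def)

lemma one_W [simp]: "\<one>\<^bsub>\<W>\<^esub> = mat 1"
  by (simp add: hyperoctahedral_def)

lemma signed_permutation_matrix_1: "signed_permutation_matrix (mat 1)"
  unfolding signed_permutation_matrix_iff by (intro exI[of _ id] exI[of _ "\<lambda>_. 1"]) simp

lemma signed_permutation_matrix_mult:
  fixes u w :: "real^'n^'n"
  assumes "signed_permutation_matrix u" "signed_permutation_matrix w"
  shows "signed_permutation_matrix (u ** w)"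
proof -
  obtain p s where u: "bij p" "\<forall>j. s j \<in> {1, -1::real}" "\<forall>j. u *v axis j 1 = s j *\<^sub>R axis (p j) 1"
    using assms(1) unfolding signed_permutation_matrix_iff by blast
  obtain q t where w: "bij q" "\<forall>j. t j \<in> {1, -1::real}" "\<forall>j. w *v axis j 1 = t j *\<^sub>R axis (q j) 1"
    using assms(2) unfolding signed_permutation_matrix_iff by blast
  have "(u ** w) *v axis j 1 = (s (q j) * t j) *\<^sub>R axis ((p \<circ> q) j) 1" for j
    using u(3) w(3) by (simp add: matrix_vector_mul_assoc[symmetric] matrix_vector_mult_scaleR)
  moreover have "s (q j) * t j \<in> {1, -1}" for j
    using u(2)[rule_format, of "q j"] w(2)[rule_format, of j] by auto
  moreover have "bij (p \<circ> q)" using u(1) w(1) by (rule bij_comp[rotated])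
  ultimately show ?thesis unfolding signed_permutation_matrix_iff
    by (intro exI[of _ "p \<circ> q"] exI[of _ "\<lambda>j. s (q j) * t j"]) auto
qed

lemma signed_permutation_matrix_orthogonal:
  fixes w :: "real^'n^'n"
  assumes "signed_permutation_matrix w"
  shows "orthogonal_matrix w"
proof -
  obtain p s where w: "bij p" "\<forall>j. s j \<in> {1, -1::real}" "\<forall>j. w *v axis j 1 = s j *\<^sub>R axis (p j) 1"
    using assms unfolding signed_permutation_matrix_iff by blast
  then have col: "column j w = s j *\<^sub>R axis (p j) 1" for j
    by (simp add: matrix_vector_mult_basis)
  have "\<bar>s j\<bar> = 1" for j using w(2)[rule_format, of j] by auto
  moreover have "p i \<noteq> p j" if "i \<noteq> j" for i j
    using w(1) that by (metis bij_pointE)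
  ultimately show ?thesis
    unfolding orthogonal_matrix_orthonormal_columns by (simp add: col orthogonal_def axis_inner_axis)
qed

lemma signed_permutation_matrix_transpose:
  fixes w :: "real^'n^'n"
  assumes "signed_permutation_matrix w"
  shows "signed_permutation_matrix (transpose w)" "transpose w ** w = mat 1"
proof -
  show tw: "transpose w ** w = mat 1"
    using signed_permutation_matrix_orthogonal[OF assms] by (simp add: orthogonal_matrix)
  obtain p s where w: "bij p" "\<forall>j. s j \<in> {1, -1::real}" "\<forall>j. w *v axis j 1 = s j *\<^sub>R axis (p j) 1"
    using assms unfolding signed_permutation_matrix_iff by blast
  have "transpose w *v axis j 1 = s (inv_into UNIV p j) *\<^sub>R axis (inv_into UNIV p j) 1" for j
  proof -
    define i where "i = inv_into UNIV p j"
    have "p i = j" unfolding i_def using w(1) by (simp add: bij_is_surj surj_f_inv_f)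
    have "s i *\<^sub>R (transpose w *v axis (p i) 1) = transpose w *v (w *v axis i 1)"
      using w(3) by (simp add: matrix_vector_mult_scaleR)
    also have "\<dots> = axis i 1" by (simp add: matrix_vector_mul_assoc tw)
    finally have "s i *\<^sub>R s i *\<^sub>R (transpose w *v axis j 1) = s i *\<^sub>R axis i 1"
      using \<open>p i = j\<close> by simp
    moreover have "s i * s i = 1" using w(2)[rule_format, of i] by auto
    ultimately show ?thesis by (simp add: i_def)
  qed
  moreover have "bij (inv_into UNIV p)" using w(1) by (rule bij_imp_bij_inv)
  ultimately show "signed_permutation_matrix (transpose w)"
    unfolding signed_permutation_matrix_iff using w(2)
    by (intro exI[of _ "inv_into UNIV p"] exI[of _ "\<lambda>j. s (inv_into UNIV p j)"]) simp
qed

lemma group_W: "group (\<W> :: (real^'n^'n) monoid)"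
proof (rule groupI)
  fix w :: "real^'n^'n" assume "w \<in> carrier \<W>"
  then show "\<exists>y\<in>carrier \<W>. y \<otimes>\<^bsub>\<W>\<^esub> w = \<one>\<^bsub>\<W>\<^esub>"
    using signed_permutation_matrix_transpose[of w] by auto
qed (simp_all add: signed_permutation_matrix_mult signed_permutation_matrix_1 matrix_mul_assoc)

lemma inv_W: "signed_permutation_matrix w \<Longrightarrow> inv\<^bsub>\<W>\<^esub> w = transpose w"
  using group.inv_equality[OF group_W, of "transpose w" w] signed_permutation_matrix_transpose[of w]
  by simp

lemma signed_permutation_matrix_inner:
  fixes w :: "real^'n^'n"
  assumes "signed_permutation_matrix w"
  shows "(w *v x) \<bullet> (w *v y) = x \<bullet> y"
proof -
  have "orthogonal_transformation ((*v) w)"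
    unfolding orthogonal_transformation_matrix
    using signed_permutation_matrix_orthogonal[OF assms] by simp
  then show ?thesis by (simp add: orthogonal_transformation_def)
qed

lemma refl_matrix_mult: "refl_matrix a *v x = x - (2 * (x \<bullet> a) / (a \<bullet> a)) *\<^sub>R a"
proof -
  have "linear (\<lambda>x. x - (2 * (x \<bullet> a) / (a \<bullet> a)) *\<^sub>R a)"
    by (rule linearI) (simp_all add: inner_add_left algebra_simps add_divide_distrib)
  from fun_cong[OF matrix_vector_mul(2)[OF this], of x] show ?thesis
    by (simp only: refl_matrix_def)
qed

lemma refl_matrix_scaleR: "k \<noteq> 0 \<Longrightarrow> refl_matrix (k *\<^sub>R a) = refl_matrix a"
  by (rule mat_eq_axisI) (simp add: refl_matrix_mult)

lemma refl_matrix_involution: "a \<noteq> 0 \<Longrightarrow> refl_matrix a ** refl_matrix a = mat 1"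
  by (rule mat_eq_axisI)
    (simp add: matrix_vector_mul_assoc[symmetric] refl_matrix_mult inner_diff_left)

lemma refl_matrix_eq_self_iff: "a \<noteq> 0 \<Longrightarrow> refl_matrix a *v x = x \<longleftrightarrow> x \<bullet> a = 0"
  by (simp add: refl_matrix_mult)

lemma signed_permutation_matrix_refl_axis: "signed_permutation_matrix (refl_matrix (axis i 1))"
  unfolding signed_permutation_matrix_iff
  by (intro exI[of _ id] exI[of _ "\<lambda>j. if j = i then -1 else 1"])
    (auto simp: refl_matrix_mult axis_inner_axis scaleR_2)

lemma signed_permutation_matrix_refl_edge:
  assumes "i \<noteq> j" "s \<in> {1, -1}"
  shows "signed_permutation_matrix (refl_matrix (axis i 1 - s *\<^sub>R axis j 1))"
proof -
  have s: "s * s = 1" using assms by auto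
  let ?a = "axis i 1 - s *\<^sub>R axis j (1::real)"
  have aa: "?a \<bullet> ?a = 2"
    using assms s by (simp add: inner_diff_left inner_diff_right axis_inner_axis)
  have "refl_matrix ?a *v axis k 1 =
      (if k = i \<or> k = j then s else 1) *\<^sub>R axis (Transposition.transpose i j k) 1" for k
    using assms s aa
    by (auto simp: refl_matrix_mult inner_diff_left inner_diff_right axis_inner_axis
        Transposition.transpose_def scaleR_diff_right)
  moreover have "bij (Transposition.transpose i j)" by simp
  ultimately show ?thesis using assms unfolding signed_permutation_matrix_iff
    by (intro exI[of _ "Transposition.transpose i j"] exI[of _ "\<lambda>k. if k = i \<or> k = j then s else 1"])
      auto
qed

lemma reflections_iff:
  "t \<in> reflections \<longleftrightarrow> signed_permutation_matrix t \<and> (\<exists>a. a \<noteq> 0 \<and> t = refl_matrix a)"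
  by (simp add: reflections_def)

section \<open>Reflection length as the codimension of the fixed space\<close>

abbreviation list_prod :: "(real^'n^'n) list \<Rightarrow> real^'n^'n" where
  "list_prod ts \<equiv> foldr (**) ts (mat 1)"

lemma subspace_fixed_space: "subspace (fixed_space w)"
  unfolding fixed_space_def subspace_def
  by (simp add: matrix_vector_right_distrib matrix_vector_mult_scaleR)

lemma dim_Int_hyperplane_ge:
  fixes S :: "(real^'n) set"
  assumes "subspace S"
  shows "dim S \<le> dim (S \<inter> {x. x \<bullet> a = 0}) + 1"
proof (cases "a = 0")
  case False
  have sub: "subspace {x. x \<bullet> a = 0}"
    by (auto simp: subspace_def inner_add_left)
  have "dim {x. x \<bullet> a = 0} = CARD('n) - 1"
    using dim_hyperplane[OF False] by (simp add: inner_commute)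
  moreover have "dim {x + y |x y. x \<in> S \<and> y \<in> {x. x \<bullet> a = 0}} \<le> CARD('n)"
    using dim_subset_UNIV[of "{x + y |x y. x \<in> S \<and> y \<in> {x. x \<bullet> a = 0}}"] by simp
  moreover have "0 < CARD('n)" by simp
  ultimately show ?thesis using dim_sums_Int[OF assms sub] by linarith
qed simp

text \<open>The product \<open>t w\<close> fixes whatever \<open>w\<close> fixes on the mirror of
  \<open>t\<close>, so every factor costs at most one dimension.\<close>

lemma length_ge_codim_fixed_space:
  fixes ts :: "(real^'n^'n) list"
  assumes "set ts \<subseteq> reflections"
  shows "CARD('n) \<le> length ts + dim (fixed_space (list_prod ts))"
  using assms
proof (induction ts)
  case Nil
  have "fixed_space (mat 1 :: real^'n^'n) = UNIV" by (simp add: fixed_space_def)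
  then show ?case by simp
next
  case (Cons t ts)
  then obtain a where a: "a \<noteq> 0" "t = refl_matrix a" by (auto simp: reflections_iff)
  have "fixed_space (list_prod ts) \<inter> {x. x \<bullet> a = 0} \<subseteq> fixed_space (list_prod (t # ts))"
    using a refl_matrix_eq_self_iff[OF a(1)]
    by (auto simp: fixed_space_def matrix_vector_mul_assoc[symmetric])
  then have "dim (fixed_space (list_prod ts) \<inter> {x. x \<bullet> a = 0}) \<le> dim (fixed_space (list_prod (t # ts)))"
    by (rule dim_subset)
  then show ?case
    using dim_Int_hyperplane_ge[OF subspace_fixed_space, of "list_prod ts" a] Cons by simp
qed

text \<open>The reflection that exchanges \<open>axis i 1\<close> with its image under
  \<open>w\<close> belongs to the group, since their difference is a multiple of a root. Its mirror
  contains the fixed space of \<open>w\<close>, and the product fixes \<open>axis i 1\<close> in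
  addition.\<close>

lemma reflection_increasing_fixed_space:
  fixes w :: "real^'n^'n"
  assumes w: "signed_permutation_matrix w" and "w \<noteq> mat 1"
  obtains t where "t \<in> reflections" "t ** t = mat 1"
    "dim (fixed_space w) < dim (fixed_space (t ** w))"
proof -
  obtain i where i: "w *v axis i 1 \<noteq> axis i 1"
    using mat_eq_axisI[of w "mat 1"] assms(2) by auto
  obtain p s where ps: "bij p" "\<forall>j. s j \<in> {1, -1::real}" "\<forall>j. w *v axis j 1 = s j *\<^sub>R axis (p j) 1"
    using w unfolding signed_permutation_matrix_iff by blast
  define a where "a = w *v axis i 1 - axis i 1"
  have a0: "a \<noteq> 0" using i by (simp add: a_def)
  have "signed_permutation_matrix (refl_matrix a)"
  proof (cases "p i = i")
    case True
    then have "a = (- 2) *\<^sub>R axis i 1"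
      using ps(2)[rule_format, of i] ps(3) i by (auto simp: a_def scaleR_2)
    then have "refl_matrix a = refl_matrix (axis i 1)" by (simp only:) (rule refl_matrix_scaleR, simp)
    then show ?thesis by (simp only: signed_permutation_matrix_refl_axis)
  next
    case False
    have "a = (- 1) *\<^sub>R (axis i 1 - s i *\<^sub>R axis (p i) 1)" using ps(3) by (simp add: a_def)
    then have "refl_matrix a = refl_matrix (axis i 1 - s i *\<^sub>R axis (p i) 1)"
      by (simp only:) (rule refl_matrix_scaleR, simp)
    then show ?thesis using signed_permutation_matrix_refl_edge[of i "p i" "s i"] False ps(2) by simp
  qed
  then have refl: "refl_matrix a \<in> reflections" using a0 by (auto simp: reflections_iff)
  have perp: "x \<bullet> a = 0" if "x \<in> fixed_space w" for x
    using signed_permutation_matrix_inner[OF w, of x "axis i 1"] that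
    by (simp add: a_def inner_diff_right fixed_space_def)
  have sub: "fixed_space w \<subseteq> fixed_space (refl_matrix a ** w)"
  proof
    fix x assume x: "x \<in> fixed_space w"
    then show "x \<in> fixed_space (refl_matrix a ** w)"
      using refl_matrix_eq_self_iff[OF a0, of x] perp[OF x]
      by (simp add: fixed_space_def matrix_vector_mul_assoc[symmetric])
  qed
  have "2 * ((w *v axis i 1) \<bullet> a) = a \<bullet> a"
    using signed_permutation_matrix_inner[OF w, of "axis i 1" "axis i 1"]
    by (simp add: a_def inner_diff_right inner_diff_left inner_commute)
  then have "refl_matrix a *v (w *v axis i 1) = axis i 1"
    using a0 by (simp add: refl_matrix_mult) (simp add: a_def)
  then have "axis i 1 \<in> fixed_space (refl_matrix a ** w)"
    by (simp add: fixed_space_def matrix_vector_mul_assoc[symmetric])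
  moreover have "axis i 1 \<notin> fixed_space w" using i by (simp add: fixed_space_def)
  ultimately have "fixed_space w \<subset> fixed_space (refl_matrix a ** w)" using sub by blast
  then have "dim (fixed_space w) < dim (fixed_space (refl_matrix a ** w))"
    by (intro dim_psubset) (simp only: span_eq_iff[THEN iffD2, OF subspace_fixed_space])
  with refl refl_matrix_involution[OF a0] show ?thesis using that by blast
qed

lemma reflection_factorization:
  fixes w :: "real^'n^'n"
  assumes "signed_permutation_matrix w"
  obtains ts where "set ts \<subseteq> reflections" "w = list_prod ts"
    "length ts + dim (fixed_space w) \<le> CARD('n)"
proof -
  have "\<exists>ts. set ts \<subseteq> reflections \<and> w = list_prod ts \<and> length ts + dim (fixed_space w) \<le> CARD('n)"
    using assms
  proof (induction "CARD('n) - dim (fixed_space w)" arbitrary: w rule: less_induct)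
    case less
    have le: "dim (fixed_space u) \<le> CARD('n)" for u :: "real^'n^'n"
      using dim_subset_UNIV[of "fixed_space u"] by simp
    show ?case
    proof (cases "w = mat 1")
      case True
      then show ?thesis using le by (intro exI[of _ "[]"]) simp
    next
      case False
      obtain t where t: "t \<in> reflections" "t ** t = mat 1"
          "dim (fixed_space w) < dim (fixed_space (t ** w))"
        using reflection_increasing_fixed_space[OF less.prems False] by blast
      have "CARD('n) - dim (fixed_space (t ** w)) < CARD('n) - dim (fixed_space w)"
        using t(3) le[of "t ** w"] by linarith
      moreover have "signed_permutation_matrix (t ** w)"
        using t(1) less.prems by (simp add: reflections_iff signed_permutation_matrix_mult)
      ultimately obtain ts where ts: "set ts \<subseteq> reflections" "t ** w = list_prod ts"
          "length ts + dim (fixed_space (t ** w)) \<le> CARD('n)"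
        using less.hyps by blast
      have "list_prod (t # ts) = (t ** t) ** w"
        using ts(2) by (simp add: matrix_mul_assoc[symmetric])
      then have "w = list_prod (t # ts)" using t(2) by simp
      then show ?thesis using t ts by (intro exI[of _ "t # ts"]) auto
    qed
  qed
  then show ?thesis using that by blast
qed

lemma refl_length_eq_codim:
  fixes w :: "real^'n^'n"
  assumes "signed_permutation_matrix w"
  shows "refl_length w + dim (fixed_space w) = CARD('n)"
proof -
  obtain ts where ts: "set ts \<subseteq> reflections" "w = list_prod ts"
      "length ts + dim (fixed_space w) \<le> CARD('n)"
    using reflection_factorization[OF assms] by blast
  have "refl_length w = CARD('n) - dim (fixed_space w)"
    unfolding refl_length_def
  proof (rule Least_equality)
    have "length ts = CARD('n) - dim (fixed_space w)"
      using length_ge_codim_fixed_space[OF ts(1)] ts by simp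
    then show "\<exists>ts. length ts = CARD('n) - dim (fixed_space w) \<and> set ts \<subseteq> reflections \<and>
        w = foldr (\<lambda>t u. t \<otimes>\<^bsub>\<W>\<^esub> u) ts \<one>\<^bsub>\<W>\<^esub>"
      using ts by (intro exI[of _ ts]) simp
  next
    fix k
    assume "\<exists>ts. length ts = k \<and> set ts \<subseteq> reflections \<and>
        w = foldr (\<lambda>t u. t \<otimes>\<^bsub>\<W>\<^esub> u) ts \<one>\<^bsub>\<W>\<^esub>"
    then obtain ts where "length ts = k" "set ts \<subseteq> reflections" "w = list_prod ts" by auto
    then show "CARD('n) - dim (fixed_space w) \<le> k"
      using length_ge_codim_fixed_space[of ts] by simp
  qed
  with ts(3) show ?thesis by simp
qed

section \<open>Noncrossing elements and noncrossing lifts\<close>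

lemma matrix_vector_mult_sum: "w *v (\<Sum>j\<in>A. f j) = (\<Sum>j\<in>A. w *v f j)"
  for w :: "real^'n^'n"
  by (rule linear_sum[OF matrix_vector_mul_linear])

lemma matrix_vector_mult_minus: "w *v (- x) = - (w *v x)" for w :: "real^'n^'n"
  by (rule linear_neg[OF matrix_vector_mul_linear])

text \<open>The signed basis vectors form one orbit of \<open>c\<close>. The enumeration is defined
  on all integers, with period \<open>2 N\<close>, so that positions can be shifted without
  reduction.\<close>

locale signed_cycle =
  fixes c :: "real^'n^'n" and e :: "int \<Rightarrow> real^'n" and N :: int
  assumes N_eq: "N = int CARD('n)"
    and signed_c: "signed_permutation_matrix c"
    and c_e: "c *v e m = e (m + 1)"
    and e_antiperiodic: "e (m + N) = - e m"
    and e_axis: "\<exists>i. \<exists>s\<in>{1, -1}. e m = s *\<^sub>R axis i 1"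
    and e_onto: "\<exists>m. e m = axis i 1"
begin

definition ax :: "int \<Rightarrow> 'n" where
  "ax m = (SOME i. \<exists>s\<in>{1, -1}. e m = s *\<^sub>R axis i 1)"

definition sg :: "int \<Rightarrow> real" where
  "sg m = e m $ ax m"

lemma N_pos: "0 < N" by (simp add: N_eq)

lemma e_eq: "e m = sg m *\<^sub>R axis (ax m) 1" and sg_cases: "sg m = 1 \<or> sg m = -1"
proof -
  obtain s where s: "s \<in> {1, -1}" "e m = s *\<^sub>R axis (ax m) 1"
    using someI_ex[OF e_axis, of m] unfolding ax_def by blast
  then have "sg m = s" by (simp add: sg_def)
  with s show "e m = sg m *\<^sub>R axis (ax m) 1" "sg m = 1 \<or> sg m = -1" by auto
qed

lemma ax_eqI: "e m = s *\<^sub>R axis i 1 \<Longrightarrow> ax m = i"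
proof -
  assume "e m = s *\<^sub>R axis i 1"
  then have "(sg m *\<^sub>R axis (ax m) 1) $ ax m = (s *\<^sub>R axis i (1::real)) $ ax m"
    using e_eq[of m] by simp
  then show ?thesis using sg_cases[of m] by (auto simp: axis_def split: if_splits)
qed

lemma ax_shift: "ax (m + N) = ax m"
  using e_antiperiodic[of m] e_eq[of m] by (intro ax_eqI[of _ "- sg m"]) simp

lemma e_shift_multiple: "e (m + q * (2 * N)) = e m"
proof (induction q rule: int_induct[where k = 0])
  case (step1 q)
  have "e (m + (q + 1) * (2 * N)) = e (m + q * (2 * N) + N + N)"
    by (rule arg_cong[where f = e]) (simp add: algebra_simps)
  then show ?case using step1 by (simp only: e_antiperiodic minus_minus)
next
  case (step2 q)
  have "e (m + q * (2 * N)) = e (m + (q - 1) * (2 * N) + N + N)"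
    by (rule arg_cong[where f = e]) (simp add: algebra_simps)
  then show ?case using step2 by (simp only: e_antiperiodic minus_minus)
qed simp

lemma e_period: "2 * N dvd a - b \<Longrightarrow> e a = e b"
proof -
  assume "2 * N dvd a - b"
  then obtain q where "a - b = 2 * N * q" by (elim dvdE)
  then have "a = b + q * (2 * N)" by (simp add: algebra_simps)
  then show ?thesis using e_shift_multiple by simp
qed

lemma ax_shift_multiple: "ax (m + q * N) = ax m"
proof (induction q rule: int_induct[where k = 0])
  case (step1 q)
  have "ax (m + (q + 1) * N) = ax (m + q * N + N)"
    by (rule arg_cong[where f = ax]) (simp add: algebra_simps)
  then show ?case using step1 by (simp only: ax_shift)
next
  case (step2 q)
  have "ax (m + q * N) = ax (m + (q - 1) * N + N)"
    by (rule arg_cong[where f = ax]) (simp add: algebra_simps)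
  then show ?case using step2 by (simp only: ax_shift)
qed simp

lemma ax_mod: "ax (m mod N) = ax m"
  using ax_shift_multiple[of "m mod N" "m div N"] by simp

lemma bij_betw_ax: "bij_betw ax {0..<N} UNIV"
proof -
  have "i \<in> ax ` {0..<N}" for i
  proof -
    obtain m where "e m = axis i 1" using e_onto by blast
    then have "ax (m mod N) = i" using ax_eqI[of m 1 i] ax_mod by simp
    moreover have "m mod N \<in> {0..<N}" using N_pos by simp
    ultimately show ?thesis by blast
  qed
  then have surj: "ax ` {0..<N} = UNIV" by auto
  then have "inj_on ax {0..<N}" by (intro eq_card_imp_inj_on) (simp_all add: N_eq)
  with surj show ?thesis by (simp add: bij_betw_def)
qed

lemma ax_eq_iff: "ax a = ax b \<longleftrightarrow> N dvd a - b"
proof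
  assume "ax a = ax b"
  then have "ax (a mod N) = ax (b mod N)" by (simp only: ax_mod)
  moreover have "a mod N \<in> {0..<N}" "b mod N \<in> {0..<N}" using N_pos by simp_all
  ultimately have "a mod N = b mod N"
    by (rule inj_onD[OF bij_betw_imp_inj_on[OF bij_betw_ax]])
  then show "N dvd a - b" by (simp add: mod_eq_dvd_iff)
next
  assume "N dvd a - b"
  then have "a mod N = b mod N" by (simp add: mod_eq_dvd_iff)
  then show "ax a = ax b" using ax_mod by metis
qed

lemma inner_e_self [simp]: "e a \<bullet> e a = 1"
  using sg_cases[of a] e_eq[of a] by (auto simp: axis_inner_axis)

lemma inner_e_0: "\<not> N dvd a - b \<Longrightarrow> e a \<bullet> e b = 0"
  using e_eq[of a] e_eq[of b] by (simp add: ax_eq_iff[symmetric] axis_inner_axis)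

lemma inner_e_window: "\<lbrakk>a \<noteq> b; \<bar>a - b\<bar> < N\<rbrakk> \<Longrightarrow> e a \<bullet> e b = 0"
  using zdvd_imp_le[of N "\<bar>a - b\<bar>"] by (intro inner_e_0) auto

lemma inner_e_pos: "0 < e a \<bullet> e b \<Longrightarrow> 2 * N dvd a - b"
proof -
  assume pos: "0 < e a \<bullet> e b"
  then have "N dvd a - b" using inner_e_0[of a b] by force
  then obtain q where q: "a - b = N * q" by (elim dvdE)
  have "even q"
  proof (rule ccontr)
    assume "odd q"
    then obtain r where "q = 2 * r + 1" by (elim oddE)
    then have "a = b + N + r * (2 * N)" using q by (simp add: algebra_simps)
    then have "e a = - e b" using e_shift_multiple[of "b + N" r] e_antiperiodic[of b] by simp
    then show False using pos by simp
  qed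
  then show ?thesis using q by (auto elim!: evenE)
qed

lemma e_eq_iff: "e a = e b \<longleftrightarrow> 2 * N dvd a - b"
  using e_period[of a b] inner_e_pos[of a b] by (metis inner_e_self zero_less_one)

lemma vec_eqI_e: "(\<And>m. x \<bullet> e m = y \<bullet> e m) \<Longrightarrow> x = y"
proof -
  assume *: "\<And>m. x \<bullet> e m = y \<bullet> e m"
  have "x $ i = y $ i" for i
  proof -
    obtain m where "e m = axis i 1" using e_onto by blast
    then show ?thesis using *[of m] by (simp add: inner_axis)
  qed
  then show ?thesis by (simp add: vec_eq_iff)
qed

lemma mat_eqI_e:
  fixes A B :: "real^'n^'n"
  assumes "\<And>m. A *v e m = B *v e m"
  shows "A = B"
proof (rule mat_eq_axisI)
  fix j
  obtain m where "e m = axis j 1" using e_onto by blast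
  then show "A *v axis j 1 = B *v axis j 1" using assms[of m] by simp
qed

lemma inner_c: "(c *v x) \<bullet> e (m + 1) = x \<bullet> e m"
  using signed_permutation_matrix_inner[OF signed_c, of x "e m"] by (simp add: c_e)

text \<open>A fixed vector has the same inner product with all \<open>e m\<close>, among which are
  opposite vectors.\<close>

lemma c_fixed: "c *v x = x \<Longrightarrow> x = 0"
proof -
  assume fixed: "c *v x = x"
  have "x \<bullet> e (m + int d) = x \<bullet> e m" for m d
  proof (induction d)
    case (Suc d)
    then show ?case using inner_c[of x "m + int d"] fixed by (simp add: algebra_simps)
  qed simp
  from this[of _ "CARD('n)"] have "x \<bullet> e (m + N) = x \<bullet> e m" for m by (simp only: N_eq)
  then have "x \<bullet> e m = 0 \<bullet> e m" for m by (simp add: e_antiperiodic)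
  then show ?thesis by (rule vec_eqI_e)
qed

lemma c_minus_1_inj: "c *v x - x = c *v y - y \<Longrightarrow> x = y"
  using c_fixed[of "x - y"] by (simp add: matrix_vector_mult_diff_distrib algebra_simps)

text \<open>The \<open>y\<close> with \<open>w y = c y\<close> form the fixed space of the inverse
  of \<open>w\<close> times \<open>c\<close>. It meets the fixed space of \<open>w\<close> only in
  0, as \<open>c\<close> has no other fixed vector, so the lengths add up exactly when the two
  dimensions add up to \<open>n\<close>.\<close>

lemma mem_NC_iff:
  "w \<in> NC c \<longleftrightarrow> signed_permutation_matrix w \<and>
    (\<forall>z. \<exists>x y. z = x + y \<and> w *v x = x \<and> w *v y = c *v y)"
proof (cases "signed_permutation_matrix w")
  case True
  let ?X = "fixed_space w"
  let ?u = "transpose w ** c"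
  let ?Y = "fixed_space ?u"
  note tw = signed_permutation_matrix_transpose[OF True]
  have su: "signed_permutation_matrix ?u"
    using tw(1) signed_c by (rule signed_permutation_matrix_mult)
  have wtw: "w ** transpose w = mat 1" using tw(2) matrix_left_right_inverse by blast
  have Y: "y \<in> ?Y \<longleftrightarrow> w *v y = c *v y" for y
  proof
    assume "y \<in> ?Y"
    then have "transpose w *v (c *v y) = y" by (simp add: fixed_space_def matrix_vector_mul_assoc)
    then have "w *v y = (w ** transpose w) *v (c *v y)"
      by (simp only: matrix_vector_mul_assoc[symmetric])
    then show "w *v y = c *v y" by (simp add: wtw)
  next
    assume "w *v y = c *v y"
    then have "transpose w *v (w *v y) = transpose w *v (c *v y)" by simp
    then show "y \<in> ?Y" by (simp add: fixed_space_def matrix_vector_mul_assoc tw)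
  qed
  have "?X \<inter> ?Y = {0}"
  proof -
    have "x = 0" if "x \<in> ?X" "x \<in> ?Y" for x
      using that Y[of x] by (intro c_fixed) (simp add: fixed_space_def)
    moreover have "0 \<in> ?X" "0 \<in> ?Y" by (auto intro: subspace_0 subspace_fixed_space)
    ultimately show ?thesis by blast
  qed
  then have dims: "dim {x + y |x y. x \<in> ?X \<and> y \<in> ?Y} = dim ?X + dim ?Y"
    using dim_sums_Int[OF subspace_fixed_space subspace_fixed_space, of w ?u] by simp
  have "fixed_space c = {0}"
    using c_fixed subspace_0[OF subspace_fixed_space, of c] by (auto simp: fixed_space_def)
  then have "refl_length c = CARD('n)" using refl_length_eq_codim[OF signed_c] by simp
  then have "w \<in> NC c \<longleftrightarrow> dim ?X + dim ?Y = CARD('n)"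
    using refl_length_eq_codim[OF True] refl_length_eq_codim[OF su] True
    by (auto simp: NC_def abs_le_def inv_W)
  also have "\<dots> \<longleftrightarrow> dim {x + y |x y. x \<in> ?X \<and> y \<in> ?Y} = DIM(real^'n)"
    by (simp add: dims)
  also have "\<dots> \<longleftrightarrow> {x + y |x y. x \<in> ?X \<and> y \<in> ?Y} = UNIV"
    using span_eq_iff[THEN iffD2, OF subspace_sums[OF subspace_fixed_space subspace_fixed_space], of w ?u]
    by (simp only: dim_eq_full)
  also have "\<dots> \<longleftrightarrow> (\<forall>z. \<exists>x y. z = x + y \<and> w *v x = x \<and> w *v y = c *v y)"
    using Y by (auto simp: fixed_space_def set_eq_iff)
  finally show ?thesis using True by simp
qed (simp add: NC_def)

text \<open>If \<open>w\<close> and \<open>u\<close> have the same fixed space \<open>X\<close> and \<open>z = x + y = x' + y'\<close> are the two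
  decompositions, then \<open>d = x - x' \<in> X\<close> satisfies \<open>d - c d \<in> X\<^sup>\<bottom>\<close>, so that \<open>c d = d\<close>.\<close>

lemma NC_eqI:
  assumes "w \<in> NC c" "u \<in> NC c" and fix_eq: "fixed_space w = fixed_space u"
  shows "w = u"
proof (rule mat_eqI_e)
  fix m
  have w: "signed_permutation_matrix w" and u: "signed_permutation_matrix u"
    using assms mem_NC_iff by auto
  obtain x y where xy: "e m = x + y" "w *v x = x" "w *v y = c *v y"
    using assms(1) mem_NC_iff by blast
  obtain x' y' where xy': "e m = x' + y'" "u *v x' = x'" "u *v y' = c *v y'"
    using assms(2) mem_NC_iff by blast
  let ?d = "x - x'"
  have fixed: "w *v v = v \<longleftrightarrow> u *v v = v" for v
    using fix_eq by (auto simp: fixed_space_def)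
  have d: "w *v ?d = ?d" "u *v ?d = ?d"
    using xy xy' fixed[of x] fixed[of x'] by (simp_all add: matrix_vector_mult_diff_distrib)
  have perp: "(w *v v - v) \<bullet> ?d = 0" "(u *v v - v) \<bullet> ?d = 0" for v
    using signed_permutation_matrix_inner[OF w, of v ?d] d
      signed_permutation_matrix_inner[OF u, of v ?d]
    by (simp_all add: inner_diff_left)
  have diff: "w *v e m - u *v e m = ?d - c *v ?d"
  proof -
    have "w *v e m = x + c *v y" "c *v y = c *v e m - c *v x"
      using xy by (simp_all add: matrix_vector_right_distrib)
    moreover have "u *v e m = x' + c *v y'" "c *v y' = c *v e m - c *v x'"
      using xy' by (simp_all add: matrix_vector_right_distrib)
    ultimately show ?thesis by (simp add: matrix_vector_mult_diff_distrib)
  qed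
  have "(?d - c *v ?d) \<bullet> ?d = 0"
    using perp[of "e m"] unfolding diff[symmetric] by (simp add: inner_diff_left)
  then have "(?d - c *v ?d) \<bullet> (?d - c *v ?d) = 0"
    using signed_permutation_matrix_inner[OF signed_c, of ?d ?d]
    by (simp add: inner_diff_left inner_diff_right inner_commute)
  then show "w *v e m = u *v e m" using diff by simp
qed

section \<open>Lifting signed permutations to the integers\<close>

definition lift :: "real^'n^'n \<Rightarrow> int \<Rightarrow> int" where
  "lift w m = (THE t. m - N < t \<and> t \<le> m + N \<and> w *v e m = e t)"

text \<open>The window consists of \<open>2 N\<close> consecutive integers and so contains every
  residue modulo the period of \<open>e\<close> exactly once.\<close>

lemma lift_eqI:
  assumes "m - N < t" "t \<le> m + N" "w *v e m = e t"
  shows "lift w m = t"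
  unfolding lift_def
proof (rule the_equality)
  fix s assume s: "m - N < s \<and> s \<le> m + N \<and> w *v e m = e s"
  then have "2 * N dvd s - t" using assms e_eq_iff by metis
  moreover have "\<bar>s - t\<bar> < 2 * N" using s assms by auto
  ultimately show "s = t" using zdvd_imp_le[of "2 * N" "\<bar>s - t\<bar>"] by fastforce
qed (use assms in simp)

lemma e_in_window:
  obtains s where "m - N < s" "s \<le> m + N" "e s = e t"
proof -
  define s where "s = m - N + 1 + (t - (m - N + 1)) mod (2 * N)"
  have "0 \<le> (t - (m - N + 1)) mod (2 * N)" "(t - (m - N + 1)) mod (2 * N) < 2 * N"
    using N_pos by simp_all
  then have "m - N < s" "s \<le> m + N" unfolding s_def by linarith+
  moreover have "e s = e t"
  proof (rule e_period)
    have "s - t = - ((t - (m - N + 1)) - (t - (m - N + 1)) mod (2 * N))" by (simp add: s_def)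
    moreover have "2 * N dvd (t - (m - N + 1)) - (t - (m - N + 1)) mod (2 * N)"
      by (rule dvd_minus_mod)
    ultimately show "2 * N dvd s - t" by (simp only: dvd_minus_iff)
  qed
  ultimately show ?thesis using that by blast
qed

lemma signed_permutation_matrix_e:
  assumes "signed_permutation_matrix w"
  shows "\<exists>t. w *v e m = e t"
proof -
  obtain p s where w: "\<forall>j. s j \<in> {1, -1::real}" "\<forall>j. w *v axis j 1 = s j *\<^sub>R axis (p j) 1"
    using assms unfolding signed_permutation_matrix_iff by blast
  obtain t where t: "e t = axis (p (ax m)) 1" using e_onto by blast
  have "w *v e m = (sg m * s (ax m)) *\<^sub>R e t"
    using w(2) t e_eq[of m] by (simp add: matrix_vector_mult_scaleR)
  moreover have "sg m * s (ax m) = 1 \<or> sg m * s (ax m) = -1"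
    using sg_cases[of m] w(1)[rule_format, of "ax m"] by auto
  ultimately have "w *v e m = e t \<or> w *v e m = e (t + N)" using e_antiperiodic[of t] by auto
  then show ?thesis by blast
qed

lemma lift:
  assumes "signed_permutation_matrix w"
  shows "m - N < lift w m" "lift w m \<le> m + N" "w *v e m = e (lift w m)"
proof -
  obtain t where t: "w *v e m = e t" using signed_permutation_matrix_e[OF assms] by blast
  obtain s where s: "m - N < s" "s \<le> m + N" "e s = e t" by (rule e_in_window)
  then have "lift w m = s" using t by (intro lift_eqI) simp_all
  with s t show "m - N < lift w m" "lift w m \<le> m + N" "w *v e m = e (lift w m)" by simp_all
qed

lemma lift_shift: "signed_permutation_matrix w \<Longrightarrow> lift w (m + N) = lift w m + N"
proof -
  assume w: "signed_permutation_matrix w"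
  have "w *v e (m + N) = e (lift w m + N)"
    using lift(3)[OF w, of m] by (simp add: e_antiperiodic matrix_vector_mult_minus)
  then show ?thesis using lift(1,2)[OF w, of m] by (intro lift_eqI) simp_all
qed

lemma inj_lift: "signed_permutation_matrix w \<Longrightarrow> inj (lift w)"
proof (rule injI)
  fix a b assume w: "signed_permutation_matrix w" and eq: "lift w a = lift w b"
  have "e a \<bullet> e b = (w *v e a) \<bullet> (w *v e b)" using signed_permutation_matrix_inner[OF w] by simp
  also have "\<dots> = 1" using lift(3)[OF w] eq by simp
  finally have "2 * N dvd a - b" by (intro inner_e_pos) simp
  moreover have "\<bar>a - b\<bar> < 2 * N" using lift(1,2)[OF w, of a] lift(1,2)[OF w, of b] eq by linarith
  ultimately show "a = b" using zdvd_imp_le[of "2 * N" "\<bar>a - b\<bar>"] by fastforce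
qed

text \<open>Since \<open>c\<close> shifts indices by one, this is the solution \<open>y\<close> of
  \<open>c y - y = e b - e a\<close> for \<open>a \<le> b\<close>, by telescoping.\<close>

definition arc_sum :: "int \<Rightarrow> int \<Rightarrow> real^'n" where
  "arc_sum a b = (\<Sum>j\<in>{a..<b}. e j)"

lemma c_arc_sum: "c *v arc_sum a b = (\<Sum>j\<in>{a<..b}. e j)"
proof -
  have "c *v arc_sum a b = (\<Sum>j\<in>{a..<b}. e (j + 1))"
    unfolding arc_sum_def by (simp add: matrix_vector_mult_sum c_e)
  also have "\<dots> = (\<Sum>j\<in>{a<..b}. e j)"
    by (rule sum.reindex_bij_witness[of _ "\<lambda>j. j - 1" "\<lambda>j. j + 1"]) auto
  finally show ?thesis .
qed

lemma c_arc_sum_diff: "a \<le> b \<Longrightarrow> c *v arc_sum a b - arc_sum a b = e b - e a"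
proof (cases "a = b")
  case False
  assume "a \<le> b"
  then have "{a<..b} = insert b {a<..<b}" "{a..<b} = insert a {a<..<b}" using False by auto
  then show ?thesis unfolding c_arc_sum by (simp add: arc_sum_def)
qed (simp add: arc_sum_def)

text \<open>At most \<open>N\<close> consecutive \<open>e i\<close> are orthonormal, so the image of
  \<open>e j\<close> has inner product 1 with the translated arc. It therefore has positive inner
  product with some \<open>e i\<close> of that arc, and then coincides with it.\<close>

lemma lift_arc_sum:
  assumes w: "signed_permutation_matrix w" and eq: "w *v arc_sum a b = c *v arc_sum a b"
    and "b \<le> a + N" and j: "a \<le> j" "j < b"
  shows "a < lift w j \<and> lift w j \<le> b"
proof -
  have "(w *v arc_sum a b) \<bullet> (w *v e j) = (\<Sum>i\<in>{a..<b}. e i \<bullet> e j)"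
    by (simp add: arc_sum_def signed_permutation_matrix_inner[OF w] inner_sum_left)
  also have "\<dots> = (\<Sum>i\<in>{a..<b}. if i = j then 1 else 0)"
    using assms by (intro sum.cong refl) (auto intro!: inner_e_window)
  also have "\<dots> = 1" using j by simp
  finally have "(\<Sum>i\<in>{a<..b}. e i \<bullet> e (lift w j)) = 1"
    using eq c_arc_sum lift(3)[OF w] by (simp add: inner_sum_left)
  then have "\<not> (\<forall>i\<in>{a<..b}. e i \<bullet> e (lift w j) \<le> 0)"
    using sum_nonpos[of "{a<..b}" "\<lambda>i. e i \<bullet> e (lift w j)"] by fastforce
  then obtain i where i: "a < i" "i \<le> b" "0 < e i \<bullet> e (lift w j)" by force
  then have "e i = e (lift w j)" using inner_e_pos e_period by blast
  then have "lift w j = i" using lift(3)[OF w, of j] assms i by (intro lift_eqI) auto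
  with i show ?thesis by simp
qed

text \<open>If \<open>e m = x + y\<close> with \<open>w x = x\<close> and \<open>w y = c y\<close>, then \<open>(c - 1) y = e (lift w m) - e m\<close>, so
  that \<open>y\<close> is up to sign the sum over the arc between \<open>m\<close> and \<open>lift w m\<close>, and \<open>w y = c y\<close> says
  that \<open>w\<close> maps this arc to its translate by one.\<close>

lemma NC_imp_nc_lift:
  assumes "w \<in> NC c"
  shows "nc_lift N (lift w)"
proof
  have w: "signed_permutation_matrix w" using assms mem_NC_iff by blast
  show "0 < N" by (rule N_pos)
  show inj: "inj (lift w)" by (rule inj_lift[OF w])
  fix m
  show "lift w (m + N) = lift w m + N" "m - N < lift w m" "lift w m \<le> m + N"
    using lift_shift[OF w] lift[OF w] by auto
  obtain x y where xy: "e m = x + y" "w *v x = x" "w *v y = c *v y"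
    using assms mem_NC_iff by blast
  have "w *v e m = x + c *v y" using xy by (simp add: matrix_vector_right_distrib)
  then have "e (lift w m) = x + c *v y" using lift(3)[OF w, of m] by simp
  then have y: "c *v y - y = e (lift w m) - e m" using xy(1) by simp
  fix j
  show "m < lift w j \<and> lift w j < lift w m" if "m < lift w m" "m < j" "j < lift w m"
  proof -
    have "y = arc_sum m (lift w m)" using y c_arc_sum_diff[of m "lift w m"] that by - (rule c_minus_1_inj, simp)
    then have "m < lift w j \<and> lift w j \<le> lift w m"
      using xy that lift(2)[OF w, of m] by (intro lift_arc_sum[OF w]) simp_all
    moreover have "lift w j \<noteq> lift w m" using inj that by (simp add: inj_eq)
    ultimately show ?thesis by simp
  qed
  show "lift w m \<le> lift w j \<and> lift w j \<le> m" if "lift w m \<le> m" "lift w m \<le> j" "j \<le> m"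
  proof (cases "j = m")
    case False
    have "c *v (- y) - (- y) = e m - e (lift w m)"
      using y by (simp add: matrix_vector_mult_minus algebra_simps)
    then have "- y = arc_sum (lift w m) m"
      using c_arc_sum_diff[of "lift w m" m] that by - (rule c_minus_1_inj, simp)
    moreover have "w *v (- y) = c *v (- y)"
      using xy by (simp add: matrix_vector_mult_minus)
    ultimately have "lift w m < lift w j \<and> lift w j \<le> m"
      using that False lift(1)[OF w, of m] by (intro lift_arc_sum[OF w]) simp_all
    then show ?thesis by simp
  qed (use that in simp)
qed

text \<open>A stable finite interval is permuted by the lift, so \<open>w\<close> fixes the sum over
  it. Adding or removing the end points \<open>m\<close> and \<open>?g m\<close> turns this into
  \<open>w y = c y\<close> for the arc sum \<open>y\<close> between them, and \<open>e m\<close>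
  minus or plus this sum is fixed by \<open>w\<close>.\<close>

lemma nc_lift_imp_NC:
  assumes w: "signed_permutation_matrix w" and "nc_lift N (lift w)"
  shows "w \<in> NC c"
proof -
  interpret nc_lift N "lift w" by fact
  let ?g = "lift w"
  let ?S = "{x + y |x y. x \<in> {x. w *v x = x} \<and> y \<in> {y. w *v y = c *v y}}"
  have "e m \<in> ?S" for m
  proof -
    have sum_stable: "(\<Sum>j\<in>I. w *v e j) = (\<Sum>j\<in>I. e j)" if "finite I" "?g ` I \<subseteq> I" for I
    proof -
      have inj': "inj_on ?g I" using inj by (rule inj_on_subset) simp
      then have "?g ` I = I" using that by (intro endo_inj_surj)
      then show ?thesis using sum.reindex[OF inj', of e] lift(3)[OF w] by simp
    qed
    have "\<exists>y. w *v y = c *v y \<and> c *v y - y = e (?g m) - e m"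
    proof (cases "m < ?g m")
      case True
      let ?I = "{m<..<?g m}"
      have "w *v arc_sum m (?g m) = w *v e m + (\<Sum>j\<in>?I. w *v e j)"
      proof -
        have "{m..<?g m} = insert m ?I" using True by auto
        then show ?thesis by (simp add: arc_sum_def matrix_vector_mult_sum matrix_vector_right_distrib)
      qed
      also have "\<dots> = e (?g m) + (\<Sum>j\<in>?I. e j)"
        using up[OF True] lift(3)[OF w] by (subst sum_stable) auto
      also have "\<dots> = c *v arc_sum m (?g m)"
      proof -
        have "{m<..?g m} = insert (?g m) ?I" using True by auto
        then show ?thesis by (simp add: c_arc_sum)
      qed
      finally show ?thesis using c_arc_sum_diff[of m "?g m"] True by (intro exI[of _ "arc_sum m (?g m)"]) simp
    next
      case False
      let ?I = "{?g m..m}"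
      have "w *v arc_sum (?g m) m + w *v e m = (\<Sum>j\<in>?I. w *v e j)"
      proof -
        have "?I = insert m {?g m..<m}" using False by auto
        then show ?thesis by (simp add: arc_sum_def matrix_vector_mult_sum)
      qed
      also have "\<dots> = (\<Sum>j\<in>?I. e j)"
        using down[of m] False by (subst sum_stable) auto
      also have "\<dots> = c *v arc_sum (?g m) m + e (?g m)"
      proof -
        have "?I = insert (?g m) {?g m<..m}" using False by auto
        then show ?thesis by (simp add: c_arc_sum)
      qed
      finally have "w *v arc_sum (?g m) m = c *v arc_sum (?g m) m" using lift(3)[OF w] by simp
      moreover have "c *v arc_sum (?g m) m - arc_sum (?g m) m = e m - e (?g m)"
        using c_arc_sum_diff[of "?g m" m] False by simp
      ultimately show ?thesis
        by (intro exI[of _ "- arc_sum (?g m) m"])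
          (simp add: matrix_vector_mult_minus algebra_simps)
    qed
    then obtain y where y: "w *v y = c *v y" "c *v y - y = e (?g m) - e m" by blast
    then have "w *v (e m - y) = e m - y"
      using lift(3)[OF w, of m] by (simp add: matrix_vector_mult_diff_distrib algebra_simps)
    moreover have "e m = (e m - y) + y" by simp
    ultimately show ?thesis using y(1) by blast
  qed
  note e_mem = this
  have S: "subspace ?S"
    by (intro subspace_sums)
      (auto simp: subspace_def matrix_vector_right_distrib matrix_vector_mult_scaleR)
  have "z \<in> ?S" for z
  proof -
    have "axis i 1 \<in> ?S" for i
    proof -
      obtain m where "e m = axis i 1" using e_onto by blast
      with e_mem[of m] show ?thesis by simp
    qed
    then have "(\<Sum>i\<in>UNIV. z $ i *s axis i 1) \<in> ?S"
      unfolding scalar_mult_eq_scaleR by (intro subspace_sum[OF S] subspace_scale[OF S])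
    then show ?thesis by (simp only: basis_expansion)
  qed
  then show ?thesis unfolding mem_NC_iff using w by blast
qed

lemma NC_iff_nc_lift: "w \<in> NC c \<longleftrightarrow> signed_permutation_matrix w \<and> nc_lift N (lift w)"
  using NC_imp_nc_lift nc_lift_imp_NC mem_NC_iff by blast

end

section \<open>Parking vectors\<close>

abbreviation cmat :: "real^'n^'n \<Rightarrow> complex^'n^'n" where
  "cmat \<equiv> map_matrix complex_of_real"

lemma cmat_mult: "cmat (u ** w) = cmat u ** cmat w"
  by (simp add: vec_eq_iff matrix_matrix_mult_def)

lemma cmat_mat_1: "cmat (mat 1) = mat 1"
  by (simp add: vec_eq_iff mat_def)

lemma signed_permutation_matrix_cmat:
  fixes w :: "real^'n^'n" and v :: "complex^'n"
  assumes "bij p" "\<And>j. w *v axis j 1 = s j *\<^sub>R axis (p j) 1"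
  shows "(cmat w *v v) $ p j = complex_of_real (s j) * v $ j"
proof -
  have entry: "w $ i $ j = (if i = p j then s j else 0)" for i j
  proof -
    have "w $ i $ j = (w *v axis j 1) $ i" by (simp add: matrix_vector_mult_basis column_def)
    then show ?thesis by (simp add: assms(2)) (simp add: axis_def)
  qed
  have inj: "p j = p k \<longleftrightarrow> j = k" for j k using assms(1) by (simp add: bij_is_inj inj_eq)
  have "(cmat w *v v) $ p j = (\<Sum>k\<in>UNIV. complex_of_real (w $ p j $ k) * v $ k)"
    by (simp add: matrix_vector_mult_def)
  also have "\<dots> = (\<Sum>k\<in>UNIV. if j = k then complex_of_real (s k) * v $ k else 0)"
    by (rule sum.cong) (simp_all add: entry inj)
  finally show ?thesis by simp
qed

lemma cmat_Re: "(\<chi> i. Re ((cmat w *v v) $ i)) = w *v (\<chi> i. Re (v $ i))"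
  and cmat_Im: "(\<chi> i. Im ((cmat w *v v) $ i)) = w *v (\<chi> i. Im (v $ i))"
  by (simp_all add: vec_eq_iff matrix_vector_mult_def)

lemma cmat_fixed_iff:
  "cmat w *v v = v \<longleftrightarrow> w *v (\<chi> i. Re (v $ i)) = (\<chi> i. Re (v $ i)) \<and>
    w *v (\<chi> i. Im (v $ i)) = (\<chi> i. Im (v $ i))"
  unfolding cmat_Re[symmetric] cmat_Im[symmetric] by (auto simp: vec_eq_iff complex_eq_iff)

lemma card_squares_cmat:
  fixes w :: "real^'n^'n" and v :: "complex^'n"
  assumes "signed_permutation_matrix w"
  shows "card {i. ((cmat w *v v) $ i)\<^sup>2 = z} = card {i. (v $ i)\<^sup>2 = z}"
proof -
  obtain p s where w: "bij p" "\<forall>j. s j \<in> {1, -1::real}" "\<forall>j. w *v axis j 1 = s j *\<^sub>R axis (p j) 1"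
    using assms unfolding signed_permutation_matrix_iff by blast
  have sq: "((cmat w *v v) $ p j)\<^sup>2 = (v $ j)\<^sup>2" for j
    using signed_permutation_matrix_cmat[of p w s v j] w(2)[rule_format, of j] w(1,3) by auto
  have "bij_betw p {i. (v $ i)\<^sup>2 = z} {i. ((cmat w *v v) $ i)\<^sup>2 = z}"
    unfolding bij_betw_def
  proof
    show "inj_on p {i. (v $ i)\<^sup>2 = z}" using w(1) bij_is_inj inj_on_subset by blast
    show "p ` {i. (v $ i)\<^sup>2 = z} = {i. ((cmat w *v v) $ i)\<^sup>2 = z}"
    proof (intro equalityI subsetI)
      fix i assume i: "i \<in> {i. ((cmat w *v v) $ i)\<^sup>2 = z}"
      obtain j where "i = p j" using bij_is_surj[OF w(1)] by (rule surjE)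
      with i sq[of j] show "i \<in> p ` {i. (v $ i)\<^sup>2 = z}" by auto
    qed (use sq in auto)
  qed
  from bij_betw_same_card[OF this] show ?thesis by simp
qed

text \<open>Squaring forgets exactly the sign of a complex number, so the multiset of squared
  coordinates is a complete invariant of the orbits.\<close>

lemma signed_permutation_of_squares:
  fixes v v' :: "complex^'n"
  assumes "\<And>z. card {i. (v $ i)\<^sup>2 = z} = card {i. (v' $ i)\<^sup>2 = z}"
  obtains w where "signed_permutation_matrix w" "v' = cmat w *v v"
proof -
  have "image_mset (\<lambda>i. (v $ i)\<^sup>2) (mset_set UNIV) = image_mset (\<lambda>i. (v' $ i)\<^sup>2) (mset_set UNIV)"
  proof (rule multiset_eqI)
    fix z
    have "count (image_mset (\<lambda>i. (u $ i)\<^sup>2) (mset_set UNIV)) z = card {i. (u $ i)\<^sup>2 = z}"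
      for u :: "complex^'n"
      by (simp add: count_image_mset vimage_def)
    then show "count (image_mset (\<lambda>i. (v $ i)\<^sup>2) (mset_set UNIV)) z =
        count (image_mset (\<lambda>i. (v' $ i)\<^sup>2) (mset_set UNIV)) z"
      using assms by simp
  qed
  then obtain p where p: "p permutes UNIV" "\<forall>i\<in>UNIV. (v $ i)\<^sup>2 = (v' $ p i)\<^sup>2"
    by (rule image_mset_eq_implies_permutes[OF finite])
  \<comment> \<open>If both entries are 0 either sign would do, and this picks 1.\<close>
  define s :: "'n \<Rightarrow> real" where "s j = (if v' $ p j = v $ j then 1 else -1)" for j
  define w :: "real^'n^'n" where "w = (\<chi> i j. if i = p j then s j else 0)"
  have bij: "bij p" using p(1) by (rule permutes_bij)
  have sw: "signed_permutation_matrix w"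
    unfolding signed_permutation_matrix_def w_def using bij
    by (intro exI[of _ p] exI[of _ s]) (simp add: s_def)
  have col: "w *v axis j 1 = s j *\<^sub>R axis (p j) 1" for j
  proof -
    have "(w *v axis j 1) $ i = w $ i $ j" for i by (simp add: matrix_vector_mult_basis column_def)
    then show ?thesis by (simp add: vec_eq_iff w_def) (simp add: axis_def)
  qed
  have comp: "(cmat w *v v) $ p j = v' $ p j" for j
  proof -
    have "v $ j = v' $ p j \<or> v $ j = - v' $ p j" using p(2) by (simp add: power2_eq_iff)
    then show ?thesis using signed_permutation_matrix_cmat[OF bij col, of v j] by (auto simp: s_def)
  qed
  have "(cmat w *v v) $ i = v' $ i" for i
  proof -
    obtain j where "i = p j" using bij_is_surj[OF bij] by (rule surjE)
    then show ?thesis using comp by simp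
  qed
  then have "v' = cmat w *v v" by (simp add: vec_eq_iff)
  with sw that show ?thesis by blast
qed

context signed_cycle
begin

text \<open>\<open>\<omega>\<close> to the power \<open>s\<close> for \<open>h = 2 N\<close>. It has
  the same period as \<open>e\<close> and the same sign change under the shift by
  \<open>N\<close>.\<close>

definition rt :: "int \<Rightarrow> complex" where
  "rt s = cis (pi * of_int s / of_int N)"

lemma rt_add: "rt (a + b) = rt a * rt b"
  by (simp add: rt_def cis_mult add_divide_distrib ring_distribs)

lemma rt_nonzero [simp]: "rt a \<noteq> 0"
  by (simp add: rt_def)

lemma rt_N [simp]: "rt N = -1"
  using N_pos by (simp add: rt_def)

lemma rt_eq_1_iff: "rt a = 1 \<longleftrightarrow> 2 * N dvd a"
proof
  assume "rt a = 1"
  then obtain q :: int where "pi * of_int a / of_int N = of_int q * (2 * pi)"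
    unfolding rt_def cis_eq_1_iff by blast
  then have "real_of_int a = of_int (q * 2 * N)" using N_pos by (simp add: field_simps)
  then have "a = 2 * N * q" by (simp only: of_int_eq_iff) simp
  then show "2 * N dvd a" by simp
next
  assume "2 * N dvd a"
  then obtain q where "a = 2 * N * q" by (elim dvdE)
  then have "pi * of_int a / of_int N = of_int q * (2 * pi)" using N_pos by (simp add: field_simps)
  then show "rt a = 1" unfolding rt_def cis_eq_1_iff by blast
qed

lemma rt_eq_iff: "rt a = rt b \<longleftrightarrow> 2 * N dvd a - b"
proof -
  have "rt a = rt (a - b) * rt b" using rt_add[of "a - b" b] by simp
  then have "rt a = rt b \<longleftrightarrow> rt (a - b) = 1" by simp
  then show ?thesis by (simp add: rt_eq_1_iff)
qed

lemma rt_square: "(rt a)\<^sup>2 = rt (2 * a)"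
  using rt_add[of a a] by (simp add: power2_eq_square)

lemma rt_square_eq_iff: "(rt a)\<^sup>2 = (rt b)\<^sup>2 \<longleftrightarrow> N dvd a - b"
  using dvd_mult_cancel_left[of 2 N "a - b"] by (simp add: rt_square rt_eq_iff right_diff_distrib)

definition phi :: "(int \<Rightarrow> int) \<Rightarrow> int \<Rightarrow> complex" where
  "phi g m = (case label g m of None \<Rightarrow> 0 | Some s \<Rightarrow> rt s)"

text \<open>For noncrossing \<open>w\<close> any \<open>m\<close> with \<open>e m = axis i 1\<close>
  gives the same value, because such \<open>m\<close> differ by multiples of \<open>2 N\<close> and
  labels commute with the shift by \<open>N\<close>.\<close>

definition park_vec :: "real^'n^'n \<Rightarrow> complex^'n" where
  "park_vec w = (\<chi> i. phi (lift w) (SOME m. e m = axis i 1))"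

text \<open>The pairing of \<open>v\<close> with \<open>e m\<close>, extended bilinearly to complex
  vectors.\<close>

definition coord :: "complex^'n \<Rightarrow> int \<Rightarrow> complex" where
  "coord v m = complex_of_real (sg m) * v $ ax m"

lemma coord_square: "(coord v m)\<^sup>2 = (v $ ax m)\<^sup>2"
  using sg_cases[of m] by (auto simp: coord_def)

lemma coord_onto: "\<exists>m. coord v m = v $ i \<and> ax m = i"
proof -
  obtain m where m: "e m = axis i 1" using e_onto by blast
  then have "ax m = i" using ax_eqI[of m 1 i] by simp
  moreover from this m have "sg m = 1" by (simp add: sg_def)
  ultimately show ?thesis by (intro exI[of _ m]) (simp add: coord_def)
qed

lemma vec_eqI_coord: "(\<And>m. coord v m = coord v' m) \<Longrightarrow> v = v'"
proof -
  assume *: "\<And>m. coord v m = coord v' m"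
  have "v $ i = v' $ i" for i
  proof -
    obtain m where "ax m = i" using coord_onto by blast
    then show ?thesis using *[of m] sg_cases[of m] by (auto simp: coord_def)
  qed
  then show ?thesis by (simp add: vec_eq_iff)
qed

lemma coord_cmat:
  assumes w: "signed_permutation_matrix w" and "w *v e m = e t"
  shows "coord (cmat w *v v) t = coord v m"
proof -
  obtain p s where ps: "bij p" "\<forall>j. s j \<in> {1, -1::real}" "\<forall>j. w *v axis j 1 = s j *\<^sub>R axis (p j) 1"
    using w unfolding signed_permutation_matrix_iff by blast
  have et: "e t = (sg m * s (ax m)) *\<^sub>R axis (p (ax m)) 1"
    using assms(2) e_eq[of m] ps(3) by (simp add: matrix_vector_mult_scaleR)
  then have ax: "ax t = p (ax m)" by (rule ax_eqI)
  then have "sg t = sg m * s (ax m)" unfolding sg_def[of t] using et by simp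
  then have "coord (cmat w *v v) t = complex_of_real (sg m * (s (ax m) * s (ax m))) * v $ ax m"
    using signed_permutation_matrix_cmat[of p w s v "ax m"] ps ax by (simp add: coord_def)
  moreover have "s (ax m) * s (ax m) = 1" using ps(2)[rule_format, of "ax m"] by auto
  ultimately show ?thesis by (simp add: coord_def)
qed

lemma signed_permutation_matrix_e_onto:
  assumes "signed_permutation_matrix w"
  shows "\<exists>m. w *v e m = e t"
proof -
  note tw = signed_permutation_matrix_transpose[OF assms]
  obtain m where m: "transpose w *v e t = e m" using signed_permutation_matrix_e[OF tw(1)] by blast
  have "w ** transpose w = mat 1" using tw(2) matrix_left_right_inverse by blast
  moreover have "w *v e m = (w ** transpose w) *v e t"
    by (simp only: m[symmetric] matrix_vector_mul_assoc)
  ultimately have "w *v e m = e t" by simp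
  then show ?thesis by blast
qed

text \<open>A shift of \<open>m\<close> by \<open>N\<close> changes the sign of both sides, on the
  right because \<open>rt N = -1\<close>, so the equation passes from the chosen representative to
  every \<open>m\<close>.\<close>

lemma coord_park_vec:
  assumes "w \<in> NC c"
  shows "coord (park_vec w) m = phi (lift w) m"
proof -
  interpret nc_lift N "lift w" using assms NC_imp_nc_lift by blast
  have phi_shift: "phi (lift w) (m + N) = - phi (lift w) m" for m
    unfolding phi_def label_shift by (simp add: rt_add split: option.split)
  have phi_period: "phi (lift w) a = phi (lift w) b" if dvd: "2 * N dvd a - b" for a b
  proof -
    have per: "phi (lift w) (b + q * (2 * N)) = phi (lift w) b" for q
    proof (induction q rule: int_induct[where k = 0])
      case (step1 q)
      have "phi (lift w) (b + (q + 1) * (2 * N)) = phi (lift w) (b + q * (2 * N) + N + N)"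
        by (rule arg_cong[where f = "phi (lift w)"]) (simp add: algebra_simps)
      then show ?case using step1 by (simp only: phi_shift minus_minus)
    next
      case (step2 q)
      have "phi (lift w) (b + q * (2 * N)) = phi (lift w) (b + (q - 1) * (2 * N) + N + N)"
        by (rule arg_cong[where f = "phi (lift w)"]) (simp add: algebra_simps)
      then show ?case using step2 by (simp only: phi_shift minus_minus)
    qed simp
    obtain q where "a - b = 2 * N * q" using dvd by (elim dvdE)
    then have "a = b + q * (2 * N)" by (simp add: algebra_simps)
    then show ?thesis using per by simp
  qed
  define m' where "m' = (SOME k. e k = axis (ax m) 1)"
  have m': "e m' = axis (ax m) 1" unfolding m'_def by (rule someI_ex[OF e_onto])
  have "coord (park_vec w) m = complex_of_real (sg m) * phi (lift w) m'"
    by (simp add: coord_def park_vec_def m'_def)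
  also have "\<dots> = phi (lift w) m"
  proof (cases "sg m = 1")
    case True
    then have "e m' = e m" using m' e_eq[of m] by simp
    then show ?thesis using True phi_period[of m' m] by (simp add: e_eq_iff)
  next
    case False
    then have sg: "sg m = -1" using sg_cases[of m] by simp
    then have "e m' = e (m + N)" using m' e_eq[of m] e_antiperiodic[of m] by simp
    then show ?thesis using sg phi_period[of m' "m + N"] phi_shift[of m] by (simp add: e_eq_iff)
  qed
  finally show ?thesis .
qed

lemma fixed_space_iff:
  assumes "signed_permutation_matrix w"
  shows "x \<in> fixed_space w \<longleftrightarrow> (\<forall>m. x \<bullet> e (lift w m) = x \<bullet> e m)"
proof -
  have "(w *v x) \<bullet> e (lift w m) = x \<bullet> e m" for m
    using signed_permutation_matrix_inner[OF assms, of x "e m"] lift(3)[OF assms] by simp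
  note inner = this
  show ?thesis
  proof
    assume "x \<in> fixed_space w"
    then show "\<forall>m. x \<bullet> e (lift w m) = x \<bullet> e m" using inner by (simp add: fixed_space_def)
  next
    assume *: "\<forall>m. x \<bullet> e (lift w m) = x \<bullet> e m"
    have "w *v x = x"
    proof (rule vec_eqI_e)
      fix t
      obtain m where "w *v e m = e t" using signed_permutation_matrix_e_onto[OF assms] by blast
      then have "e t = e (lift w m)" using lift(3)[OF assms, of m] by simp
      then show "(w *v x) \<bullet> e t = x \<bullet> e t" using inner[of m] * by simp
    qed
    then show "x \<in> fixed_space w" by (simp add: fixed_space_def)
  qed
qed

lemma fixed_space_iff_label:
  assumes "w \<in> NC c"
  shows "x \<in> fixed_space w \<longleftrightarrow>
    (\<forall>m. case label (lift w) m of None \<Rightarrow> x \<bullet> e m = 0 | Some s \<Rightarrow> x \<bullet> e m = x \<bullet> e s)"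
proof -
  interpret nc_lift N "lift w" using assms NC_imp_nc_lift by blast
  have "signed_permutation_matrix w" using assms mem_NC_iff by blast
  from fixed_space_iff[OF this] show ?thesis
    using antiperiodic_invariant_iff[of "\<lambda>m. x \<bullet> e m"] by (simp add: e_antiperiodic)
qed

text \<open>\<open>w\<close> fixes its parking vector, so the real and imaginary parts of this
  vector lie in the fixed space and are fixed by the stabilizer. Conversely, the entries of the
  parking vector separate the blocks: equal \<open>rt\<close> at two labels means equal
  \<open>e\<close> there, hence equal coordinates of every \<open>x\<close> in the fixed
  space.\<close>

lemma stabilizer_iff:
  assumes "w \<in> NC c"
  shows "u \<in> stabilizer (fixed_space w) \<longleftrightarrow>
    signed_permutation_matrix u \<and> cmat u *v park_vec w = park_vec w"
proof (cases "signed_permutation_matrix u")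
  case True
  have w: "signed_permutation_matrix w" using assms mem_NC_iff by blast
  interpret nc_lift N "lift w" using assms NC_imp_nc_lift by blast
  let ?p = "park_vec w"
  have "cmat w *v ?p = ?p"
  proof (rule vec_eqI_coord)
    fix t
    obtain m where m: "w *v e m = e t" using signed_permutation_matrix_e_onto[OF w] by blast
    then have "e t = e (lift w m)" using lift(3)[OF w, of m] by simp
    have "coord (cmat w *v ?p) (lift w m) = coord ?p (lift w m)"
      using coord_cmat[OF w lift(3)[OF w, of m]] by (simp add: coord_park_vec[OF assms] phi_def)
    moreover have "coord v t = coord v (lift w m)" for v
    proof -
      have "ax t = ax (lift w m)"
        using \<open>e t = e (lift w m)\<close> e_eq[of "lift w m"] by (intro ax_eqI) simp
      moreover from this have "sg t = sg (lift w m)" using \<open>e t = e (lift w m)\<close> by (simp add: sg_def)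
      ultimately show ?thesis by (simp add: coord_def)
    qed
    ultimately show "coord (cmat w *v ?p) t = coord ?p t" by simp
  qed
  then have reim: "(\<chi> i. Re (?p $ i)) \<in> fixed_space w" "(\<chi> i. Im (?p $ i)) \<in> fixed_space w"
    using cmat_fixed_iff[of w ?p] by (simp_all add: fixed_space_def)
  show ?thesis
  proof
    assume "u \<in> stabilizer (fixed_space w)"
    then show "signed_permutation_matrix u \<and> cmat u *v ?p = ?p"
      using reim unfolding cmat_fixed_iff by (simp add: stabilizer_def)
  next
    assume u: "signed_permutation_matrix u \<and> cmat u *v ?p = ?p"
    have "u *v x = x" if "x \<in> fixed_space w" for x
    proof (rule vec_eqI_e)
      fix t
      obtain m where m: "u *v e m = e t" using signed_permutation_matrix_e_onto[OF True] by blast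
      have "phi (lift w) t = phi (lift w) m"
        using coord_cmat[OF True m, of ?p] u by (simp add: coord_park_vec[OF assms])
      moreover have "case label (lift w) j of None \<Rightarrow> x \<bullet> e j = 0 | Some s \<Rightarrow> x \<bullet> e j = x \<bullet> e s" for j
        using that fixed_space_iff_label[OF assms] by blast
      note lab = this[of t] this[of m]
      ultimately have "x \<bullet> e t = x \<bullet> e m"
        by (auto simp: phi_def rt_eq_iff e_period split: option.splits)
      moreover have "(u *v x) \<bullet> e t = x \<bullet> e m"
        using signed_permutation_matrix_inner[OF True, of x "e m"] m by simp
      ultimately show "(u *v x) \<bullet> e t = x \<bullet> e t" by simp
    qed
    then show "u \<in> stabilizer (fixed_space w)" using True by (simp add: stabilizer_def)
  qed
qed (simp add: stabilizer_def)

lemma card_ax: "card {i. P i} = card {m\<in>{0..<N}. P (ax m)}"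
proof -
  have "bij_betw ax {m\<in>{0..<N}. P (ax m)} {i. P i}"
    unfolding bij_betw_def
  proof
    show "inj_on ax {m\<in>{0..<N}. P (ax m)}"
      using bij_betw_imp_inj_on[OF bij_betw_ax] by (rule inj_on_subset) auto
    have surj: "i \<in> ax ` {0..<N}" for i using bij_betw_ax by (simp add: bij_betw_def)
    show "ax ` {m\<in>{0..<N}. P (ax m)} = {i. P i}"
    proof (intro equalityI subsetI)
      fix i assume "i \<in> {i. P i}"
      moreover obtain m where "i = ax m" "m \<in> {0..<N}" using surj[of i] by (rule imageE)
      ultimately show "i \<in> ax ` {m\<in>{0..<N}. P (ax m)}" by simp
    qed auto
  qed
  from bij_betw_same_card[OF this] show ?thesis by simp
qed

text \<open>Squares of \<open>rt\<close> agree exactly when the arguments agree modulo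
  \<open>N\<close>, so this counts the positions of one period whose label is congruent to
  \<open>s\<close>.\<close>

lemma card_squares_park_vec:
  assumes "w \<in> NC c"
  shows "card {i. (park_vec w $ i)\<^sup>2 = (rt s)\<^sup>2} = multiplicity (lift w) s"
proof -
  interpret nc_lift N "lift w" using assms NC_imp_nc_lift by blast
  have "card {i. (park_vec w $ i)\<^sup>2 = (rt s)\<^sup>2} =
      card {m\<in>{0..<N}. (park_vec w $ ax m)\<^sup>2 = (rt s)\<^sup>2}"
    by (rule card_ax)
  also have "{m\<in>{0..<N}. (park_vec w $ ax m)\<^sup>2 = (rt s)\<^sup>2} =
      {m\<in>{0..<N}. \<exists>t. label (lift w) m = Some t \<and> N dvd t - s}"
  proof -
    have "(park_vec w $ ax m)\<^sup>2 = (rt s)\<^sup>2 \<longleftrightarrow> (\<exists>t. label (lift w) m = Some t \<and> N dvd t - s)" for m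
      unfolding coord_square[symmetric] coord_park_vec[OF assms] phi_def
      by (auto simp: rt_square_eq_iff split: option.split)
    then show ?thesis by simp
  qed
  also have "card \<dots> = multiplicity (lift w) s" by (rule card_label_window)
  finally show ?thesis .
qed

text \<open>Vectors in one orbit give the same multiplicities, hence the same labels; the labels
  give the fixed space, and \<open>NC_eqI\<close> the element.\<close>

lemma park_vec_orbit_unique:
  assumes "w \<in> NC c" "w' \<in> NC c" and u: "signed_permutation_matrix u" "signed_permutation_matrix u'"
    and eq: "cmat u *v park_vec w = cmat u' *v park_vec w'"
  shows "w = w'"
proof -
  interpret g: nc_lift N "lift w" using assms NC_imp_nc_lift by blast
  interpret g': nc_lift N "lift w'" using assms NC_imp_nc_lift by blast
  have "multiplicity (lift w) s = multiplicity (lift w') s" for s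
    using card_squares_cmat[OF u(1), of "park_vec w" "(rt s)\<^sup>2"]
      card_squares_cmat[OF u(2), of "park_vec w'" "(rt s)\<^sup>2"] eq
    by (simp add: card_squares_park_vec[OF assms(1)] card_squares_park_vec[OF assms(2)])
  then have "label (lift w) m = label (lift w') m" for m
    by (simp add: g.label_eq_last_multiplicity g'.label_eq_last_multiplicity)
  then have "fixed_space w = fixed_space w'"
    using fixed_space_iff_label[OF assms(1)] fixed_space_iff_label[OF assms(2)] by auto
  then show ?thesis using assms NC_eqI by blast
qed

text \<open>The orbit arguments use this description by roots of unity; \<open>locus_eq\<close>
  identifies it with the zero locus of the parking ideal.\<close>

definition locus :: "(complex^'n) set" where
  "locus = {v. \<forall>i. v $ i = 0 \<or> (\<exists>s. v $ i = rt s)}"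

lemma park_vec_in_locus: "w \<in> NC c \<Longrightarrow> park_vec w \<in> locus"
proof -
  assume w: "w \<in> NC c"
  have "park_vec w $ i = 0 \<or> (\<exists>s. park_vec w $ i = rt s)" for i
  proof -
    obtain m where "coord (park_vec w) m = park_vec w $ i" using coord_onto by blast
    then have "park_vec w $ i = phi (lift w) m" using coord_park_vec[OF w] by simp
    then show ?thesis by (auto simp: phi_def split: option.split)
  qed
  then show ?thesis by (simp add: locus_def)
qed

lemma uminus_rt: "- rt s = rt (s + N)"
  by (simp add: rt_add)

lemma cmat_locus:
  assumes "v \<in> locus" "signed_permutation_matrix u"
  shows "cmat u *v v \<in> locus"
proof -
  obtain p s where ps: "bij p" "\<forall>j. s j \<in> {1, -1::real}" "\<forall>j. u *v axis j 1 = s j *\<^sub>R axis (p j) 1"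
    using assms(2) unfolding signed_permutation_matrix_iff by blast
  have *: "(cmat u *v v) $ p j = v $ j \<or> (cmat u *v v) $ p j = - v $ j" for j
    using signed_permutation_matrix_cmat[of p u s v j] ps(1,3) ps(2)[rule_format, of j] by auto
  have **: "(cmat u *v v) $ p j = 0 \<or> (\<exists>s. (cmat u *v v) $ p j = rt s)" for j
  proof -
    have "v $ j = 0 \<or> (\<exists>s. v $ j = rt s)" using assms(1) by (simp add: locus_def)
    then show ?thesis using *[of j] by (auto simp: uminus_rt)
  qed
  have "(cmat u *v v) $ i = 0 \<or> (\<exists>s. (cmat u *v v) $ i = rt s)" for i
  proof -
    obtain j where "i = p j" using bij_is_surj[OF ps(1)] by (rule surjE)
    then show ?thesis using ** by simp
  qed
  then show ?thesis by (simp add: locus_def)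
qed

lemma disjoint_squares:
  "a \<in> {0..<N} \<Longrightarrow> b \<in> {0..<N} \<Longrightarrow> (rt a)\<^sup>2 = (rt b)\<^sup>2 \<Longrightarrow> a = b"
  using zdvd_imp_le[of N "\<bar>a - b\<bar>"] by (fastforce simp: rt_square_eq_iff)

lemma sum_card_squares:
  "(\<Sum>s\<in>{0..<N}. card {i. (v $ i)\<^sup>2 = (rt s)\<^sup>2}) = card {i. \<exists>s. (v $ i)\<^sup>2 = (rt s)\<^sup>2}"
proof -
  have "card (\<Union>s\<in>{0..<N}. {i. (v $ i)\<^sup>2 = (rt s)\<^sup>2}) = (\<Sum>s\<in>{0..<N}. card {i. (v $ i)\<^sup>2 = (rt s)\<^sup>2})"
    by (rule card_UN_disjoint) (auto dest: disjoint_squares)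
  moreover have "(\<Union>s\<in>{0..<N}. {i. (v $ i)\<^sup>2 = (rt s)\<^sup>2}) = {i. \<exists>s. (v $ i)\<^sup>2 = (rt s)\<^sup>2}"
  proof -
    have "\<exists>a\<in>{0..<N}. (rt s)\<^sup>2 = (rt a)\<^sup>2" for s
    proof
      show "s mod N \<in> {0..<N}" using N_pos by simp
      show "(rt s)\<^sup>2 = (rt (s mod N))\<^sup>2" unfolding rt_square_eq_iff by (rule dvd_minus_mod)
    qed
    then show ?thesis by auto
  qed
  ultimately show ?thesis by simp
qed

text \<open>Coordinates that are not of the form \<open>rt s\<close> vanish, so the number of zeros
  is \<open>n\<close> minus the sum of the other counts.\<close>

lemma card_squares_eqI:
  assumes "v \<in> locus" "v' \<in> locus"
    and eq: "\<And>s. card {i. (v $ i)\<^sup>2 = (rt s)\<^sup>2} = card {i. (v' $ i)\<^sup>2 = (rt s)\<^sup>2}"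
  shows "card {i. (v $ i)\<^sup>2 = z} = card {i. (v' $ i)\<^sup>2 = z}"
proof -
  have zero: "card {i. (u $ i)\<^sup>2 = 0} = CARD('n) - (\<Sum>s\<in>{0..<N}. card {i. (u $ i)\<^sup>2 = (rt s)\<^sup>2})"
    if "u \<in> locus" for u
  proof -
    have "{i. (u $ i)\<^sup>2 = 0} = UNIV - {i. \<exists>s. (u $ i)\<^sup>2 = (rt s)\<^sup>2}"
      using that unfolding locus_def by force
    then show ?thesis unfolding sum_card_squares by (simp add: card_Diff_subset)
  qed
  consider "z = 0" | s where "z = (rt s)\<^sup>2" | "z \<noteq> 0" "\<forall>s. z \<noteq> (rt s)\<^sup>2" by blast
  then show ?thesis
  proof cases
    case 1
    then show ?thesis using zero[OF assms(1)] zero[OF assms(2)] eq by simp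
  next
    case 2
    then show ?thesis using eq by simp
  next
    case 3
    then have "{i. (u $ i)\<^sup>2 = z} = {}" if "u \<in> locus" for u
      using that unfolding locus_def by force
    then show ?thesis using assms by simp
  qed
qed

text \<open>Compatibility with the shift by \<open>N\<close> makes the assignment of
  \<open>e (g m)\<close> to \<open>e m\<close> respect signs, and together with injectivity of
  \<open>g\<close> it makes the induced map on coordinates injective.\<close>

lemma matrix_of_lift:
  assumes "nc_lift N g"
  obtains w where "w \<in> NC c" "lift w = g"
proof -
  interpret nc_lift N g by fact
  obtain m0 where m0: "\<And>i. e (m0 i) = axis i 1"
    using choice[of "\<lambda>i m. e m = axis i 1"] e_onto by blast
  define w :: "real^'n^'n" where "w = (\<chi> i j. e (g (m0 j)) $ i)"
  have col: "w *v axis j 1 = e (g (m0 j))" for j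
    by (simp add: matrix_vector_mult_basis column_def w_def vec_eq_iff)
  have gq: "g (b + q * N) = g b + q * N" for b q
  proof (induction q rule: int_induct[where k = 0])
    case (step1 q)
    then show ?case using shift[of "b + q * N"] by (simp add: algebra_simps)
  next
    case (step2 q)
    then show ?case using shift[of "b + (q - 1) * N"] by (simp add: algebra_simps)
  qed simp
  have w_e: "w *v e m = e (g m)" for m
  proof (cases "sg m = 1")
    case True
    then have "e m = e (m0 (ax m))" using e_eq[of m] m0 by simp
    then obtain q where "m - m0 (ax m) = 2 * N * q" unfolding e_eq_iff by (elim dvdE)
    then have "m = m0 (ax m) + (2 * q) * N" by (simp add: algebra_simps)
    then have "g m = g (m0 (ax m)) + (2 * q) * N" using gq by metis
    then have "e (g m) = e (g (m0 (ax m)))" unfolding e_eq_iff by simp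
    then show ?thesis using col[of "ax m"] e_eq[of m] True by simp
  next
    case False
    then have sg: "sg m = -1" using sg_cases[of m] by simp
    then have "e m = e (m0 (ax m) + N)" using e_eq[of m] m0 by (simp add: e_antiperiodic)
    then obtain q where "m - (m0 (ax m) + N) = 2 * N * q" unfolding e_eq_iff by (elim dvdE)
    then have "m = m0 (ax m) + (2 * q + 1) * N" by (simp add: algebra_simps)
    then have "g m = g (m0 (ax m)) + (2 * q + 1) * N" using gq by metis
    then have "e (g m) = e (g (m0 (ax m)) + N)" unfolding e_eq_iff by (simp add: algebra_simps)
    then show ?thesis using col[of "ax m"] e_eq[of m] sg
      by (simp add: e_antiperiodic matrix_vector_mult_minus)
  qed
  have "inj (\<lambda>j. ax (g (m0 j)))"
  proof (rule injI)
    fix i j assume "ax (g (m0 i)) = ax (g (m0 j))"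
    then obtain q where "g (m0 i) - g (m0 j) = N * q" unfolding ax_eq_iff by (elim dvdE)
    then have "g (m0 i) = g (m0 j + q * N)" using gq[of "m0 j" q] by (simp add: algebra_simps)
    then have "m0 i = m0 j + q * N" using inj by (simp add: inj_eq)
    then have "ax (m0 i) = ax (m0 j)" by (simp add: ax_shift_multiple)
    then show "i = j" using ax_eqI[of "m0 i" 1 i] ax_eqI[of "m0 j" 1 j] m0 by simp
  qed
  then have "bij (\<lambda>j. ax (g (m0 j)))" by (simp add: bij_def finite_UNIV_inj_surj)
  then have w: "signed_permutation_matrix w"
    unfolding signed_permutation_matrix_iff using col e_eq sg_cases
    by (intro exI[of _ "\<lambda>j. ax (g (m0 j))"] exI[of _ "\<lambda>j. sg (g (m0 j))"]) auto
  have "lift w = g"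
    using lift_eqI[of _ _ w] lower upper w_e by (intro ext) blast
  then show ?thesis using that NC_iff_nc_lift w assms by simp
qed

text \<open>The counts have period \<open>N\<close>, since a shift by \<open>N\<close> only changes
  the sign of \<open>rt\<close>, and they sum to at most \<open>n\<close> over a period, so the
  stack process applies to them. Its parking vector has the same counts as \<open>v\<close>,
  including that of the zeros.\<close>

lemma park_vec_orbit_exists:
  assumes "v \<in> locus"
  obtains u w where "signed_permutation_matrix u" "w \<in> NC c" "v = cmat u *v park_vec w"
proof -
  define k where "k s = card {i. (v $ i)\<^sup>2 = (rt s)\<^sup>2}" for s
  have "circular_walk N k"
  proof
    show "0 < N" by (rule N_pos)
    have "(rt (m + N))\<^sup>2 = (rt m)\<^sup>2" for m by (simp add: rt_square_eq_iff)
    then show "k (m + N) = k m" for m by (simp only: k_def)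
    show "(\<Sum>i\<in>{0..<N}. k i) \<le> nat N"
      unfolding k_def sum_card_squares using card_mono[OF finite subset_UNIV] by (simp add: N_eq)
  qed
  then interpret circular_walk N k .
  obtain w where w: "w \<in> NC c" "lift w = stack_map" using matrix_of_lift[OF nc_lift_stack_map] by blast
  have "card {i. (park_vec w $ i)\<^sup>2 = (rt s)\<^sup>2} = card {i. (v $ i)\<^sup>2 = (rt s)\<^sup>2}" for s
    using card_squares_park_vec[OF w(1)] w(2) multiplicity_stack_map by (simp add: k_def)
  from card_squares_eqI[OF park_vec_in_locus[OF w(1)] assms this]
  obtain u where "signed_permutation_matrix u" "v = cmat u *v park_vec w"
    using signed_permutation_of_squares by blast
  with w(1) that show ?thesis by blast
qed

end

section \<open>The hsop of pure powers\<close>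

lemma poly_mapping_expansion:
  fixes p :: "'a \<Rightarrow>\<^sub>0 'b::comm_monoid_add"
  shows "p = (\<Sum>m\<in>Poly_Mapping.keys p. Poly_Mapping.single m (Poly_Mapping.lookup p m))"
proof (rule poly_mapping_eqI)
  fix k
  have "(\<Sum>m\<in>Poly_Mapping.keys p. Poly_Mapping.lookup (Poly_Mapping.single m (Poly_Mapping.lookup p m)) k) =
      (\<Sum>m\<in>Poly_Mapping.keys p. if m = k then Poly_Mapping.lookup p k else 0)"
    by (intro sum.cong refl) (auto simp: lookup_single when_def)
  then show "Poly_Mapping.lookup p k = Poly_Mapping.lookup
      (\<Sum>m\<in>Poly_Mapping.keys p. Poly_Mapping.single m (Poly_Mapping.lookup p m)) k"
    by (simp add: lookup_sum in_keys_iff)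
qed

lemma single_eq_single_iff:
  fixes k :: "'b::zero"
  shows "k \<noteq> 0 \<Longrightarrow> Poly_Mapping.single i k = Poly_Mapping.single j k \<longleftrightarrow> i = j"
  using lookup_single_eq[of i k] lookup_single_not_eq[of j i k] by fastforce

lemma Const_0 [simp]: "Const 0 = 0"
  by (simp add: Const_def)

lemma Const_add: "Const (a + b) = Const a + Const b"
  by (simp add: Const_def single_add)

lemma Const_mult_single: "Const a * Poly_Mapping.single m b = Poly_Mapping.single m (a * b)"
  by (simp add: Const_def mult_single)

lemma single_power:
  fixes a :: "'b::comm_semiring_1"
  shows "Poly_Mapping.single (Poly_Mapping.single i k) a ^ r =
    Poly_Mapping.single (Poly_Mapping.single i (k * r)) (a ^ r)"
  by (induction r) (simp_all add: mult_single single_add[symmetric] add.commute)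

definition exponent :: "('n::finite \<Rightarrow> nat) \<Rightarrow> 'n \<Rightarrow>\<^sub>0 nat" where
  "exponent f = (\<Sum>i\<in>UNIV. Poly_Mapping.single i (f i))"

lemma lookup_exponent [simp]: "Poly_Mapping.lookup (exponent f) i = f i"
  by (simp add: exponent_def lookup_sum lookup_single when_def)

lemma prod_single: "(\<Prod>i\<in>A. Poly_Mapping.single (f i) (1::'b::comm_semiring_1)) =
    Poly_Mapping.single (\<Sum>i\<in>A. f i) 1"
  by (induction A rule: infinite_finite_induct) (simp_all add: mult_single)

lemma psubst_superset:
  assumes "finite A" "Poly_Mapping.keys p \<subseteq> A"
  shows "psubst F p = (\<Sum>m\<in>A. Const (Poly_Mapping.lookup p m) *
     (\<Prod>i\<in>UNIV. F i ^ Poly_Mapping.lookup m i))"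
  unfolding psubst_def using assms
  by (intro sum.mono_neutral_left) (auto simp: in_keys_iff)

lemma psubst_0 [simp]: "psubst F 0 = 0"
  by (simp add: psubst_def)

lemma psubst_add: "psubst F (p + q) = psubst F p + psubst F q"
proof -
  let ?A = "Poly_Mapping.keys p \<union> Poly_Mapping.keys q"
  have "Poly_Mapping.keys (p + q) \<subseteq> ?A" by (rule keys_add)
  then show ?thesis
    by (simp add: psubst_superset[of ?A] lookup_add Const_add distrib_right sum.distrib)
qed

lemma psubst_sum: "psubst F (\<Sum>x\<in>A. f x) = (\<Sum>x\<in>A. psubst F (f x))"
  by (induction A rule: infinite_finite_induct) (simp_all add: psubst_add)

lemma psubst_single:
  "psubst F (Poly_Mapping.single m a) = Const a * (\<Prod>i\<in>UNIV. F i ^ Poly_Mapping.lookup m i)"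
  by (subst psubst_superset[of "{m}"]) auto

lemma psubst_single_single:
  "psubst F (Poly_Mapping.single (Poly_Mapping.single i k) a) = Const a * F i ^ k"
proof -
  have "(\<Prod>j\<in>UNIV. F j ^ Poly_Mapping.lookup (Poly_Mapping.single i k) j) =
      (\<Prod>j\<in>UNIV. if j = i then F j ^ k else 1)"
    by (intro prod.cong refl) (auto simp: lookup_single when_def)
  then show ?thesis by (simp add: psubst_single)
qed

lemma peval_superset:
  assumes "finite A" "Poly_Mapping.keys p \<subseteq> A"
  shows "peval p v = (\<Sum>m\<in>A. Poly_Mapping.lookup p m * (\<Prod>i\<in>UNIV. (v $ i) ^ Poly_Mapping.lookup m i))"
  unfolding peval_def using assms
  by (intro sum.mono_neutral_left) (auto simp: in_keys_iff)

lemma peval_0 [simp]: "peval 0 v = 0"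
  by (simp add: peval_def)

lemma peval_add: "peval (p + q) v = peval p v + peval q v"
proof -
  let ?A = "Poly_Mapping.keys p \<union> Poly_Mapping.keys q"
  have "Poly_Mapping.keys (p + q) \<subseteq> ?A" by (rule keys_add)
  then show ?thesis
    by (simp add: peval_superset[of ?A] lookup_add distrib_right sum.distrib)
qed

lemma peval_diff: "peval (p - q) v = peval p v - peval q v"
  using peval_add[of "p - q" q v] by simp

lemma peval_sum: "peval (\<Sum>x\<in>A. f x) v = (\<Sum>x\<in>A. peval (f x) v)"
  by (induction A rule: infinite_finite_induct) (simp_all add: peval_add)

lemma peval_single:
  "peval (Poly_Mapping.single m a) v = a * (\<Prod>i\<in>UNIV. (v $ i) ^ Poly_Mapping.lookup m i)"
  by (subst peval_superset[of "{m}"]) auto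

lemma peval_single_single:
  "peval (Poly_Mapping.single (Poly_Mapping.single i k) a) v = a * (v $ i) ^ k"
proof -
  have "(\<Prod>j\<in>UNIV. (v $ j) ^ Poly_Mapping.lookup (Poly_Mapping.single i k) j) =
      (\<Prod>j\<in>UNIV. if j = i then (v $ j) ^ k else 1)"
    by (intro prod.cong refl) (auto simp: lookup_single when_def)
  then show ?thesis by (simp add: peval_single)
qed

lemma peval_mult: "peval (p * q) v = peval p v * peval q v"
proof -
  have single: "peval (Poly_Mapping.single m a * Poly_Mapping.single m' b) v =
      peval (Poly_Mapping.single m a) v * peval (Poly_Mapping.single m' b) v" for m m' a b
    by (simp add: mult_single peval_single lookup_add power_add prod.distrib)
  have "p * q = (\<Sum>m\<in>Poly_Mapping.keys p. \<Sum>m'\<in>Poly_Mapping.keys q.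
      Poly_Mapping.single m (Poly_Mapping.lookup p m) * Poly_Mapping.single m' (Poly_Mapping.lookup q m'))"
    using arg_cong2[OF poly_mapping_expansion[of p] poly_mapping_expansion[of q], of "(*)"]
    by (simp only: sum_product)
  then have "peval (p * q) v = (\<Sum>m\<in>Poly_Mapping.keys p. \<Sum>m'\<in>Poly_Mapping.keys q.
      peval (Poly_Mapping.single m (Poly_Mapping.lookup p m)) v *
      peval (Poly_Mapping.single m' (Poly_Mapping.lookup q m')) v)"
    by (simp only: peval_sum single)
  also have "\<dots> = (\<Sum>m\<in>Poly_Mapping.keys p. peval (Poly_Mapping.single m (Poly_Mapping.lookup p m)) v) *
      (\<Sum>m'\<in>Poly_Mapping.keys q. peval (Poly_Mapping.single m' (Poly_Mapping.lookup q m')) v)"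
    by (rule sum_product[symmetric])
  also have "\<dots> = peval p v * peval q v"
    by (simp only: peval_sum[symmetric] poly_mapping_expansion[symmetric])
  finally show ?thesis .
qed

definition pure_power :: "nat \<Rightarrow> 'n \<Rightarrow> ('n::finite) cpoly" where
  "pure_power d i = Poly_Mapping.single (Poly_Mapping.single i d) 1"

lemma homogeneous_pure_power: "homogeneous d (pure_power d i)"
  by (simp add: homogeneous_def pure_power_def lookup_single when_def)

lemma psubst_pure_power:
  "psubst (pure_power d) (Poly_Mapping.single m a) =
    Poly_Mapping.single (exponent (\<lambda>i. d * Poly_Mapping.lookup m i)) a"
  by (simp add: psubst_single pure_power_def single_power prod_single Const_mult_single exponent_def)

text \<open>Division of all exponents by \<open>d\<close> writes a monomial as a product of
  \<open>d\<close>-th powers of variables times a monomial with exponents below \<open>d\<close>.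
  There are finitely many of the latter, and they generate.\<close>

lemma hsop_pure_power:
  assumes "0 < d"
  shows "hsop (pure_power d :: 'n::finite \<Rightarrow> 'n cpoly)"
  unfolding hsop_def
proof (intro conjI allI)
  fix i :: 'n
  show "\<exists>k>0. homogeneous k (pure_power d i)" using assms homogeneous_pure_power by blast
next
  define rem :: "('n \<Rightarrow>\<^sub>0 nat) \<Rightarrow> 'n cpoly" where
    "rem m = Poly_Mapping.single (exponent (\<lambda>i. Poly_Mapping.lookup m i mod d)) 1" for m
  define quot :: "('n \<Rightarrow>\<^sub>0 nat) \<Rightarrow> 'n \<Rightarrow>\<^sub>0 nat" where
    "quot m = exponent (\<lambda>i. Poly_Mapping.lookup m i div d)" for m
  define B :: "'n cpoly set" where
    "B = (\<lambda>f. Poly_Mapping.single (exponent f) 1) ` (PiE UNIV (\<lambda>_. {..<d}))"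
  show "\<exists>B. finite B \<and> (\<forall>p. \<exists>q. (\<forall>b\<in>B. q b \<in> range (psubst (pure_power d :: 'n \<Rightarrow> 'n cpoly))) \<and>
      p = (\<Sum>b\<in>B. q b * b))"
  proof (intro exI[of _ B] conjI allI)
    show fin: "finite B" unfolding B_def by (intro finite_imageI finite_PiE) auto
    fix p :: "'n cpoly"
    let ?K = "Poly_Mapping.keys p"
    define q where "q b = psubst (pure_power d) (\<Sum>m\<in>{m \<in> ?K. rem m = b}.
        Poly_Mapping.single (quot m) (Poly_Mapping.lookup p m))" for b
    have split: "Poly_Mapping.single (exponent (\<lambda>i. d * Poly_Mapping.lookup (quot m) i)) a * rem m =
        Poly_Mapping.single m a" for m a
    proof -
      have "exponent (\<lambda>i. d * Poly_Mapping.lookup (quot m) i) +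
          exponent (\<lambda>i. Poly_Mapping.lookup m i mod d) = m"
        by (rule poly_mapping_eqI) (simp add: lookup_add quot_def)
      then show ?thesis by (simp add: rem_def mult_single)
    qed
    have "(\<Sum>b\<in>B. q b * b) = (\<Sum>b\<in>B. \<Sum>m\<in>{m \<in> ?K. rem m = b}.
        Poly_Mapping.single m (Poly_Mapping.lookup p m))"
    proof (rule sum.cong)
      fix b
      have "q b * b = (\<Sum>m\<in>{m \<in> ?K. rem m = b}.
          Poly_Mapping.single (exponent (\<lambda>i. d * Poly_Mapping.lookup (quot m) i)) (Poly_Mapping.lookup p m) * b)"
        by (simp add: q_def psubst_sum psubst_pure_power sum_distrib_right)
      also have "\<dots> = (\<Sum>m\<in>{m \<in> ?K. rem m = b}. Poly_Mapping.single m (Poly_Mapping.lookup p m))"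
        using split by (intro sum.cong) auto
      finally show "q b * b = \<dots>" .
    qed simp
    also have "\<dots> = (\<Sum>m\<in>?K. Poly_Mapping.single m (Poly_Mapping.lookup p m))"
    proof (rule sum.group)
      show "rem ` ?K \<subseteq> B" unfolding B_def rem_def using assms by auto
    qed (simp_all add: fin)
    also have "\<dots> = p" by (rule poly_mapping_expansion[symmetric])
    finally show "\<exists>q. (\<forall>b\<in>B. q b \<in> range (psubst (pure_power d))) \<and> p = (\<Sum>b\<in>B. q b * b)"
      by (intro exI[of _ q]) (auto simp: q_def)
  qed
qed

lemma linear_form_expansion:
  assumes "f \<in> linear_forms"
  shows "f = (\<Sum>i\<in>UNIV. Poly_Mapping.single (Poly_Mapping.single i 1)
    (Poly_Mapping.lookup f (Poly_Mapping.single i 1)))"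
proof (rule poly_mapping_eqI)
  fix m
  show "Poly_Mapping.lookup f m = Poly_Mapping.lookup (\<Sum>i\<in>UNIV. Poly_Mapping.single
      (Poly_Mapping.single i 1) (Poly_Mapping.lookup f (Poly_Mapping.single i 1))) m"
  proof (cases "\<exists>j. m = Poly_Mapping.single j 1")
    case True
    then show ?thesis by (auto simp: lookup_sum lookup_single when_def single_eq_single_iff)
  next
    case False
    have "m \<notin> Poly_Mapping.keys f"
    proof
      assume "m \<in> Poly_Mapping.keys f"
      then have sum: "(\<Sum>i\<in>UNIV. Poly_Mapping.lookup m i) = 1"
        using assms by (simp add: linear_forms_def homogeneous_def)
      then obtain j where j: "Poly_Mapping.lookup m j = 1" "\<forall>i. i \<noteq> j \<longrightarrow> Poly_Mapping.lookup m i = 0"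
        using sum[unfolded sum_eq_1_iff[OF finite]] by auto
      then have "m = Poly_Mapping.single j 1"
        by (intro poly_mapping_eqI) (auto simp: lookup_single when_def)
      with False show False by blast
    qed
    moreover have "Poly_Mapping.single j 1 \<noteq> m" for j using False by blast
    ultimately show ?thesis by (simp add: lookup_sum lookup_single when_def in_keys_iff)
  qed
qed

lemma hsop_map_pure_power:
  "hsop_map (pure_power d) f = (\<Sum>i\<in>UNIV. Poly_Mapping.single (Poly_Mapping.single i d)
    (Poly_Mapping.lookup f (Poly_Mapping.single i 1)))"
  by (simp add: hsop_map_def pure_power_def Const_mult_single)

lemma hsop_map_sum: "hsop_map F (\<Sum>x\<in>A. f x) = (\<Sum>x\<in>A. hsop_map F (f x))"
  by (induction A rule: infinite_finite_induct)
    (simp_all add: hsop_map_def lookup_add Const_add distrib_right sum.distrib)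

lemma hsop_map_pure_power_single:
  "hsop_map (pure_power d) (Poly_Mapping.single (Poly_Mapping.single j 1) a) =
    Poly_Mapping.single (Poly_Mapping.single j d) a"
proof -
  have "hsop_map (pure_power d) (Poly_Mapping.single (Poly_Mapping.single j 1) a) =
      (\<Sum>i\<in>UNIV. if i = j then Poly_Mapping.single (Poly_Mapping.single i d) a else 0)"
    unfolding hsop_map_pure_power
    by (intro sum.cong refl) (auto simp: lookup_single when_def single_eq_single_iff)
  then show ?thesis by simp
qed

lemma inj_hsop_map_pure_power:
  assumes "0 < d"
  shows "inj_on (hsop_map (pure_power d)) linear_forms"
proof (rule inj_onI)
  fix f g :: "('n::finite) cpoly"
  assume fg: "f \<in> linear_forms" "g \<in> linear_forms"
    and eq: "hsop_map (pure_power d) f = hsop_map (pure_power d) g"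
  have coeff: "Poly_Mapping.lookup (hsop_map (pure_power d) f) (Poly_Mapping.single j d) =
      Poly_Mapping.lookup f (Poly_Mapping.single j 1)" for f :: "'n cpoly" and j
    using assms by (simp add: hsop_map_pure_power lookup_sum lookup_single when_def single_eq_single_iff)
  have "Poly_Mapping.lookup f (Poly_Mapping.single j 1) = Poly_Mapping.lookup g (Poly_Mapping.single j 1)" for j
    using coeff[of f j] coeff[of g j] eq by simp
  then show "f = g" using linear_form_expansion[OF fg(1)] linear_form_expansion[OF fg(2)] by simp
qed

text \<open>Since the inverse of \<open>w\<close> is its transpose, \<open>w\<close> acts on the
  variables by the same permutation and signs as on the basis vectors.\<close>

lemma pact_single_single:
  fixes w :: "real^'n^'n"
  assumes "signed_permutation_matrix w"
    and w: "\<And>j. w *v axis j 1 = s j *\<^sub>R axis (p j) 1"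
  shows "pact w (Poly_Mapping.single (Poly_Mapping.single i k) a) =
    Poly_Mapping.single (Poly_Mapping.single (p i) k) (a * complex_of_real (s i) ^ k)"
proof -
  have entry: "(inv\<^bsub>\<W>\<^esub> w) $ i $ j = (if j = p i then s i else 0)" for i j
  proof -
    have "(inv\<^bsub>\<W>\<^esub> w) $ i $ j = (w *v axis i 1) $ j"
      using inv_W[OF assms(1)] by (simp add: matrix_vector_mult_basis column_def transpose_def)
    then show ?thesis by (simp add: w) (simp add: axis_def)
  qed
  have "(\<Sum>j\<in>UNIV. Const (complex_of_real ((inv\<^bsub>\<W>\<^esub> w) $ i $ j)) * Var j) =
      (\<Sum>j\<in>UNIV. if j = p i then Poly_Mapping.single (Poly_Mapping.single j 1) (complex_of_real (s i)) else 0)"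
    by (intro sum.cong refl) (simp add: entry Var_def Const_mult_single)
  then show ?thesis by (simp add: pact_def psubst_single_single single_power Const_mult_single)
qed

text \<open>An odd power of a sign is that sign, so taking \<open>d\<close>-th powers of the
  variables commutes with signed permutations.\<close>

lemma hsop_map_pure_power_equivariant:
  fixes w :: "real^'n^'n"
  assumes w: "signed_permutation_matrix w" and "f \<in> linear_forms" and "odd d"
  shows "hsop_map (pure_power d) (pact w f) = pact w (hsop_map (pure_power d) f)"
proof -
  obtain p s where ps: "\<forall>j. s j \<in> {1, -1::real}" "\<And>j. w *v axis j 1 = s j *\<^sub>R axis (p j) 1"
    using w unfolding signed_permutation_matrix_iff by blast
  let ?f = "\<lambda>i. Poly_Mapping.lookup f (Poly_Mapping.single i 1)"
  have pact_sum: "pact w (\<Sum>i\<in>UNIV. g i) = (\<Sum>i\<in>UNIV. pact w (g i))" for g :: "'n \<Rightarrow> 'n cpoly"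
    by (simp add: pact_def psubst_sum)
  have "s i ^ d = s i" for i using ps(1)[rule_format, of i] \<open>odd d\<close> by auto
  then have pow: "complex_of_real (s i) ^ d = complex_of_real (s i)" for i
    by (metis of_real_power)
  have "pact w f = pact w (\<Sum>i\<in>UNIV. Poly_Mapping.single (Poly_Mapping.single i 1) (?f i))"
    using linear_form_expansion[OF assms(2)] by simp
  also have "\<dots> = (\<Sum>i\<in>UNIV. Poly_Mapping.single (Poly_Mapping.single (p i) 1) (?f i * complex_of_real (s i)))"
    by (simp only: pact_sum pact_single_single[OF w ps(2)] power_one_right)
  finally have "hsop_map (pure_power d) (pact w f) =
      (\<Sum>i\<in>UNIV. Poly_Mapping.single (Poly_Mapping.single (p i) d) (?f i * complex_of_real (s i)))"
    by (simp only: hsop_map_sum hsop_map_pure_power_single)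
  also have "\<dots> = pact w (hsop_map (pure_power d) f)"
    by (simp only: hsop_map_pure_power pact_sum pact_single_single[OF w ps(2)] pow)
  finally show ?thesis .
qed

lemma admissible_hsop_pure_power:
  assumes "even h"
  shows "admissible_hsop h (pure_power (h + 1) :: 'n::finite \<Rightarrow> 'n cpoly)"
  unfolding admissible_hsop_def
proof (intro conjI ballI allI)
  show "hsop (pure_power (h + 1) :: 'n \<Rightarrow> 'n cpoly)" by (rule hsop_pure_power) simp
  show "inj_on (hsop_map (pure_power (h + 1))) (linear_forms :: 'n cpoly set)"
    by (rule inj_hsop_map_pure_power) simp
  fix w :: "real^'n^'n" and f :: "'n cpoly"
  assume "w \<in> carrier \<W>" "f \<in> linear_forms"
  then show "hsop_map (pure_power (h + 1)) (pact w f) = pact w (hsop_map (pure_power (h + 1)) f)"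
    using assms by (intro hsop_map_pure_power_equivariant) simp_all
qed (rule homogeneous_pure_power)

lemma parking_locus_pure_power:
  "parking_locus (pure_power d) = {v :: complex^'n. \<forall>i. (v $ i) ^ d = v $ i}"
proof -
  have diff: "peval (pure_power d i - Var i) v = (v $ i) ^ d - v $ i"
    for i :: "'n::finite" and v :: "complex^'n"
    by (simp add: peval_diff pure_power_def Var_def peval_single_single del: One_nat_def)
  show ?thesis
  proof (intro equalityI subsetI CollectI allI)
    fix v :: "complex^'n" and i :: 'n assume v: "v \<in> parking_locus (pure_power d)"
    \<comment> \<open>Indicator coefficients place each single generator in the ideal.\<close>
    have "(\<Sum>j\<in>UNIV. (if j = i then 1 else 0) * (pure_power d j - Var j)) = pure_power d i - Var i"
      by (simp add: if_distrib[of "\<lambda>x. x * _"] cong: if_cong)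
    then have "pure_power d i - Var i \<in> parking_ideal (pure_power d)"
      unfolding parking_ideal_def by (auto intro!: exI[of _ "\<lambda>j. if j = i then 1 else 0"])
    then have "peval (pure_power d i - Var i) v = 0" using v by (simp add: parking_locus_def)
    then show "(v $ i) ^ d = v $ i" using diff by simp
  next
    fix v :: "complex^'n" assume "v \<in> {v. \<forall>i. (v $ i) ^ d = v $ i}"
    then have "peval (\<Sum>i\<in>UNIV. q i * (pure_power d i - Var i)) v = 0" for q
      by (simp add: peval_sum peval_mult diff)
    then show "v \<in> parking_locus (pure_power d)"
      by (auto simp: parking_locus_def parking_ideal_def)
  qed
qed

lemma card_vec_PiE:
  "card {v :: 'a^'n. \<forall>i. v $ i \<in> R} = card R ^ CARD('n::finite)"
proof -
  have "bij_betw vec_lambda (PiE (UNIV :: 'n set) (\<lambda>_. R)) {v. \<forall>i. v $ i \<in> R}"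
    by (rule bij_betwI[of _ _ _ vec_nth]) auto
  from bij_betw_same_card[OF this] show ?thesis by (simp add: card_PiE)
qed

section \<open>Coxeter elements are signed cycles\<close>

lemma axis_eq_scaleR: "axis i (s::real) = s *\<^sub>R axis i 1"
  by (simp add: vec_eq_iff axis_def)

lemma root_cases:
  assumes "a \<in> roots_B"
  obtains (loop) i s where "s \<in> {1, -1}" "a = s *\<^sub>R axis i (1::real)"
  | (edge) i j s t where "i \<noteq> j" "s \<in> {1, -1}" "t \<in> {1, -1}"
      "a = s *\<^sub>R axis i (1::real) + t *\<^sub>R axis j 1"
proof -
  from assms consider i s where "s \<in> {1, -1}" "a = axis i s"
    | i j s t where "i \<noteq> j" "s \<in> {1, -1}" "t \<in> {1, -1}" "a = axis i s + axis j t"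
    unfolding roots_B_def by blast
  then show ?thesis
  proof cases
    case (1 i s)
    then have "a = s *\<^sub>R axis i 1" by (simp only: axis_eq_scaleR[of i s, symmetric])
    with 1 loop show ?thesis by blast
  next
    case (2 i j s t)
    then have "a = s *\<^sub>R axis i 1 + t *\<^sub>R axis j 1"
      by (simp only: axis_eq_scaleR[of i s, symmetric] axis_eq_scaleR[of j t, symmetric])
    with 2 edge show ?thesis by blast
  qed
qed

lemma loop_in_roots:
  assumes "s \<in> {1, -1}"
  shows "s *\<^sub>R axis i 1 \<in> roots_B"
proof -
  have "axis i s \<in> {axis i s | i s. s \<in> {1, -1}}"
    using assms by (intro CollectI exI[of _ i] exI[of _ s] conjI refl)
  then have "axis i s \<in> roots_B" unfolding roots_B_def by (rule UnI1)
  then show ?thesis by (simp only: axis_eq_scaleR[of i s])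
qed

lemma edge_in_roots:
  assumes "i \<noteq> j" "s \<in> {1, -1}" "t \<in> {1, -1}"
  shows "s *\<^sub>R axis i 1 + t *\<^sub>R axis j 1 \<in> roots_B"
proof -
  have "axis i s + axis j t \<in>
      {axis i s + axis j t | i j s t. i \<noteq> j \<and> s \<in> {1, -1} \<and> t \<in> {1, -1}}"
    using assms by (intro CollectI exI[of _ i] exI[of _ j] exI[of _ s] exI[of _ t] conjI refl)
  then have "axis i s + axis j t \<in> roots_B" unfolding roots_B_def by (rule UnI2)
  then show ?thesis by (simp only: axis_eq_scaleR[of i s] axis_eq_scaleR[of j t])
qed

lemma root_nonzero:
  assumes "a \<in> roots_B"
  shows "a \<noteq> 0"
  using assms
proof (cases rule: root_cases)
  case (loop i s)
  then have "a $ i \<noteq> 0" by auto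
  then show ?thesis by auto
next
  case (edge i j s t)
  then have "a $ i \<noteq> 0" by (auto simp: axis_def)
  then show ?thesis by auto
qed

lemma signed_permutation_matrix_refl_root:
  assumes "a \<in> roots_B"
  shows "signed_permutation_matrix (refl_matrix a)"
  using assms
proof (cases rule: root_cases)
  case (loop i s)
  then have "s \<noteq> 0" by auto
  then have "refl_matrix a = refl_matrix (axis i 1)"
    unfolding loop(2) by (rule refl_matrix_scaleR)
  then show ?thesis by (simp only: signed_permutation_matrix_refl_axis)
next
  case (edge i j s t)
  then have s: "s * s = 1" "s \<noteq> 0" "- s * t \<in> {1, -1}" by auto
  have "s * (s * t) = t" using s(1) by (simp add: mult.assoc[symmetric])
  then have "a = s *\<^sub>R (axis i 1 - (- s * t) *\<^sub>R axis j 1)"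
    unfolding edge(4) by (simp add: scaleR_right_distrib)
  then have "refl_matrix a = refl_matrix (axis i 1 - (- s * t) *\<^sub>R axis j 1)"
    by (simp only:) (rule refl_matrix_scaleR, rule s)
  then show ?thesis using signed_permutation_matrix_refl_edge[OF edge(1) s(3)] by simp
qed

lemma list_prod_refl_diff_in_span:
  "list_prod (map refl_matrix bs) *v x - x \<in> span (set bs)"
proof (induction bs)
  case (Cons b bs)
  let ?y = "list_prod (map refl_matrix bs) *v x"
  have "list_prod (map refl_matrix (b # bs)) *v x - x = (?y - x) + (- (2 * (?y \<bullet> b) / (b \<bullet> b))) *\<^sub>R b"
    by (simp add: matrix_vector_mul_assoc[symmetric] refl_matrix_mult)
  moreover have "?y - x \<in> span (set (b # bs))"
    using Cons by (rule set_mp[OF span_mono, rotated]) auto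
  moreover have "b \<in> span (set (b # bs))" by (rule span_base) simp
  ultimately show ?case by (simp only: span_add span_scale)
qed (simp add: span_zero)

text \<open>If \<open>x\<close> were not orthogonal to the first vector \<open>a\<close>, then
  \<open>a\<close> would be a multiple of the displacement of \<open>x\<close> by the remaining
  reflections and so lie in the span of their vectors.\<close>

lemma list_prod_refl_fixed:
  assumes "independent (set bs)" "distinct bs" "list_prod (map refl_matrix bs) *v x = x" "b \<in> set bs"
  shows "x \<bullet> b = 0"
  using assms
proof (induction bs)
  case (Cons a bs)
  let ?y = "list_prod (map refl_matrix bs) *v x"
  have ind: "independent (set bs)" "a \<notin> span (set bs)"
    using Cons.prems(1,2) by (simp_all add: independent_insert)
  have a0: "a \<noteq> 0" using ind(2) span_zero by blast
  have fixed: "refl_matrix a *v ?y = x"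
    using Cons.prems(3) by (simp add: matrix_vector_mul_assoc[symmetric])
  have "?y = (refl_matrix a ** refl_matrix a) *v ?y" using refl_matrix_involution[OF a0] by simp
  also have "\<dots> = refl_matrix a *v x"
    using fixed by (simp add: matrix_vector_mul_assoc[symmetric])
  finally have y: "?y - x = (- (2 * (x \<bullet> a) / (a \<bullet> a))) *\<^sub>R a" by (simp add: refl_matrix_mult)
  have "x \<bullet> a = 0"
  proof (rule ccontr)
    assume "x \<bullet> a \<noteq> 0"
    let ?k = "- (2 * (x \<bullet> a) / (a \<bullet> a))"
    have "?k \<noteq> 0" using \<open>x \<bullet> a \<noteq> 0\<close> a0 by simp
    then have "a = inverse ?k *\<^sub>R (?y - x)"
      unfolding y scaleR_scaleR by (simp only: left_inverse[OF \<open>?k \<noteq> 0\<close>] scaleR_one)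
    then have "a \<in> span (set bs)"
      using span_scale[OF list_prod_refl_diff_in_span[of bs x], of "inverse ?k"] by simp
    with ind show False by simp
  qed
  moreover from this have "?y = x" using y by simp
  ultimately show ?case using Cons.IH ind(1) Cons.prems(2,4) by auto
qed simp

locale type_B_simple_system =
  fixes D :: "(real^'n) set"
  assumes simple: "simple_system D"
begin

lemma D_roots: "a \<in> D \<Longrightarrow> a \<in> roots_B" and D_independent: "independent D"
  and D_combination: "b \<in> roots_B \<Longrightarrow> \<exists>k. (\<forall>a\<in>D. 0 \<le> k a) \<and>
        (b = (\<Sum>a\<in>D. k a *\<^sub>R a) \<or> b = - (\<Sum>a\<in>D. k a *\<^sub>R a))"
  using simple unfolding simple_system_def by auto

lemma D_finite: "finite D"
  using D_independent by (rule independent_imp_finite)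

text \<open>Exists because \<open>D\<close> is independent. By the sign condition on coefficients it
  vanishes on no root, and its sign tells positive from negative roots.\<close>

definition height :: "real^'n \<Rightarrow> real" where
  "height = (SOME f. linear f \<and> (\<forall>a\<in>D. f a = 1))"

lemma linear_height: "linear height" and height_D: "a \<in> D \<Longrightarrow> height a = 1"
proof -
  have "linear height \<and> (\<forall>a\<in>D. height a = 1)"
    unfolding height_def
    using someI_ex[OF linear_independent_extend[OF D_independent, of "\<lambda>_. 1 :: real"]] by simp
  then show "linear height" "a \<in> D \<Longrightarrow> height a = 1" by auto
qed

lemma height_combination: "height (\<Sum>a\<in>D. k a *\<^sub>R a) = (\<Sum>a\<in>D. k a)"
  by (simp add: linear_sum[OF linear_height] linear_scale[OF linear_height] height_D)

lemma height_nonzero: "b \<in> roots_B \<Longrightarrow> height b \<noteq> 0"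
proof
  assume b: "b \<in> roots_B" and 0: "height b = 0"
  obtain k where k: "\<forall>a\<in>D. 0 \<le> k a" "b = (\<Sum>a\<in>D. k a *\<^sub>R a) \<or> b = - (\<Sum>a\<in>D. k a *\<^sub>R a)"
    using D_combination[OF b] by blast
  then have "(\<Sum>a\<in>D. k a) = 0"
    using 0 height_combination[of k] by (auto simp: linear_neg[OF linear_height])
  then have "\<forall>a\<in>D. k a = 0" using k(1) D_finite by (simp add: sum_nonneg_eq_0_iff)
  then have "b = 0" using k(2) by auto
  then show False using root_nonzero[OF b] by simp
qed

lemma positive_combination:
  assumes "b \<in> roots_B" "0 < height b"
  obtains k where "\<And>a. a \<in> D \<Longrightarrow> 0 \<le> k a" "b = (\<Sum>a\<in>D. k a *\<^sub>R a)"
proof -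
  obtain k where k: "\<forall>a\<in>D. 0 \<le> k a" "b = (\<Sum>a\<in>D. k a *\<^sub>R a) \<or> b = - (\<Sum>a\<in>D. k a *\<^sub>R a)"
    using D_combination[OF assms(1)] by blast
  have "0 \<le> (\<Sum>a\<in>D. k a)" using k(1) by (simp add: sum_nonneg)
  then have "b \<noteq> - (\<Sum>a\<in>D. k a *\<^sub>R a)"
    using assms(2) height_combination[of k] by (auto simp: linear_neg[OF linear_height])
  with k show ?thesis using that by blast
qed

text \<open>The signs \<open>sig\<close> make all \<open>f i\<close> positive roots, of height
  \<open>r i\<close>. The numbers \<open>r i\<close> are distinct because \<open>f i - f j\<close>
  is a root, and they order the coordinates as in the standard simple system.\<close>

definition sig :: "'n \<Rightarrow> real" where
  "sig i = sgn (height (axis i 1))"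

definition r :: "'n \<Rightarrow> real" where
  "r i = \<bar>height (axis i 1)\<bar>"

definition f :: "'n \<Rightarrow> real^'n" where
  "f i = sig i *\<^sub>R axis i 1"

lemma height_axis: "height (axis i 1) = sig i * r i"
  by (simp add: sig_def r_def sgn_mult_abs)

lemma height_axis_nonzero: "height (axis i 1) \<noteq> 0"
  using height_nonzero[OF loop_in_roots[of 1 i]] by simp

lemma r_pos: "0 < r i"
  using height_axis_nonzero by (simp add: r_def)

lemma sig: "sig i = 1 \<or> sig i = -1"
  using height_axis_nonzero[of i] by (auto simp: sig_def sgn_if)

lemma sig_square [simp]: "sig i * sig i = 1"
  using sig[of i] by auto

lemma f_root: "f i \<in> roots_B"
  unfolding f_def using sig by (intro loop_in_roots) auto

lemma height_f: "height (f i) = r i"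
  by (simp add: f_def linear_scale[OF linear_height] height_axis mult.assoc[symmetric])

lemma r_distinct: "i \<noteq> j \<Longrightarrow> r i \<noteq> r j"
proof
  assume "i \<noteq> j" and eq: "r i = r j"
  have "sig i *\<^sub>R axis i 1 + (- sig j) *\<^sub>R axis j 1 \<in> roots_B"
    using \<open>i \<noteq> j\<close> sig[of i] sig[of j] by (intro edge_in_roots) auto
  then have "height (f i - f j) \<noteq> 0" using height_nonzero by (simp add: f_def)
  then show False using eq by (simp add: linear_diff[OF linear_height] height_f)
qed

lemma loop_in_D:
  assumes "s \<in> {1, -1}" "s *\<^sub>R axis i 1 \<in> D"
  shows "s *\<^sub>R axis i 1 = f i"
proof -
  have "s * (sig i * r i) = 1"
    using height_D[OF assms(2)] by (simp add: linear_scale[OF linear_height] height_axis)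
  then have "s = sig i" using assms(1) sig[of i] r_pos[of i] by auto
  then show ?thesis by (simp add: f_def)
qed

text \<open>A union of connected components of the graph on the coordinates whose edges are the
  simple roots with two nonzero entries.\<close>

definition separated :: "'n set \<Rightarrow> bool" where
  "separated J \<longleftrightarrow> (\<forall>a\<in>D. (\<forall>i\<in>J. a $ i = 0) \<or> (\<forall>i. i \<notin> J \<longrightarrow> a $ i = 0))"

text \<open>If \<open>i \<in> J\<close> minimizes \<open>r\<close>, then the functional \<open>f j \<mapsto> r j - r i\<close> for \<open>j \<in> J\<close> and
  \<open>f j \<mapsto> 0\<close> otherwise is positive on every simple root supported in \<open>J\<close> except \<open>f i\<close>.\<close>

lemma separated_has_loop:
  assumes "separated J" "J \<noteq> {}"
  shows "\<exists>i\<in>J. f i \<in> D"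
proof -
  have "finite (r ` J)" "r ` J \<noteq> {}" using assms(2) by auto
  then have "Min (r ` J) \<in> r ` J" by (rule Min_in)
  then obtain i where i: "i \<in> J" "r i = Min (r ` J)" by auto
  have min: "r i \<le> r j" if "j \<in> J" for j using i that by simp
  have less: "r i < r j" if "j \<in> J" "j \<noteq> i" for j
    using min[OF that(1)] r_distinct[OF that(2)] by simp
  define h where "h j = (if j \<in> J then sig j * (r j - r i) else 0)" for j
  define \<phi> where "\<phi> x = (\<Sum>j\<in>UNIV. x $ j * h j)" for x
  have lin: "linear \<phi>"
    by (rule linearI) (simp_all add: \<phi>_def sum.distrib distrib_right sum_distrib_left mult.assoc)
  have axis: "\<phi> (axis j 1) = h j" for j
  proof -
    have "\<phi> (axis j 1) = (\<Sum>l\<in>UNIV. if l = j then h l else 0)"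
      unfolding \<phi>_def by (intro sum.cong refl) (simp add: axis_def)
    then show ?thesis by simp
  qed
  have D_cases: "0 \<le> \<phi> a \<and> (\<phi> a = 0 \<longrightarrow> a = f i \<or> a $ i = 0)" if a: "a \<in> D" for a
    using D_roots[OF a]
  proof (cases rule: root_cases)
    case (loop j s)
    then have aj: "a = f j" using loop_in_D a by simp
    have val: "\<phi> a = (if j \<in> J then r j - r i else 0)"
      unfolding aj f_def linear_scale[OF lin] axis by (simp add: h_def mult.assoc[symmetric])
    show ?thesis
    proof (cases "j \<in> J")
      case True
      then show ?thesis using val min[of j] less[of j] aj by force
    next
      case False
      then have "a $ i = 0" using i(1) unfolding aj f_def by (auto simp: axis_def)
      with False val show ?thesis by simp
    qed
  next
    case (edge j l s t)
    have val: "\<phi> a = s * h j + t * h l"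
      unfolding edge linear_add[OF lin] linear_scale[OF lin] axis by simp
    have ht: "s * (sig j * r j) + t * (sig l * r l) = 1"
      using height_D[OF a] unfolding edge
      by (simp add: linear_add[OF linear_height] linear_scale[OF linear_height] height_axis)
    have aj: "a $ j = s" "a $ l = t" using edge(1) unfolding edge by (simp_all add: axis_def)
    have nz: "a $ j \<noteq> 0" "a $ l \<noteq> 0" using edge(2,3) aj by auto
    show ?thesis
    proof (cases "j \<in> J")
      case True
      then have l: "l \<in> J" using assms(1) a nz unfolding separated_def by blast
      have pos: "r i < r j \<or> r i < r l" using less True l edge(1) by blast
      \<comment> \<open>With respect to \<open>f j\<close> and \<open>f l\<close> the signs of
        \<open>a\<close> are not both negative, as the height is 1. Two positive signs give two
        terms that are nonnegative and not both 0; for opposite signs \<open>r i\<close> cancels and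
        the value is the height 1.\<close>
      have "0 < \<phi> a"
        unfolding val h_def using True l ht pos min[OF True] min[OF l] edge(2,3) sig[of j] sig[of l]
          r_pos[of j] r_pos[of l] by (auto simp: algebra_simps)
      then show ?thesis by simp
    next
      case False
      then have l: "l \<notin> J" using assms(1) a nz unfolding separated_def by blast
      have "a $ i = 0" using False l i(1) unfolding edge by (auto simp: axis_def)
      then show ?thesis using False l by (simp add: val h_def)
    qed
  qed
  have "f i \<in> D"
  proof (rule ccontr)
    assume notin: "f i \<notin> D"
    obtain k where k: "\<And>a. a \<in> D \<Longrightarrow> 0 \<le> k a" "f i = (\<Sum>a\<in>D. k a *\<^sub>R a)"
      using positive_combination[OF f_root] height_f r_pos by metis
    have "\<phi> (f i) = 0" unfolding f_def linear_scale[OF lin] axis by (simp add: h_def)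
    then have "(\<Sum>a\<in>D. k a * \<phi> a) = 0"
      unfolding k(2) by (simp add: linear_sum[OF lin] linear_scale[OF lin])
    \<comment> \<open>All terms are nonnegative. Hence every simple root that occurs has value 0 and
      vanishes at coordinate \<open>i\<close>, which \<open>f i\<close> does not.\<close>
    then have "\<forall>a\<in>D. k a * \<phi> a = 0"
      using k(1) D_cases D_finite by (subst (asm) sum_nonneg_eq_0_iff) auto
    then have "\<forall>a\<in>D. k a * a $ i = 0" using D_cases notin by fastforce
    then have "(\<Sum>a\<in>D. k a * a $ i) = 0" by (intro sum.neutral) blast
    moreover have "f i $ i = (\<Sum>a\<in>D. k a * a $ i)"
      by (subst k(2)) (simp add: sum_component)
    ultimately show False using sig[of i] by (auto simp: f_def)
  qed
  with i show ?thesis by blast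
qed

text \<open>Otherwise the root \<open>f i - f j\<close> would have coefficients 1 and -1 on two
  simple roots, against the common sign. The functionals \<open>p\<close> and \<open>q\<close> read
  off these coefficients.\<close>

lemma loop_unique:
  assumes "f i \<in> D" "f j \<in> D"
  shows "i = j"
proof (rule ccontr)
  assume "i \<noteq> j"
  have ne: "f i \<noteq> f j"
  proof
    assume "f i = f j"
    then have "f i $ i = f j $ i" by simp
    then show False using \<open>i \<noteq> j\<close> sig[of i] by (auto simp: f_def axis_def)
  qed
  obtain p where p: "linear p" "\<forall>a\<in>D. p a = (if a = f i then 1 else 0 :: real)"
    using linear_independent_extend[OF D_independent, of "\<lambda>a. if a = f i then 1 else 0 :: real"] by blast
  obtain q where q: "linear q" "\<forall>a\<in>D. q a = (if a = f j then 1 else 0 :: real)"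
    using linear_independent_extend[OF D_independent, of "\<lambda>a. if a = f j then 1 else 0 :: real"] by blast
  have "sig i *\<^sub>R axis i 1 + (- sig j) *\<^sub>R axis j 1 \<in> roots_B"
    using \<open>i \<noteq> j\<close> sig[of i] sig[of j] by (intro edge_in_roots) auto
  then have "f i - f j \<in> roots_B" by (simp add: f_def)
  from D_combination[OF this] obtain k where k: "\<forall>a\<in>D. 0 \<le> k a"
      "f i - f j = (\<Sum>a\<in>D. k a *\<^sub>R a) \<or> f i - f j = - (\<Sum>a\<in>D. k a *\<^sub>R a)"
    by blast
  have "p (\<Sum>a\<in>D. k a *\<^sub>R a) = (\<Sum>a\<in>D. if a = f i then k a else 0)"
    unfolding linear_sum[OF p(1)] using p by (intro sum.cong refl) (simp add: linear_scale)
  then have pk: "p (\<Sum>a\<in>D. k a *\<^sub>R a) = k (f i)" using D_finite assms by simp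
  have "q (\<Sum>a\<in>D. k a *\<^sub>R a) = (\<Sum>a\<in>D. if a = f j then k a else 0)"
    unfolding linear_sum[OF q(1)] using q by (intro sum.cong refl) (simp add: linear_scale)
  then have qk: "q (\<Sum>a\<in>D. k a *\<^sub>R a) = k (f j)" using D_finite assms by simp
  have vals: "p (f i - f j) = 1" "q (f i - f j) = -1"
    using p q assms ne by (simp_all add: linear_diff)
  from k(2) show False
  proof
    assume "f i - f j = (\<Sum>a\<in>D. k a *\<^sub>R a)"
    then have "k (f j) = -1" using qk vals by simp
    then show False using k(1) assms by force
  next
    assume "f i - f j = - (\<Sum>a\<in>D. k a *\<^sub>R a)"
    then have "k (f i) = -1" using pk vals p(1) by (simp add: linear_neg)
    then show False using k(1) assms by force
  qed
qed

text \<open>A proper \<open>J\<close> and its complement would both be separated, and each would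
  contain the index of a simple root \<open>f i\<close>, of which there is only one.\<close>

lemma separated_eq_UNIV:
  assumes "separated J" "J \<noteq> {}"
  shows "J = UNIV"
proof (rule ccontr)
  assume "J \<noteq> UNIV"
  then have "- J \<noteq> {}" by auto
  moreover have "separated (- J)" using assms(1) unfolding separated_def by auto
  ultimately obtain i j where "i \<in> J" "f i \<in> D" "j \<notin> J" "f j \<in> D"
    using separated_has_loop[OF assms] separated_has_loop[of "- J"] by blast
  then show False using loop_unique[of i j] by blast
qed

lemma span_D: "span D = UNIV"
proof -
  have "axis i 1 \<in> span D" for i
  proof -
    have "1 *\<^sub>R axis i 1 \<in> roots_B" by (rule loop_in_roots) simp
    then obtain k where "axis i 1 = (\<Sum>a\<in>D. k a *\<^sub>R a) \<or> axis i 1 = - (\<Sum>a\<in>D. k a *\<^sub>R a)"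
      using D_combination[of "axis i 1"] by auto
    moreover have sum: "(\<Sum>a\<in>D. k a *\<^sub>R a) \<in> span D"
      by (intro span_sum span_scale span_base)
    moreover have "- (\<Sum>a\<in>D. k a *\<^sub>R a) \<in> span D" by (rule span_neg[OF sum])
    ultimately show ?thesis by (elim disjE) (simp_all only:)
  qed
  note axis = this
  have "z \<in> span D" for z :: "real^'n"
  proof -
    have "(\<Sum>i\<in>UNIV. z $ i *\<^sub>R axis i 1) \<in> span D" by (intro span_sum span_scale axis)
    then show ?thesis by (simp only: scalar_mult_eq_scaleR[symmetric] basis_expansion)
  qed
  then show ?thesis by auto
qed

lemma card_D: "card D = CARD('n)"
  using dim_eq_card_independent[OF D_independent] dim_span[of D] unfolding span_D by simp

definition edge_root :: "real^'n \<Rightarrow> bool" where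
  "edge_root a \<longleftrightarrow> (\<exists>i j s t. i \<noteq> j \<and> s \<in> {1, -1} \<and> t \<in> {1, -1} \<and>
    a = s *\<^sub>R axis i 1 + t *\<^sub>R axis j 1)"

text \<open>The reflection in this vector is the transposition of \<open>i\<close> and
  \<open>j\<close>. The order of the two indices is left to the choice and affects only the sign of
  the vector.\<close>

definition unsigned :: "real^'n \<Rightarrow> real^'n" where
  "unsigned a = (SOME b. \<exists>i j s t. i \<noteq> j \<and> s \<in> {1, -1} \<and> t \<in> {1, -1} \<and>
    a = s *\<^sub>R axis i 1 + t *\<^sub>R axis j 1 \<and> b = axis i 1 - axis j 1)"

lemma unsigned:
  assumes "edge_root a"
  obtains i j s t where "i \<noteq> j" "s \<in> {1, -1}" "t \<in> {1, -1}"
    "a = s *\<^sub>R axis i 1 + t *\<^sub>R axis j 1" "unsigned a = axis i 1 - axis j 1"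
proof -
  have "\<exists>b i j s t. i \<noteq> j \<and> s \<in> {1, -1} \<and> t \<in> {1, -1} \<and>
    a = s *\<^sub>R axis i 1 + t *\<^sub>R axis j 1 \<and> b = axis i 1 - axis j (1::real)"
    using assms unfolding edge_root_def by blast
  from someI_ex[OF this] show ?thesis unfolding unsigned_def[symmetric] using that by blast
qed

lemma D_edge_or_loop:
  assumes "a \<in> D"
  shows "edge_root a \<or> (\<exists>i. a = f i)"
  using D_roots[OF assms]
proof (cases rule: root_cases)
  case (loop i s)
  then show ?thesis using loop_in_D assms by auto
next
  case (edge i j s t)
  then show ?thesis unfolding edge_root_def by blast
qed

lemma not_edge_root_f: "\<not> edge_root (f i)"
proof
  assume "edge_root (f i)"
  then obtain j l s t where jl: "j \<noteq> l" "s \<in> {1, -1}" "t \<in> {1, -1}"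
      "f i = s *\<^sub>R axis j 1 + t *\<^sub>R axis l (1::real)"
    unfolding edge_root_def by blast
  then have "f i $ j \<noteq> 0" "f i $ l \<noteq> 0" by (auto simp: axis_def)
  then show False using jl(1) by (auto simp: f_def axis_def split: if_splits)
qed

text \<open>Orthogonality says that \<open>x\<close> has equal entries at both ends of every edge,
  so the level sets of \<open>x\<close> are separated.\<close>

lemma orthogonal_unsigned_constant:
  assumes "\<And>a. \<lbrakk>a \<in> D; edge_root a\<rbrakk> \<Longrightarrow> x \<bullet> unsigned a = 0"
  shows "x $ i = x $ j"
proof -
  let ?J = "{l. x $ l = x $ j}"
  have "separated ?J"
    unfolding separated_def
  proof
    fix a assume a: "a \<in> D"
    from D_edge_or_loop[OF a] show "(\<forall>i\<in>?J. a $ i = 0) \<or> (\<forall>i. i \<notin> ?J \<longrightarrow> a $ i = 0)"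
    proof
      assume edge: "edge_root a"
      then obtain k l s t where kl: "a = s *\<^sub>R axis k 1 + t *\<^sub>R axis l 1"
          "unsigned a = axis k 1 - axis l 1"
        using unsigned by metis
      then have "x $ k = x $ l"
        using assms[OF a edge] by (simp add: inner_diff_right inner_axis)
      note eq = this
      have zero: "a $ i = 0" if "i \<noteq> k" "i \<noteq> l" for i using that by (simp add: kl(1) axis_def)
      show ?thesis
      proof (cases "x $ k = x $ j")
        case True
        have "a $ i = 0" if "i \<notin> ?J" for i
        proof (rule zero)
          show "i \<noteq> k" using that True by blast
          show "i \<noteq> l" using that True eq by auto
        qed
        then show ?thesis by blast
      next
        case False
        have "a $ i = 0" if "i \<in> ?J" for i
        proof (rule zero)
          show "i \<noteq> k" using that False by blast
          show "i \<noteq> l" using that False eq by auto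
        qed
        then show ?thesis by blast
      qed
    next
      assume "\<exists>i. a = f i"
      then obtain l where l: "a = f l" by blast
      have zero: "a $ i = 0" if "i \<noteq> l" for i using that by (simp add: l f_def axis_def)
      show ?thesis
      proof (cases "l \<in> ?J")
        case True
        have "a $ i = 0" if "i \<notin> ?J" for i using zero[of i] that True by blast
        then show ?thesis by blast
      next
        case False
        have "a $ i = 0" if "i \<in> ?J" for i using zero[of i] that False by blast
        then show ?thesis by blast
      qed
    qed
  qed
  then have "?J = UNIV" by (rule separated_eq_UNIV) auto
  then show ?thesis by auto
qed

end

lemma refl_edge_axis:
  assumes "k \<noteq> l" "s \<in> {1, -1}" "t \<in> {1, -1}"
  shows "refl_matrix (s *\<^sub>R axis k 1 + t *\<^sub>R axis l 1) *v axis j 1 =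
    (if j = k \<or> j = l then - (s * t) else 1) *\<^sub>R axis (Transposition.transpose k l j) 1"
proof -
  let ?a = "s *\<^sub>R axis k 1 + t *\<^sub>R axis l (1::real)"
  have st: "s * s = 1" "t * t = 1" using assms by auto
  have aa: "?a \<bullet> ?a = 2"
    using assms(1) st by (simp add: inner_add_left inner_add_right axis_inner_axis)
  have aj: "axis j 1 \<bullet> ?a = (if j = k then s else if j = l then t else 0)"
    using assms(1) by (simp add: inner_add_right axis_inner_axis)
  show ?thesis
    unfolding refl_matrix_mult aa aj using assms(1) st
    by (auto simp: Transposition.transpose_def scaleR_right_distrib mult.commute)
qed

context type_B_simple_system
begin

lemma loop_exists: "\<exists>i. f i \<in> D"
  using separated_has_loop[of UNIV] by (auto simp: separated_def)

lemma length_edges: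
  assumes "distinct as" "set as = D"
  shows "length (filter edge_root as) + 1 = CARD('n)"
proof -
  obtain i where i: "f i \<in> D" using loop_exists by blast
  have "{a \<in> D. \<not> edge_root a} = {f i}"
  proof (intro equalityI subsetI)
    fix a assume "a \<in> {a \<in> D. \<not> edge_root a}"
    then obtain j where "a = f j" "f j \<in> D" using D_edge_or_loop[of a] by auto
    then show "a \<in> {f i}" using loop_unique[OF i, of j] by simp
  qed (use i not_edge_root_f in auto)
  then have "D = insert (f i) (set (filter edge_root as))" using assms(2) by auto
  then have "card D = card (insert (f i) (set (filter edge_root as)))" by (rule arg_cong)
  also have "\<dots> = Suc (card (set (filter edge_root as)))"
    using not_edge_root_f by (intro card_insert_disjoint) simp_all
  finally have "card D = card (set (filter edge_root as)) + 1" by simp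
  then show ?thesis using distinct_card[of "filter edge_root as"] assms(1) card_D by simp
qed

text \<open>Only constant vectors are orthogonal to these \<open>n - 1\<close> vectors, so their
  span has dimension at least \<open>n - 1\<close>, which leaves no room for a dependence or a
  repetition. In terms of graphs, a connected graph with \<open>n - 1\<close> edges is a
  tree.\<close>

lemma independent_unsigned:
  assumes "distinct as" "set as = D"
  shows "independent (set (map unsigned (filter edge_root as)))"
    and "distinct (map unsigned (filter edge_root as))"
proof -
  let ?l = "map unsigned (filter edge_root as)"
  let ?U = "set ?l"
  let ?O = "{y \<in> UNIV. \<forall>x\<in>span ?U. orthogonal x y}"
  have "?O \<subseteq> span {\<chi> i. 1}"
  proof
    fix y assume y: "y \<in> ?O"
    have "y \<bullet> unsigned a = 0" if "a \<in> D" "edge_root a" for a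
    proof -
      have "unsigned a \<in> span ?U" using that assms(2) by (intro span_base) auto
      then have "unsigned a \<bullet> y = 0" using y unfolding orthogonal_def by blast
      then show ?thesis by (simp add: inner_commute)
    qed
    then have "y $ i = y $ j" for i j by (rule orthogonal_unsigned_constant)
    then have "y = (y $ undefined) *\<^sub>R (\<chi> i. 1)" by (simp add: vec_eq_iff)
    moreover have "(y $ undefined) *\<^sub>R (\<chi> i. (1::real)) \<in> span {\<chi> i. (1::real)}"
      by (intro span_scale span_base) simp
    ultimately show "y \<in> span {\<chi> i. 1}" by (rule ssubst)
  qed
  then have "dim ?O \<le> 1" using dim_le_card[of ?O "{\<chi> i. 1}"] by simp
  moreover have "dim ?O + dim (span ?U) = dim (UNIV :: (real^'n) set)"
    by (rule dim_subspace_orthogonal_to_vectors) auto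
  ultimately have dim: "length ?l \<le> dim ?U"
    using length_edges[OF assms] by simp
  then have "card ?U \<le> dim ?U" using card_length[of ?l] by simp
  then show ind: "independent ?U"
    by (intro card_le_dim_spanning[of ?U ?U]) (auto intro: span_base)
  then have "card ?U = length ?l" using dim dim_eq_card_independent[OF ind] card_length[of ?l] by simp
  then show "distinct ?l" by (rule card_distinct)
qed

text \<open>Forgetting signs is a homomorphism onto permutations, under which the edges become
  transpositions and the loop becomes trivial.\<close>

lemma list_prod_unsigned:
  assumes "set bs \<subseteq> D"
  shows "\<exists>j s. s \<in> {1, -1} \<and> list_prod (map refl_matrix bs) *v axis i 1 = s *\<^sub>R axis j 1 \<and>
    list_prod (map refl_matrix (map unsigned (filter edge_root bs))) *v axis i 1 = axis j 1"
  using assms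
proof (induction bs)
  case Nil
  then show ?case by (intro exI[of _ i] exI[of _ 1]) simp
next
  case (Cons a bs)
  let ?P = "\<lambda>bs. list_prod (map refl_matrix bs)"
  let ?U = "\<lambda>bs. list_prod (map refl_matrix (map unsigned (filter edge_root bs)))"
  obtain j s where js: "s \<in> {1, -1}" "?P bs *v axis i 1 = s *\<^sub>R axis j 1" "?U bs *v axis i 1 = axis j 1"
    using Cons by auto
  have P: "?P (a # bs) *v axis i 1 = s *\<^sub>R (refl_matrix a *v axis j 1)"
    using js(2) by (simp add: matrix_vector_mul_assoc[symmetric] matrix_vector_mult_scaleR)
  show ?case
  proof (cases "edge_root a")
    case True
    then obtain k l u t where kl: "k \<noteq> l" "u \<in> {1, -1}" "t \<in> {1, -1}"
        "a = u *\<^sub>R axis k 1 + t *\<^sub>R axis l 1" "unsigned a = axis k 1 - axis l 1"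
      by (rule unsigned)
    let ?j = "Transposition.transpose k l j"
    let ?v = "if j = k \<or> j = l then - (u * t) else 1"
    have "refl_matrix a *v axis j 1 = ?v *\<^sub>R axis ?j 1"
      unfolding kl(4) by (rule refl_edge_axis[OF kl(1-3)])
    then have "?P (a # bs) *v axis i 1 = (s * ?v) *\<^sub>R axis ?j 1" by (simp only: P scaleR_scaleR)
    moreover have "?U (a # bs) *v axis i 1 = axis ?j 1"
      using refl_edge_axis[OF kl(1), of 1 "-1" j] True js(3)
      by (simp add: matrix_vector_mul_assoc[symmetric] kl(5))
    moreover have "s * ?v \<in> {1, -1}" using js(1) kl(2,3) by auto
    ultimately show ?thesis by blast
  next
    case False
    then obtain l where l: "a = f l" using D_edge_or_loop[of a] Cons.prems by auto
    have "refl_matrix a *v axis j 1 = (if j = l then -1 else 1) *\<^sub>R axis j 1"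
      using sig[of l] by (auto simp: l f_def refl_matrix_mult axis_inner_axis scaleR_2)
    then have "?P (a # bs) *v axis i 1 = (s * (if j = l then -1 else 1)) *\<^sub>R axis j 1"
      by (simp only: P scaleR_scaleR)
    moreover have "s * (if j = l then -1 else 1) \<in> {1, -1}" using js(1) by auto
    moreover have "?U (a # bs) *v axis i 1 = axis j 1" using js(3) False by simp
    ultimately show ?thesis by blast
  qed
qed

lemma signed_list_prod:
  assumes "set bs \<subseteq> D"
  shows "signed_permutation_matrix (list_prod (map refl_matrix bs))"
  using assms
  by (induction bs)
    (auto intro!: signed_permutation_matrix_mult signed_permutation_matrix_refl_root D_roots
      simp: signed_permutation_matrix_1)

lemma list_prod_no_fixed:
  assumes "distinct as" "set as = D" "list_prod (map refl_matrix as) *v x = x"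
  shows "x = 0"
proof -
  have "D \<subseteq> {y. x \<bullet> y = 0}"
    using list_prod_refl_fixed[of as x] assms D_independent by auto
  moreover have "subspace {y. x \<bullet> y = 0}" by (auto simp: subspace_def inner_add_right)
  ultimately have "span D \<subseteq> {y. x \<bullet> y = 0}" by (rule span_minimal)
  then have "x \<bullet> x = 0" unfolding span_D by blast
  then show ?thesis by simp
qed

text \<open>Forgetting signs turns the Coxeter element into a product of \<open>n - 1\<close> reflections in
  independent vectors \<open>axis i 1 - axis j 1\<close>, which fixes only the constant vectors. The indicator
  of an orbit is fixed as well.\<close>

lemma list_prod_transitive:
  assumes as: "distinct as" "set as = D" and "bij p"
    and p: "\<And>j. list_prod (map refl_matrix as) *v axis j 1 = s j *\<^sub>R axis (p j) 1"
  shows "\<exists>k. (p ^^ k) i = j"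
proof -
  let ?U = "list_prod (map refl_matrix (map unsigned (filter edge_root as)))"
  have U: "?U *v axis l 1 = axis (p l) 1" for l
  proof -
    have "set as \<subseteq> D" using as(2) by simp
    from list_prod_unsigned[OF this, of l] obtain j t where t: "t \<in> {1, -1}"
        "list_prod (map refl_matrix as) *v axis l 1 = t *\<^sub>R axis j 1"
        "?U *v axis l 1 = axis j 1"
      by blast
    from t p[of l] have jt: "t \<in> {1, -1}" "s l *\<^sub>R axis (p l) 1 = t *\<^sub>R axis j (1::real)"
        "?U *v axis l 1 = axis j 1"
      by simp_all
    have "(s l *\<^sub>R axis (p l) 1) $ j \<noteq> (0::real)" unfolding jt(2) using jt(1) by auto
    then have "j = p l" by (auto simp: axis_def split: if_splits)
    then show ?thesis using jt(3) by simp
  qed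
  define Orb where "Orb = range (\<lambda>k. (p ^^ k) i)"
  have "p ` Orb \<subseteq> Orb"
  proof
    fix l assume "l \<in> p ` Orb"
    then obtain k where "l = (p ^^ Suc k) i" unfolding Orb_def by auto
    then show "l \<in> Orb" unfolding Orb_def by blast
  qed
  moreover have inj: "inj_on p Orb" using \<open>bij p\<close> bij_is_inj inj_on_subset by blast
  ultimately have Orb: "p ` Orb = Orb" by (intro endo_inj_surj) simp_all
  define x :: "real^'n" where "x = (\<Sum>l\<in>Orb. axis l 1)"
  have "?U *v x = (\<Sum>l\<in>Orb. axis (p l) 1)" unfolding x_def by (simp only: matrix_vector_mult_sum U)
  also have "\<dots> = x" using sum.reindex[OF inj, of "\<lambda>l. axis l (1::real)"] Orb by (simp add: x_def)
  finally have fixed: "?U *v x = x" .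
  have "x \<bullet> unsigned a = 0" if "a \<in> D" "edge_root a" for a
    using that as by (intro list_prod_refl_fixed[OF independent_unsigned[OF as] fixed]) auto
  then have const: "x $ i = x $ j" by (rule orthogonal_unsigned_constant)
  have comp: "x $ l = (if l \<in> Orb then 1 else 0)" for l
  proof -
    have "x $ l = (\<Sum>m\<in>Orb. if m = l then 1 else 0)"
      unfolding x_def sum_component by (intro sum.cong refl) (simp add: axis_def)
    then show ?thesis by simp
  qed
  have "i \<in> Orb" unfolding Orb_def by (rule range_eqI[of _ _ 0]) simp
  then have "j \<in> Orb" using const comp[of i] comp[of j] by (simp split: if_splits)
  then show ?thesis unfolding Orb_def by auto
qed

end

text \<open>The underlying permutation is an \<open>n\<close>-cycle, so the \<open>n\<close>-th
  power of \<open>c\<close> maps a basis vector to plus or minus itself. The plus sign would make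
  the sum over the orbit a nonzero fixed vector; the minus sign is antiperiodicity.\<close>

lemma signed_cycle_of_transitive:
  fixes c :: "real^'n^'n"
  assumes c: "signed_permutation_matrix c" and nofix: "\<And>x. c *v x = x \<Longrightarrow> x = 0"
    and "bij p" and s: "\<And>j. s j \<in> {1, -1}" and p: "\<And>j. c *v axis j 1 = s j *\<^sub>R axis (p j) 1"
    and trans: "\<And>i j. \<exists>k. (p ^^ k) i = j"
  shows "\<exists>e. signed_cycle c e (int CARD('n))"
proof -
  define i0 :: 'n where "i0 = undefined"
  define F where "F k = ((*v) c ^^ k) (axis i0 1)" for k
  have F_Suc: "F (Suc k) = c *v F k" for k by (simp add: F_def)
  have F_axis: "\<exists>t\<in>{1, -1}. F k = t *\<^sub>R axis ((p ^^ k) i0) 1" for k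
  proof (induction k)
    case 0
    then show ?case by (intro bexI[of _ 1]) (simp_all add: F_def)
  next
    case (Suc k)
    then obtain t where t: "t \<in> {1, -1}" "F k = t *\<^sub>R axis ((p ^^ k) i0) 1" by blast
    have "F (Suc k) = (t * s ((p ^^ k) i0)) *\<^sub>R axis ((p ^^ Suc k) i0) 1"
      using t(2) p by (simp add: F_Suc matrix_vector_mult_scaleR)
    moreover have "t * s ((p ^^ k) i0) \<in> {1, -1}" using t(1) s[of "(p ^^ k) i0"] by auto
    ultimately show ?case by blast
  qed
  define d where "d = (LEAST d. 0 < d \<and> (p ^^ d) i0 = i0)"
  have "\<exists>d. 0 < d \<and> (p ^^ d) i0 = i0"
  proof -
    obtain j where "i0 = p j" using bij_is_surj[OF \<open>bij p\<close>] by (rule surjE)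
    moreover obtain k where "(p ^^ k) i0 = j" using trans by blast
    ultimately have "(p ^^ Suc k) i0 = i0" by simp
    then show ?thesis by blast
  qed
  from LeastI_ex[OF this] have d: "0 < d" "(p ^^ d) i0 = i0" by (simp_all add: d_def)
  have d_min: "\<not> (0 < k \<and> (p ^^ k) i0 = i0)" if "k < d" for k
    using not_less_Least[of k "\<lambda>d. 0 < d \<and> (p ^^ d) i0 = i0"] that by (simp add: d_def)
  have "inj_on (\<lambda>k. (p ^^ k) i0) {..<d}"
  proof (rule inj_onI)
    have False if "a < b" "b < d" "(p ^^ a) i0 = (p ^^ b) i0" for a b
    proof -
      have "(p ^^ a) ((p ^^ (b - a)) i0) = (p ^^ a) i0"
        using that funpow_add[of a "b - a" p] by simp
      moreover have "inj (p ^^ a)" using bij_is_inj[OF \<open>bij p\<close>] by (rule inj_fn)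
      ultimately have "(p ^^ (b - a)) i0 = i0" by (simp add: inj_eq)
      moreover have "0 < b - a" "b - a < d" using that by auto
      ultimately show False using d_min by blast
    qed
    then show "a = b" if "a \<in> {..<d}" "b \<in> {..<d}" "(p ^^ a) i0 = (p ^^ b) i0" for a b
      using that by (metis lessThan_iff linorder_neqE_nat)
  qed
  then have "card ((\<lambda>k. (p ^^ k) i0) ` {..<d}) = d" by (simp add: card_image)
  moreover have "(\<lambda>k. (p ^^ k) i0) ` {..<d} = UNIV"
  proof -
    have "j \<in> (\<lambda>k. (p ^^ k) i0) ` {..<d}" for j
    proof -
      obtain k where "(p ^^ k) i0 = j" using trans by blast
      then have "j = (p ^^ (k mod d)) i0" using funpow_mod_eq[OF d(2), of k] by simp
      then show ?thesis using d(1) by simp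
    qed
    then show ?thesis by blast
  qed
  ultimately have dn: "d = CARD('n)" by simp
  have Fd: "F d = - axis i0 1"
  proof (rule ccontr)
    assume "F d \<noteq> - axis i0 1"
    then have Fd1: "F d = F 0" using F_axis[of d] d(2) by (auto simp: F_def)
    let ?y = "\<Sum>k<d. F k"
    have "c *v ?y = (\<Sum>k<d. F (Suc k))" by (simp add: matrix_vector_mult_sum F_Suc)
    also have "\<dots> = ?y" using Fd1 sum.lessThan_Suc_shift[of F d] by (simp add: add.commute)
    finally have "?y = 0" by (rule nofix)
    \<comment> \<open>The orbit returns to \<open>i0\<close> first after \<open>d\<close> steps, so
      only the term \<open>k = 0\<close> has a nonzero entry there.\<close>
    moreover have "?y $ i0 = (\<Sum>k<d. if k = 0 then 1 else 0)"
      unfolding sum_component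
    proof (intro sum.cong refl)
      fix k assume "k \<in> {..<d}"
      then have "k = 0 \<or> (p ^^ k) i0 \<noteq> i0" using d_min[of k] by auto
      then show "F k $ i0 = (if k = 0 then 1 else 0)"
        using F_axis[of k] by (auto simp: F_def axis_def)
    qed
    ultimately show False using d(1) by simp
  qed
  have F_d: "F (k + d) = - F k" for k
  proof (induction k)
    case 0
    then show ?case using Fd by (simp add: F_def)
  next
    case (Suc k)
    then show ?case by (simp add: F_Suc matrix_vector_mult_minus)
  qed
  have F_mod: "F (k mod (2 * d)) = F k" for k
  proof -
    have "F (2 * d) = F 0" using F_d[of d] F_d[of 0] by (simp add: mult_2)
    then have "((*v) c ^^ (2 * d)) (axis i0 1) = axis i0 1" by (simp add: F_def)
    from funpow_mod_eq[OF this, of k] show ?thesis by (simp add: F_def)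
  qed
  let ?N = "int CARD('n)"
  \<comment> \<open>Reduction modulo the period extends the enumeration to negative
    integers.\<close>
  define e where "e m = F (nat (m mod (2 * ?N)))" for m
  have e_int: "e (int k) = F k" for k
  proof -
    have "nat (int k mod (2 * ?N)) = k mod (2 * d)"
      using nat_mod_distrib[of "int k" "2 * ?N"] by (simp add: dn nat_mult_distrib)
    then show ?thesis by (simp add: e_def F_mod)
  qed
  have e_add: "e (m + int j) = F (nat (m mod (2 * ?N)) + j)" for m j
  proof -
    have "e (m + int j) = e (m mod (2 * ?N) + int j)" by (simp add: e_def mod_add_left_eq)
    also have "m mod (2 * ?N) + int j = int (nat (m mod (2 * ?N)) + j)" by simp
    finally show ?thesis by (simp only: e_int)
  qed
  have "signed_cycle c e ?N"
  proof
    show "?N = int CARD('n)" by simp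
    show "signed_permutation_matrix c" by (rule c)
    fix m
    show "c *v e m = e (m + 1)" using e_add[of m 1] F_Suc by (simp add: e_def)
    show "e (m + ?N) = - e m" using e_add[of m d] F_d by (simp add: e_def dn)
    show "\<exists>i. \<exists>s\<in>{1, -1}. e m = s *\<^sub>R axis i 1" unfolding e_def using F_axis by blast
    fix i
    show "\<exists>m. e m = axis i 1"
    proof -
      obtain k where k: "(p ^^ k) i0 = i" using trans by blast
      then have "F k = axis i 1 \<or> F (k + d) = axis i 1" using F_axis[of k] F_d[of k] by auto
      then show ?thesis using e_int by metis
    qed
  qed
  then show ?thesis by blast
qed

lemma coxeter_element_signed_cycle:
  fixes c :: "real^'n^'n"
  assumes "coxeter_element c"
  shows "\<exists>e. signed_cycle c e (int CARD('n))"
proof -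
  obtain as where as: "distinct as" "simple_system (set as)"
      "c = foldr (\<lambda>a w. refl_matrix a \<otimes>\<^bsub>\<W>\<^esub> w) as \<one>\<^bsub>\<W>\<^esub>"
    using assms unfolding coxeter_element_def by blast
  interpret type_B_simple_system "set as" using as(2) by unfold_locales
  have c: "c = list_prod (map refl_matrix as)" unfolding as(3) by (induction as) simp_all
  have signed: "signed_permutation_matrix c" unfolding c by (rule signed_list_prod) simp
  then obtain p s where ps: "bij p" "\<forall>j. s j \<in> {1, -1::real}" "\<forall>j. c *v axis j 1 = s j *\<^sub>R axis (p j) 1"
    unfolding signed_permutation_matrix_iff by blast
  show ?thesis
  proof (rule signed_cycle_of_transitive[OF signed _ ps(1)])
    show "x = 0" if "c *v x = x" for x
      using list_prod_no_fixed[OF as(1) refl] that unfolding c by blast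
    show "\<exists>k. (p ^^ k) i = j" for i j
      using list_prod_transitive[OF as(1) refl ps(1), of s i j] ps(3) unfolding c by blast
  qed (use ps in auto)
qed

section \<open>The equivariant bijection\<close>

lemma park_class_eq_iff:
  fixes c u u' :: "real^'n^'n"
  assumes "signed_permutation_matrix u" "signed_permutation_matrix u'" "X \<in> NC_flats c" "X' \<in> NC_flats c"
  shows "park_class c u X = park_class c u' X' \<longleftrightarrow> X = X' \<and> (\<exists>z\<in>stabilizer X. u' = u ** z)"
proof
  let ?H = "stabilizer X"
  have one: "mat 1 \<in> ?H" by (simp add: stabilizer_def signed_permutation_matrix_1)
  assume eq: "park_class c u X = park_class c u' X'"
  have "(u', X') \<in> park_class c u' X'" using assms by (simp add: park_class_def park_rel_def)
  then have "(u', X') \<in> park_class c u X" using eq by simp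
  then have *: "X = X' \<and> u <#\<^bsub>\<W>\<^esub> ?H = u' <#\<^bsub>\<W>\<^esub> stabilizer X'"
    unfolding park_class_def park_rel_def Image_singleton_iff mem_Collect_eq prod.case by blast
  then have X: "X = X'" and cos: "u <#\<^bsub>\<W>\<^esub> ?H = u' <#\<^bsub>\<W>\<^esub> ?H" by blast+
  have "u' ** mat 1 \<in> u' <#\<^bsub>\<W>\<^esub> ?H" using one unfolding l_coset_def by (auto intro!: bexI[of _ "mat 1"])
  then have "u' \<in> u <#\<^bsub>\<W>\<^esub> ?H" using cos by simp
  then show "X = X' \<and> (\<exists>z\<in>?H. u' = u ** z)" using X unfolding l_coset_def by auto
next
  let ?H = "stabilizer X"
  assume "X = X' \<and> (\<exists>z\<in>?H. u' = u ** z)"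
  then obtain z where z: "X = X'" "z \<in> ?H" "u' = u ** z" by blast
  have sz: "signed_permutation_matrix z" and fz: "x \<in> X \<Longrightarrow> z *v x = x" for x
    using z(2) by (simp_all add: stabilizer_def)
  note tz = signed_permutation_matrix_transpose[OF sz]
  have z_mem: "z ** h \<in> ?H" if "h \<in> ?H" for h
    using that z(2) by (simp add: stabilizer_def signed_permutation_matrix_mult matrix_vector_mul_assoc[symmetric])
  have tz_mem: "transpose z ** h \<in> ?H" if "h \<in> ?H" for h
  proof -
    have "transpose z *v x = x" if "x \<in> X" for x
    proof -
      have "transpose z *v (z *v x) = x" unfolding matrix_vector_mul_assoc tz(2) by simp
      then show ?thesis using fz[OF that] by simp
    qed
    then have "(transpose z ** h) *v x = x" if "x \<in> X" for x
      using that \<open>h \<in> ?H\<close>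
      by (simp only: matrix_vector_mul_assoc[symmetric] stabilizer_def mem_Collect_eq)
    moreover have "signed_permutation_matrix (transpose z ** h)"
      using \<open>h \<in> ?H\<close> by (intro signed_permutation_matrix_mult tz(1)) (simp add: stabilizer_def)
    ultimately show ?thesis by (simp add: stabilizer_def)
  qed
  have zH: "(\<lambda>h. z ** h) ` ?H = ?H"
  proof (intro equalityI subsetI)
    fix h assume "h \<in> (\<lambda>h. z ** h) ` ?H"
    then obtain k where "k \<in> ?H" "h = z ** k" by (elim imageE)
    then show "h \<in> ?H" using z_mem by simp
  next
    fix h assume h: "h \<in> ?H"
    have "h = z ** (transpose z ** h)"
      using tz(2) matrix_left_right_inverse[of "transpose z" z] by (simp add: matrix_mul_assoc)
    then show "h \<in> (\<lambda>h. z ** h) ` ?H" using tz_mem[OF h] by (rule image_eqI)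
  qed
  have "u' <#\<^bsub>\<W>\<^esub> ?H = (\<lambda>h. u ** h) ` ((\<lambda>h. z ** h) ` ?H)"
    unfolding l_coset_def image_image by (auto simp: z(3) matrix_mul_assoc)
  also have "\<dots> = u <#\<^bsub>\<W>\<^esub> ?H" unfolding zH l_coset_def by auto
  finally show "park_class c u X = park_class c u' X'"
    using assms z(1) by (auto simp: park_class_def park_rel_def)
qed

lemma Park_eq: "Park c = {park_class c w X | w X. signed_permutation_matrix w \<and> X \<in> NC_flats c}"
proof (intro equalityI subsetI)
  fix P assume "P \<in> Park c"
  then obtain x where "x \<in> carrier \<W> \<times> NC_flats c" "P = park_rel c `` {x}"
    unfolding Park_def by (rule quotientE)
  then show "P \<in> {park_class c w X | w X. signed_permutation_matrix w \<and> X \<in> NC_flats c}"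
    unfolding park_class_def mem_Collect_eq
    by (intro exI[of _ "fst x"] exI[of _ "snd x"]) auto
next
  fix P assume "P \<in> {park_class c w X | w X. signed_permutation_matrix w \<and> X \<in> NC_flats c}"
  then obtain w X where "signed_permutation_matrix w" "X \<in> NC_flats c" "P = park_class c w X" by blast
  then show "P \<in> Park c" unfolding Park_def park_class_def by (auto intro: quotientI)
qed

section \<open>The cyclic action and the map to parking functions\<close>

context signed_cycle
begin

abbreviation cpow :: "int \<Rightarrow> real^'n^'n" where
  "cpow d \<equiv> c [^]\<^bsub>\<W>\<^esub> d"

lemma c_carrier: "c \<in> carrier \<W>"
  using signed_c by simp

lemma signed_cpow: "signed_permutation_matrix (cpow d)"
  using group.int_pow_closed[OF group_W c_carrier, of d] by simp

lemma cpow_mult: "cpow (a + b) = cpow a ** cpow b"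
  using group.int_pow_mult[OF group_W c_carrier, of a b] by simp

lemma cpow_inverse: "cpow (- d) ** cpow d = mat 1" "cpow d ** cpow (- d) = mat 1"
  using cpow_mult[of "- d" d] cpow_mult[of d "- d"] by simp_all

lemma nat_pow_e: "(c [^]\<^bsub>\<W>\<^esub> (k::nat)) *v e m = e (m + int k)"
proof (induction k arbitrary: m)
  case (Suc k)
  then show ?case using Suc[of "m + 1"]
    by (simp add: matrix_vector_mul_assoc[symmetric] c_e algebra_simps)
qed simp

lemma cpow_e: "cpow d *v e m = e (m + d)"
proof (cases d rule: int_cases2)
  case (nonneg k)
  then show ?thesis using nat_pow_e by (simp add: int_pow_int)
next
  case (nonpos k)
  have "cpow (- int k) *v (cpow (int k) *v e (m - int k)) = e (m - int k)"
    unfolding matrix_vector_mul_assoc cpow_inverse by simp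
  then show ?thesis using nat_pow_e[of k "m - int k"] nonpos by (simp add: int_pow_int)
qed

lemma ord_c: "group.ord \<W> c = 2 * CARD('n)"
proof -
  have "group.ord \<W> c dvd k \<longleftrightarrow> 2 * CARD('n) dvd k" for k :: nat
  proof -
    have "group.ord \<W> c dvd k \<longleftrightarrow> c [^]\<^bsub>\<W>\<^esub> k = mat 1"
      using group.pow_eq_id[OF group_W c_carrier, of k] by simp
    also have "\<dots> \<longleftrightarrow> 2 * N dvd int k"
    proof
      assume "c [^]\<^bsub>\<W>\<^esub> k = mat 1"
      then have "e (0 + int k) = e 0" using nat_pow_e[of k 0] by simp
      then show "2 * N dvd int k" by (simp add: e_eq_iff)
    next
      assume "2 * N dvd int k"
      then have "(c [^]\<^bsub>\<W>\<^esub> k) *v e m = mat 1 *v e m" for m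
        using nat_pow_e[of k m] by (simp add: e_eq_iff)
      then show "c [^]\<^bsub>\<W>\<^esub> k = mat 1" by (rule mat_eqI_e)
    qed
    also have "2 * N = int (2 * CARD('n))" by (simp add: N_eq)
    finally show ?thesis by (simp only: int_dvd_int_iff)
  qed
  then show ?thesis by (meson dvd_antisym dvd_refl)
qed

text \<open>Carries the action of \<open>C\<close> on flats over to noncrossing elements: the fixed
  space of the conjugate is the translate of the fixed space by \<open>cpow d\<close>.\<close>

definition conjugate :: "int \<Rightarrow> real^'n^'n \<Rightarrow> real^'n^'n" where
  "conjugate d w = cpow d ** w ** cpow (- d)"

lemma signed_conjugate:
  "signed_permutation_matrix w \<Longrightarrow> signed_permutation_matrix (conjugate d w)"
  by (simp add: conjugate_def signed_permutation_matrix_mult signed_cpow)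

text \<open>\<open>cpow d\<close> shifts the index of \<open>e\<close> by \<open>d\<close>, so
  conjugation becomes conjugation with a translation of the integers, which also keeps the
  window.\<close>

lemma lift_conjugate:
  assumes "signed_permutation_matrix w"
  shows "lift (conjugate d w) m = lift w (m - d) + d"
  using lift[OF assms, of "m - d"]
  by (intro lift_eqI) (simp_all add: conjugate_def matrix_vector_mul_assoc[symmetric] cpow_e)

lemma label_translate:
  assumes "\<And>m. g' m = g (m - d) + d"
  shows "label g' m = map_option (\<lambda>s. s + d) (label g (m - d))"
proof -
  have spans: "spans g' m s \<longleftrightarrow> spans g (m - d) (s - d)" for s
  proof -
    have "(\<exists>l\<ge>m. g' l = s) \<longleftrightarrow> (\<exists>l\<ge>m - d. g l = s - d)"
    proof
      assume "\<exists>l\<ge>m. g' l = s"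
      then obtain l where "m \<le> l" "g' l = s" by blast
      then have "m - d \<le> l - d" "g (l - d) = s - d" using assms[of l] by simp_all
      then show "\<exists>l\<ge>m - d. g l = s - d" by blast
    next
      assume "\<exists>l\<ge>m - d. g l = s - d"
      then obtain l where "m - d \<le> l" "g l = s - d" by blast
      then have "m \<le> l + d" "g' (l + d) = s" using assms[of "l + d"] by simp_all
      then show "\<exists>l\<ge>m. g' l = s" by blast
    qed
    then show ?thesis by (simp add: spans_def)
  qed
  show ?thesis
  proof (cases "label g (m - d)")
    case None
    then have "label g' m = None" by (simp add: label_eq_None_iff spans)
    with None show ?thesis by simp
  next
    case (Some s)
    have "spans g' m (s + d)" using Some by (simp add: label_eq_Some_iff spans)
    moreover have "t \<le> s + d" if "spans g' m t" for t
    proof -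
      have "t - d \<le> s" using Some that by (simp add: label_eq_Some_iff spans)
      then show ?thesis by simp
    qed
    ultimately have "label g' m = Some (s + d)" by (simp add: label_eq_Some_iff)
    with Some show ?thesis by simp
  qed
qed

lemma conjugate_NC:
  assumes "w \<in> NC c"
  shows "conjugate d w \<in> NC c"
proof -
  have w: "signed_permutation_matrix w" using assms mem_NC_iff by blast
  interpret nc_lift N "lift w" using assms NC_imp_nc_lift by blast
  have "nc_lift N (lift (conjugate d w))"
  proof
    show "0 < N" by (rule n_pos)
    show "inj (lift (conjugate d w))" by (rule inj_lift[OF signed_conjugate[OF w]])
    fix m
    note g = lift_conjugate[OF w, of d]
    show "lift (conjugate d w) (m + N) = lift (conjugate d w) m + N"
      by (rule lift_shift[OF signed_conjugate[OF w]])
    show "m - N < lift (conjugate d w) m" "lift (conjugate d w) m \<le> m + N"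
      by (rule lift[OF signed_conjugate[OF w]])+
    fix j
    show "m < lift (conjugate d w) j \<and> lift (conjugate d w) j < lift (conjugate d w) m"
      if "m < lift (conjugate d w) m" "m < j" "j < lift (conjugate d w) m"
      using that up[of "m - d" "j - d"] unfolding g by auto
    show "lift (conjugate d w) m \<le> lift (conjugate d w) j \<and> lift (conjugate d w) j \<le> m"
      if "lift (conjugate d w) m \<le> m" "lift (conjugate d w) m \<le> j" "j \<le> m"
      using that down[of "m - d" "j - d"] unfolding g by auto
  qed
  then show ?thesis using NC_iff_nc_lift signed_conjugate[OF w] by blast
qed

lemma fixed_space_conjugate: "fixed_space (conjugate d w) = (\<lambda>x. cpow d *v x) ` fixed_space w"
proof (intro equalityI subsetI)
  fix x assume "x \<in> fixed_space (conjugate d w)"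
  then have x: "cpow d *v (w *v (cpow (- d) *v x)) = x"
    by (simp add: fixed_space_def conjugate_def matrix_vector_mul_assoc matrix_mul_assoc)
  have inv: "cpow (- d) *v (cpow d *v y) = y" "cpow d *v (cpow (- d) *v y) = y" for y
    unfolding matrix_vector_mul_assoc cpow_inverse by simp_all
  have "w *v (cpow (- d) *v x) = cpow (- d) *v x"
    using arg_cong[OF x, of "\<lambda>y. cpow (- d) *v y"] inv by simp
  then have "cpow (- d) *v x \<in> fixed_space w" by (simp add: fixed_space_def)
  then show "x \<in> (\<lambda>x. cpow d *v x) ` fixed_space w"
    by (rule image_eqI[rotated]) (simp only: inv)
next
  fix x assume "x \<in> (\<lambda>x. cpow d *v x) ` fixed_space w"
  then obtain y where y: "x = cpow d *v y" "w *v y = y" by (auto simp: fixed_space_def)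
  have "cpow (- d) *v x = y" unfolding y(1) matrix_vector_mul_assoc cpow_inverse by simp
  then have "conjugate d w *v x = x"
    using y unfolding conjugate_def matrix_vector_mul_assoc[symmetric] by simp
  then show "x \<in> fixed_space (conjugate d w)" by (simp add: fixed_space_def)
qed

text \<open>The conjugate has both positions and labels shifted by \<open>d\<close>. The shift of
  the positions is the action of \<open>cpow d\<close>, the shift of the labels multiplies the
  values by \<open>rt d\<close>; this is how scaling corresponds to the rotation of flats.\<close>

lemma park_vec_conjugate:
  assumes "w \<in> NC c"
  shows "park_vec (conjugate d w) = rt d *s (cmat (cpow d) *v park_vec w)"
proof (rule vec_eqI_coord)
  fix m
  have w: "signed_permutation_matrix w" using assms mem_NC_iff by blast
  have "coord (park_vec (conjugate d w)) m = phi (lift (conjugate d w)) m"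
    by (rule coord_park_vec[OF conjugate_NC[OF assms]])
  also have "\<dots> = rt d * phi (lift w) (m - d)"
    using label_translate[of "lift (conjugate d w)" "lift w" d m, OF lift_conjugate[OF w]]
    by (simp add: phi_def rt_add split: option.split)
  also have "phi (lift w) (m - d) = coord (cmat (cpow d) *v park_vec w) m"
    using coord_cmat[OF signed_cpow, of d "m - d" m "park_vec w"] coord_park_vec[OF assms, of "m - d"]
    by (simp add: cpow_e)
  also have "rt d * \<dots> = coord (rt d *s (cmat (cpow d) *v park_vec w)) m"
    by (simp add: coord_def)
  finally show "coord (park_vec (conjugate d w)) m = coord (rt d *s (cmat (cpow d) *v park_vec w)) m" .
qed

text \<open>The stabilizer of the flat is the isotropy group of the parking vector, and an orbit
  contains only one parking vector. One direction makes \<open>park_of\<close> well defined, the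
  other makes it injective.\<close>

lemma park_class_eq_iff_park_vec:
  assumes u: "signed_permutation_matrix u" "signed_permutation_matrix u'"
    and w: "w \<in> NC c" "w' \<in> NC c"
  shows "park_class c u (fixed_space w) = park_class c u' (fixed_space w') \<longleftrightarrow>
    cmat u *v park_vec w = cmat u' *v park_vec w'"
proof -
  have flats: "fixed_space w \<in> NC_flats c" "fixed_space w' \<in> NC_flats c"
    using w by (auto simp: NC_flats_def)
  show ?thesis unfolding park_class_eq_iff[OF u flats]
  proof
    assume "fixed_space w = fixed_space w' \<and> (\<exists>z\<in>stabilizer (fixed_space w). u' = u ** z)"
    then obtain z where z: "z \<in> stabilizer (fixed_space w)" "u' = u ** z" and "w = w'"
      using NC_eqI[OF w] by blast
    then show "cmat u *v park_vec w = cmat u' *v park_vec w'"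
      using z(1) unfolding stabilizer_iff[OF w(1)]
      by (simp add: cmat_mult matrix_vector_mul_assoc[symmetric])
  next
    assume eq: "cmat u *v park_vec w = cmat u' *v park_vec w'"
    have ww: "w = w'" by (rule park_vec_orbit_unique[OF w u eq])
    note tu = signed_permutation_matrix_transpose[OF u(1)]
    let ?z = "transpose u ** u'"
    have "cmat ?z *v park_vec w = cmat (transpose u) *v (cmat u *v park_vec w)"
      using eq ww by (simp add: cmat_mult matrix_vector_mul_assoc[symmetric])
    also have "\<dots> = park_vec w"
      unfolding matrix_vector_mul_assoc cmat_mult[symmetric] tu(2) cmat_mat_1 by simp
    finally have "?z \<in> stabilizer (fixed_space w)"
      unfolding stabilizer_iff[OF w(1)] using signed_permutation_matrix_mult[OF tu(1) u(2)] by simp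
    moreover have "u' = u ** ?z"
      using tu(2) matrix_left_right_inverse[of "transpose u" u] by (simp add: matrix_mul_assoc)
    ultimately show "fixed_space w = fixed_space w' \<and> (\<exists>z\<in>stabilizer (fixed_space w). u' = u ** z)"
      using ww by blast
  qed
qed

definition park_of :: "complex^'n \<Rightarrow> ((real^'n^'n) \<times> (real^'n) set) set" where
  "park_of v = (SOME P. \<exists>u w. signed_permutation_matrix u \<and> w \<in> NC c \<and>
    v = cmat u *v park_vec w \<and> P = park_class c u (fixed_space w))"

lemma park_of_eq:
  assumes "signed_permutation_matrix u" "w \<in> NC c"
  shows "park_of (cmat u *v park_vec w) = park_class c u (fixed_space w)"
  unfolding park_of_def
proof (rule some_equality)
  fix P
  assume "\<exists>u' w'. signed_permutation_matrix u' \<and> w' \<in> NC c \<and>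
    cmat u *v park_vec w = cmat u' *v park_vec w' \<and> P = park_class c u' (fixed_space w')"
  then show "P = park_class c u (fixed_space w)"
    using park_class_eq_iff_park_vec[OF assms(1) _ assms(2)] by auto
qed (use assms in blast)

lemma bij_betw_park_of: "bij_betw park_of locus (Park c)"
  unfolding bij_betw_def
proof (intro conjI inj_onI equalityI subsetI)
  fix v v' assume "v \<in> locus" "v' \<in> locus" and eq: "park_of v = park_of v'"
  obtain u w where u: "signed_permutation_matrix u" "w \<in> NC c" "v = cmat u *v park_vec w"
    using park_vec_orbit_exists[OF \<open>v \<in> locus\<close>] by blast
  obtain u' w' where u': "signed_permutation_matrix u'" "w' \<in> NC c" "v' = cmat u' *v park_vec w'"
    using park_vec_orbit_exists[OF \<open>v' \<in> locus\<close>] by blast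
  show "v = v'" using eq park_class_eq_iff_park_vec[OF u(1) u'(1) u(2) u'(2)]
    unfolding u(3) u'(3) park_of_eq[OF u(1,2)] park_of_eq[OF u'(1,2)] by blast
next
  fix P assume "P \<in> park_of ` locus"
  then obtain v where v: "v \<in> locus" "P = park_of v" by blast
  obtain u w where u: "signed_permutation_matrix u" "w \<in> NC c" "v = cmat u *v park_vec w"
    using park_vec_orbit_exists[OF v(1)] by blast
  then show "P \<in> Park c" using v(2) park_of_eq[OF u(1,2)] by (auto simp: Park_eq NC_flats_def)
next
  fix P assume "P \<in> Park c"
  then obtain u w where u: "signed_permutation_matrix u" "w \<in> NC c" "P = park_class c u (fixed_space w)"
    by (auto simp: Park_eq NC_flats_def)
  have "cmat u *v park_vec w \<in> locus" using cmat_locus park_vec_in_locus u by blast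
  then show "P \<in> park_of ` locus" unfolding u(3) park_of_eq[OF u(1,2), symmetric] by (rule imageI)
qed

lemma locus_act_eq: "locus_act c u d v = rt d *s (cmat u *v v)"
proof -
  have "exp (2 * complex_of_real pi * \<i> / of_nat (group.ord \<W> c)) = cis (pi / of_int N)"
    by (simp add: ord_c cis_conv_exp N_eq field_simps)
  then have "exp (2 * complex_of_real pi * \<i> / of_nat (group.ord \<W> c)) powi d = rt d"
    by (simp add: cis_power_int rt_def mult.commute)
  then show ?thesis by (simp add: locus_act_def)
qed

lemma park_of_equivariant: "park_equivariant c locus park_of"
  unfolding park_equivariant_def
proof (intro ballI allI impI)
  fix v and u w :: "real^'n^'n" and X and d :: int
  assume v: "v \<in> locus" and uw: "u \<in> carrier \<W>" "w \<in> carrier \<W>" and X: "X \<in> NC_flats c"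
    and eq: "park_of v = park_class c w X"
  obtain y where y: "y \<in> NC c" "X = fixed_space y" using X by (auto simp: NC_flats_def)
  obtain u' w' where u': "signed_permutation_matrix u'" "w' \<in> NC c" "v = cmat u' *v park_vec w'"
    using park_vec_orbit_exists[OF v] by blast
  have sw: "signed_permutation_matrix u" "signed_permutation_matrix w" using uw by simp_all
  have vw: "v = cmat w *v park_vec y"
    using eq park_class_eq_iff_park_vec[OF u'(1) sw(2) u'(2) y(1)]
    unfolding u'(3) park_of_eq[OF u'(1,2)] y(2) by blast
  let ?t = "u ** w ** cpow (- d)"
  have t: "signed_permutation_matrix ?t"
    by (intro signed_permutation_matrix_mult sw signed_cpow)
  \<comment> \<open>The factor \<open>cpow (- d)\<close> of the new representative cancels the
    \<open>cpow d\<close> in the parking vector of the conjugate, and the scalar \<open>rt d\<close>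
    remains.\<close>
  have "cmat ?t *v park_vec (conjugate d y) =
      rt d *s (cmat u *v (cmat w *v ((cmat (cpow (- d)) ** cmat (cpow d)) *v park_vec y)))"
    unfolding park_vec_conjugate[OF y(1)] vector_scalar_commute cmat_mult
    by (simp only: matrix_vector_mul_assoc matrix_mul_assoc)
  also have "\<dots> = locus_act c u d v"
    unfolding cmat_mult[symmetric] cpow_inverse cmat_mat_1 locus_act_eq vw by simp
  finally have "park_of (locus_act c u d v) = park_class c ?t (fixed_space (conjugate d y))"
    using park_of_eq[OF t conjugate_NC[OF y(1)], of d] by simp
  then show "park_of (locus_act c u d v) = park_class c
      (u \<otimes>\<^bsub>\<W>\<^esub> w \<otimes>\<^bsub>\<W>\<^esub> (c [^]\<^bsub>\<W>\<^esub> (- d))) ((\<lambda>x. (c [^]\<^bsub>\<W>\<^esub> d) *v x) ` X)"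
    unfolding fixed_space_conjugate y(2) by simp
qed

lemma power_eq_self_iff:
  "x ^ (2 * CARD('n) + 1) = x \<longleftrightarrow> x = 0 \<or> (\<exists>s. x = rt s)"
proof -
  let ?h = "2 * CARD('n)"
  have h: "0 < ?h" by simp
  have "x ^ ?h = 1 \<longleftrightarrow> (\<exists>s. x = rt s)"
  proof
    assume "x ^ ?h = 1"
    then have "x \<in> (\<lambda>k. cis (2 * pi * real k / real ?h)) ` {..<?h}"
      using Complex.bij_betw_roots_unity[OF h] by (simp add: bij_betw_def)
    then obtain k where "x = cis (2 * pi * real k / real ?h)" by blast
    then have "x = rt (int k)" by (simp add: rt_def) (simp add: N_eq)
    then show "\<exists>s. x = rt s" by blast
  next
    assume "\<exists>s. x = rt s"
    then obtain s where x: "x = rt s" by blast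
    have "rt s ^ k = rt (int k * s)" for k
    proof (induction k)
      case 0
      then show ?case by (simp add: rt_eq_1_iff)
    next
      case (Suc k)
      then show ?case by (simp add: rt_add distrib_right)
    qed
    then have "x ^ ?h = rt (int ?h * s)" by (simp only: x)
    also have "\<dots> = 1" unfolding rt_eq_1_iff by (simp add: N_eq)
    finally show "x ^ ?h = 1" .
  qed
  then show ?thesis by auto
qed

lemma locus_eq: "locus = parking_locus (pure_power (2 * CARD('n) + 1))"
  unfolding parking_locus_pure_power locus_def power_eq_self_iff ..

lemma card_locus: "card locus = (2 * CARD('n) + 1) ^ CARD('n)"
proof -
  let ?h = "2 * CARD('n)"
  have "{x :: complex. x = 0 \<or> (\<exists>s. x = rt s)} = insert 0 {x. x ^ ?h = 1}"
    unfolding power_eq_self_iff[symmetric] by auto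
  moreover have "card {x :: complex. x ^ ?h = 1} = ?h" "finite {x :: complex. x ^ ?h = 1}"
    using card_roots_unity_eq[of ?h] finite_roots_unity[of ?h] by simp_all
  moreover have "0 \<notin> {x :: complex. x ^ ?h = 1}" by (simp add: power_0_left)
  ultimately have "card {x :: complex. x = 0 \<or> (\<exists>s. x = rt s)} = ?h + 1" by simp
  then show ?thesis using card_vec_PiE[of "{x :: complex. x = 0 \<or> (\<exists>s. x = rt s)}", where 'n = 'n]
    by (simp add: locus_def)
qed

end

theorem mainTheorem3:
  fixes c :: "real^'n^'n"
  assumes "CARD('n) \<ge> 2"
    and "coxeter_element c"
  shows "group.ord \<W> c = 2 * CARD('n) \<and>
    (\<exists>\<Theta>. admissible_hsop (group.ord \<W> c) \<Theta> \<and>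
       card (parking_locus \<Theta>) = (group.ord \<W> c + 1) ^ CARD('n) \<and>
       (\<exists>f. bij_betw f (parking_locus \<Theta>) (Park c) \<and>
            park_equivariant c (parking_locus \<Theta>) f))"
proof -
  obtain e where "signed_cycle c e (int CARD('n))"
    using coxeter_element_signed_cycle[OF assms(2)] by blast
  then interpret signed_cycle c e "int CARD('n)" .
  have "admissible_hsop (group.ord \<W> c) (pure_power (group.ord \<W> c + 1) :: 'n \<Rightarrow> 'n cpoly)"
    by (rule admissible_hsop_pure_power) (simp add: ord_c)
  moreover have "locus = parking_locus (pure_power (group.ord \<W> c + 1))"
    using locus_eq by (simp add: ord_c)
  ultimately show ?thesis
    using ord_c card_locus bij_betw_park_of park_of_equivariant
    by (intro conjI exI[of _ "pure_power (group.ord \<W> c + 1)"] exI[of _ park_of]) simp_all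
qed

end
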